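(* Let $k$ be a field of characteristic zero and let $V$ be a braided vector space of diagonal type over $k$ (of finite rank $n\in\mathbb{N}$) such that $\boldsymbol{\Delta}(\mathcal{B}(V))$ is finite. Then the multiplicities of the elements of $\boldsymbol{\Delta}(\mathcal{B}(V))$ are one, and if $\alpha\in\boldsymbol{\Delta}^+(\mathcal{B}(V))$ then $\lambda\alpha\notin\boldsymbol{\Delta}^+(\mathcal{B}(V))$ for all $\lambda\in\mathbb{R}\setminus\{1\}$.
   Context: A braided vector space of diagonal type of rank $n$ is a $k$-vector space $V$ with a basis $x_1,\ldots,x_n$ and braiding $\sigma(x_i\otimes x_j)=q_{ij}x_j\otimes x_i$, where the structure constants $q_{ij}$ lie in $k\setminus\{0\}$. Its Nichols algebra $\mathcal{B}(V)$ is the quotient of the tensor algebra $T(V)$ by the direct sum over $m\ge 2$ of the kernels of the braided symmetrizers $\sum_{w\in S_m}\sigma_w$ on $V^{\otimes m}$, where $\sigma_w=\sigma_{i_1}\cdots\sigma_{i_r}$ for a reduced expression $w=s_{i_1}\cdots s_{i_r}$ and $\sigma_i$ is $\sigma$ applied to the tensor factors $i,i+1$. It is $\mathbb{Z}^n$-graded by $\deg x_i=\mathbf{e}_i$, where $\mathbf{e}_1,\ldots,\mathbf{e}_n$ is the standard basis of $\mathbb{Z}^n$. Let $\chi:\mathbb{Z}^n\times\mathbb{Z}^n\to k\setminus\{0\}$ be the bicharacter (bimultiplicative map) with $\chi(\mathbf{e}_i,\mathbf{e}_j)=q_{ij}$. By a theorem of Kharchenko, $\mathcal{B}(V)$ has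 a (restricted) Poincaré–Birkhoff–Witt basis: there is a totally ordered set $S$ of $\mathbb{Z}^n$-homogeneous elements (iterated skew-commutators of the $x_i$), called PBW generators, and heights $h(u)\in\{2,3,\ldots\}\cup\{\infty\}$, such that the monomials $u_1^{a_1}\cdots u_r^{a_r}$ with $r\ge 0$, $u_1>\cdots>u_r$ in $S$, $0<a_i<h(u_i)$, form a $k$-basis of $\mathcal{B}(V)$, and such that (P): the height of a PBW generator of degree $d$ is finite if and only if $2\le\mathrm{ord}\,\chi(d,d)<\infty$ ($\mathrm{ord}$ is the multiplicative order), and in this case the height equals $\mathrm{ord}\,\chi(d,d)$. $\boldsymbol{\Delta}^+(\mathcal{B}(V))\subset\mathbb{N}_0^n\setminus\{0\}$ denotes the set of degrees of the PBW generators counted with multiplicities; it is independent of the choice of a $\mathbb{Z}^n$-graded PBW basis satisfying (P). Set $\boldsymbol{\Delta}(\mathcal{B}(V)):=\boldsymbol{\Delta}^+(\mathcal{B}(V))\cup-\boldsymbol{\Delta}^+(\mathcal{B}(V))$ (a disjoint union). *)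

theory Defs
  imports
    "HOL-Analysis.Finite_Cartesian_Product"
    "HOL-Library.Poly_Mapping"
    "HOL-Library.Extended_Nat"
    "HOL-Combinatorics.Transposition"
    "HOL-Combinatorics.Permutations"
    "HOL-Algebra.QuotRing"
    "HOL-Algebra.Module"
begin

section \<open>The tensor algebra\<close>

text \<open>
  A braided vector space of diagonal type of rank \<open>n\<close> is given by its structure constants
  \<open>q :: 'n \<Rightarrow> 'n \<Rightarrow> 'k\<close>, where \<open>'n\<close> is a finite type with \<open>n\<close> elements that indexes the basis
  \<open>x\<^sub>i\<close>.  The words in the letters \<open>x\<^sub>i\<close> form a basis of \<open>T(V)\<close>, so \<open>T(V)\<close> is the monoid algebra
  of the free monoid.  The wrapper type is there because lists are not an instance of
  \<open>monoid_add\<close>; the additive class is what \<open>Poly_Mapping\<close> needs for its convolution product.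
\<close>

datatype 'n word = Word (letters: "'n list")

instantiation word :: (type) monoid_add
begin

definition "0 = Word []"

definition "u + v = Word (letters u @ letters v)"

instance
  by standard (simp_all add: zero_word_def plus_word_def)

end

type_synonym ('n, 'k) tensor = "'n word \<Rightarrow>\<^sub>0 'k"

definition tensor_ring :: "('n, 'k::field) tensor ring" where
  "tensor_ring = \<lparr>carrier = UNIV, mult = (*), one = 1, zero = 0, add = (+)\<rparr>"

definition tensor_power :: "nat \<Rightarrow> ('n, 'k::field) tensor set" where
  "tensor_power m = {f. \<forall>w \<in> Poly_Mapping.keys f. length (letters w) = m}"

definition word_degree :: "'n::finite word \<Rightarrow> int ^ 'n" where
  "word_degree w = (\<Sum>i\<leftarrow>letters w. axis i 1)"

definition tensor_component :: "int ^ 'n::finite \<Rightarrow> ('n, 'k::field) tensor set" where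
  "tensor_component d = {f. \<forall>w \<in> Poly_Mapping.keys f. word_degree w = d}"


section \<open>Braided symmetrizers\<close>

text \<open>Tensor factors are numbered from \<open>0\<close>: \<open>braid q i\<close> is the braiding
  \<open>x\<^sub>a \<otimes> x\<^sub>b \<mapsto> q\<^sub>a\<^sub>b x\<^sub>b \<otimes> x\<^sub>a\<close> on the factors \<open>i\<close> and \<open>i + 1\<close>.  It is only used on
  words of length at least \<open>i + 2\<close>.\<close>

definition swap_letters :: "nat \<Rightarrow> 'n word \<Rightarrow> 'n word" where
  "swap_letters i w =
    Word ((letters w)[i := letters w ! (i + 1), i + 1 := letters w ! i])"

definition braid ::
    "('n \<Rightarrow> 'n \<Rightarrow> 'k::field) \<Rightarrow> nat \<Rightarrow> ('n, 'k) tensor \<Rightarrow> ('n, 'k) tensor" where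
  "braid q i f = (\<Sum>w \<in> Poly_Mapping.keys f.
    Poly_Mapping.single (swap_letters i w)
      (Poly_Mapping.lookup f w * q (letters w ! i) (letters w ! (i + 1))))"

text \<open>\<open>[i\<^sub>1, \<dots>, i\<^sub>r]\<close> stands for the product \<open>s\<^sub>i\<^sub>1 \<cdots> s\<^sub>i\<^sub>r\<close> of adjacent transpositions.\<close>

definition perm_of_expr :: "nat list \<Rightarrow> nat \<Rightarrow> nat" where
  "perm_of_expr is = foldr (\<lambda>i p. transpose i (i + 1) \<circ> p) is id"

definition expr_of :: "nat \<Rightarrow> (nat \<Rightarrow> nat) \<Rightarrow> nat list \<Rightarrow> bool" where
  "expr_of m p is \<longleftrightarrow> (\<forall>i \<in> set is. i + 1 < m) \<and> perm_of_expr is = p"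

definition reduced_expr :: "nat \<Rightarrow> (nat \<Rightarrow> nat) \<Rightarrow> nat list \<Rightarrow> bool" where
  "reduced_expr m p is \<longleftrightarrow>
    expr_of m p is \<and> (\<forall>js. expr_of m p js \<longrightarrow> length is \<le> length js)"

text \<open>Since \<open>braid q\<close> satisfies the braid relations, any reduced expression gives the same map.\<close>

definition braid_perm ::
    "('n \<Rightarrow> 'n \<Rightarrow> 'k::field) \<Rightarrow> nat \<Rightarrow> (nat \<Rightarrow> nat) \<Rightarrow> ('n, 'k) tensor \<Rightarrow> ('n, 'k) tensor" where
  "braid_perm q m p = foldr (\<lambda>i g. braid q i \<circ> g) (SOME is. reduced_expr m p is) id"

definition braided_symmetrizer ::
    "('n \<Rightarrow> 'n \<Rightarrow> 'k::field) \<Rightarrow> nat \<Rightarrow> ('n, 'k) tensor \<Rightarrow> ('n, 'k) tensor" where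
  "braided_symmetrizer q m f = (\<Sum>p | p permutes {..<m}. braid_perm q m p f)"

definition symmetrizer_kernel ::
    "('n \<Rightarrow> 'n \<Rightarrow> 'k::field) \<Rightarrow> nat \<Rightarrow> ('n, 'k) tensor set" where
  "symmetrizer_kernel q m = {f \<in> tensor_power m. braided_symmetrizer q m f = 0}"


section \<open>The Nichols algebra\<close>

definition nichols_ideal :: "('n \<Rightarrow> 'n \<Rightarrow> 'k::field) \<Rightarrow> ('n, 'k) tensor set" where
  "nichols_ideal q =
    {(\<Sum>m\<in>M. g m) | M g. finite M \<and> (\<forall>m\<in>M. 2 \<le> m \<and> g m \<in> symmetrizer_kernel q m)}"

definition nichols_class ::
    "('n \<Rightarrow> 'n \<Rightarrow> 'k::field) \<Rightarrow> ('n, 'k) tensor \<Rightarrow> ('n, 'k) tensor set" where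
  "nichols_class q f = nichols_ideal q +>\<^bsub>tensor_ring\<^esub> f"

text \<open>The quotient ring of \<open>T(V)\<close>, with its scalar multiplication;
  \<open>Poly_Mapping.single 0 c\<close> is the constant \<open>c\<close> in \<open>T(V)\<close>.\<close>

definition nichols_algebra ::
    "('n \<Rightarrow> 'n \<Rightarrow> 'k::field) \<Rightarrow> ('k, ('n, 'k) tensor set) module" where
  "nichols_algebra q = ring.extend (tensor_ring Quot nichols_ideal q)
    (module.fields (\<lambda>c X. \<Union>f\<in>X. nichols_class q (Poly_Mapping.single 0 c * f)))"

definition nichols_component ::
    "('n::finite \<Rightarrow> 'n \<Rightarrow> 'k::field) \<Rightarrow> int ^ 'n \<Rightarrow> ('n, 'k) tensor set set" where
  "nichols_component q d = nichols_class q ` tensor_component d"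


section \<open>PBW bases\<close>

definition basis_family ::
    "('k::field, 'b, 'm) module_scheme \<Rightarrow> 'i set \<Rightarrow> ('i \<Rightarrow> 'b) \<Rightarrow> bool" where
  "basis_family M I v \<longleftrightarrow> v \<in> I \<rightarrow> carrier M \<and>
    (\<forall>x \<in> carrier M. \<exists>!c :: 'i \<Rightarrow> 'k.
      finite {i. c i \<noteq> 0} \<and> {i. c i \<noteq> 0} \<subseteq> I \<and>
      x = (\<Oplus>\<^bsub>M\<^esub>i \<in> {i. c i \<noteq> 0}. c i \<odot>\<^bsub>M\<^esub> v i))"

text \<open>The total order on the set \<open>S\<close> of generators is the relation \<open>r\<close>, with \<open>(u, v) \<in> r\<close> for
  \<open>u \<le> v\<close>.  The list \<open>[(u\<^sub>1, a\<^sub>1), \<dots>, (u\<^sub>l, a\<^sub>l)]\<close> stands for the monomial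
  \<open>u\<^sub>1\<^bsup>a\<^sub>1\<^esup> \<cdots> u\<^sub>l\<^bsup>a\<^sub>l\<^esup>\<close>.\<close>

definition pbw_exponents ::
    "'b set \<Rightarrow> 'b rel \<Rightarrow> ('b \<Rightarrow> enat) \<Rightarrow> ('b \<times> nat) list set" where
  "pbw_exponents S r h = {us.
    (\<forall>(u, a) \<in> set us. u \<in> S \<and> 0 < a \<and> enat a < h u) \<and>
    sorted_wrt (\<lambda>(u, _) (v, _). (v, u) \<in> r \<and> u \<noteq> v) us}"

definition pbw_monomial :: "('b, 'm) ring_scheme \<Rightarrow> ('b \<times> nat) list \<Rightarrow> 'b" where
  "pbw_monomial R us = foldr (\<lambda>(u, a) y. (u [^]\<^bsub>R\<^esub> a) \<otimes>\<^bsub>R\<^esub> y) us \<one>\<^bsub>R\<^esub>"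

definition graded_pbw_basis ::
    "('n::finite \<Rightarrow> 'n \<Rightarrow> 'k::field) \<Rightarrow> ('n, 'k) tensor set set \<Rightarrow> ('n, 'k) tensor set rel \<Rightarrow>
      (('n, 'k) tensor set \<Rightarrow> enat) \<Rightarrow> bool" where
  "graded_pbw_basis q S r h \<longleftrightarrow>
    linear_order_on S r \<and>
    (\<forall>u \<in> S. (\<exists>d. u \<in> nichols_component q d) \<and> 2 \<le> h u) \<and>
    basis_family (nichols_algebra q) (pbw_exponents S r h) (pbw_monomial (nichols_algebra q))"

definition bichar :: "('n::finite \<Rightarrow> 'n \<Rightarrow> 'k::field) \<Rightarrow> int ^ 'n \<Rightarrow> int ^ 'n \<Rightarrow> 'k" where
  "bichar q a b = (\<Prod>i\<in>UNIV. \<Prod>j\<in>UNIV. q i j powi (a $ i * b $ j))"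

text \<open>The multiplicative order; \<open>Inf {} = \<infinity>\<close>.\<close>

definition mult_order :: "'k::field \<Rightarrow> enat" where
  "mult_order x = Inf {enat m | m. 0 < m \<and> x ^ m = 1}"

text \<open>Property (P): the heights are determined by the degrees.\<close>

definition height_property ::
    "('n::finite \<Rightarrow> 'n \<Rightarrow> 'k::field) \<Rightarrow> ('n, 'k) tensor set set \<Rightarrow>
      (('n, 'k) tensor set \<Rightarrow> enat) \<Rightarrow> bool" where
  "height_property q S h \<longleftrightarrow> (\<forall>d. \<forall>u \<in> S \<inter> nichols_component q d.
    (h u < \<infinity> \<longleftrightarrow> 2 \<le> mult_order (bichar q d d) \<and> mult_order (bichar q d d) < \<infinity>) \<and>
    (h u < \<infinity> \<longrightarrow> h u = mult_order (bichar q d d)))"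


section \<open>Degrees of the PBW generators\<close>

text \<open>
  The following depend on \<open>S\<close> only formally: every graded PBW basis with property (P) has the
  same degrees, with the same multiplicities, because the Hilbert series of the Nichols algebra
  determines them.  Elements of \<open>S\<close> are nonzero, so each lies in exactly one component.
\<close>

definition pos_mult ::
    "('n::finite \<Rightarrow> 'n \<Rightarrow> 'k::field) \<Rightarrow> ('n, 'k) tensor set set \<Rightarrow> int ^ 'n \<Rightarrow> enat" where
  "pos_mult q S d = (if finite (S \<inter> nichols_component q d)
    then enat (card (S \<inter> nichols_component q d)) else \<infinity>)"

definition pos_roots ::
    "('n::finite \<Rightarrow> 'n \<Rightarrow> 'k::field) \<Rightarrow> ('n, 'k) tensor set set \<Rightarrow> (int ^ 'n) set" where
  "pos_roots q S = {d. pos_mult q S d \<noteq> 0}"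

text \<open>The sum of the multiplicities in the two halves of the (disjoint) union.\<close>

definition root_mult ::
    "('n::finite \<Rightarrow> 'n \<Rightarrow> 'k::field) \<Rightarrow> ('n, 'k) tensor set set \<Rightarrow> int ^ 'n \<Rightarrow> enat" where
  "root_mult q S d = pos_mult q S d + pos_mult q S (- d)"

definition roots ::
    "('n::finite \<Rightarrow> 'n \<Rightarrow> 'k::field) \<Rightarrow> ('n, 'k) tensor set set \<Rightarrow> (int ^ 'n) set" where
  "roots q S = pos_roots q S \<union> uminus ` pos_roots q S"

definition real_vec :: "int ^ 'n::finite \<Rightarrow> real ^ 'n" where
  "real_vec d = (\<chi> i. real_of_int (d $ i))"

lemma bichar_axis: "bichar q (axis i 1) (axis j 1) = q i j"
proof -
  have "(\<Prod>j'\<in>UNIV. q i' j' powi (axis i 1 $ i' * axis j 1 $ j')) = (if i' = i then q i j else 1)"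
    for i'
  proof (cases "i' = i")
    case True
    then have "q i' j' powi (axis i 1 $ i' * axis j 1 $ j') = (if j' = j then q i j else 1)" for j'
      by (simp add: axis_def)
    with True show ?thesis by simp
  qed (simp add: axis_def)
  then show ?thesis by (simp add: bichar_def)
qed

lemma bichar_add_left:
  assumes "\<And>i j. q i j \<noteq> 0"
  shows "bichar q (a + b) c = bichar q a c * bichar q b c"
  unfolding bichar_def
  by (simp add: assms power_int_add distrib_right prod.distrib)

lemma bichar_add_right:
  assumes "\<And>i j. q i j \<noteq> 0"
  shows "bichar q a (b + c) = bichar q a b * bichar q a c"
  unfolding bichar_def
  by (simp add: assms power_int_add distrib_left prod.distrib)

end

theory Submission
  imports Defs "HOL-Library.Function_Algebras" "HOL-Combinatorics.Multiset_Permutations"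
begin

text \<open>
  The Nichols algebra \<open>B(q)\<close> is realised as the subalgebra of the quantum shuffle algebra that is
  generated by the letters; there its skew derivations strip the first or the last letter of a word.
  For a fixed \<open>i\<close> let \<open>K\<close> be the kernel in \<open>B(q)\<close> of the derivation that strips a last letter \<open>x\<^sub>i\<close>.
  Then \<open>B(q) = K \<otimes> k[x\<^sub>i]/(x\<^sub>i\<^sup>h)\<close>.  The braided adjoint action of \<open>x\<^sub>i\<close> and suitable iterated
  derivations act on \<open>K\<close> like the skew derivations of the Nichols algebra of the reflected matrix
  \<open>q'\<close>, while stripping a first letter \<open>x\<^sub>i\<close> acts like the adjoint action of \<open>x'\<^sub>i\<close>.  This gives
  \<open>dim K'\<^sub>s\<^sub>(\<^sub>d\<^sub>) \<le> dim K\<^sub>d\<close>, where \<open>s\<close> is the reflection of \<open>\<int>\<^sup>n\<close>, and equality since reflecting twice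
  returns \<open>q\<close>.  Hence, if the Hilbert series of \<open>B(q)\<close> factors over a finite family of degrees, then
  that of \<open>B(q')\<close> factors over the reflected family, in which only the simple root has changed its
  sign.  A simple root occurs exactly once and is not proportional to any other member of the
  family.  Reflecting repeatedly, every member becomes a simple root at some point.
\<close>

section \<open>Linear algebra in function spaces\<close>

text \<open>For j different from i, the new generator x'_j is the iterated commutator (ad x_i)^m_j
  (x_j), of degree s(e_j). Here m_j is the largest exponent for which it is nonzero; it exists
  because finitely many degrees bound the x_i-degree of the elements of K in which x_j occurs once.
  What travels along the reflections is a factorisation of the Hilbert series rather than a PBW
  basis, and the comparison map \<open>psi\<close> only has to be surjective. The PBW generators are
  kept as an index set \<open>S\<close> that never changes, with varying degrees: generators of
  equal degree remain different indices, so multiplicity one and the absence of proportional roots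
  become a single statement, namely that indices with proportional degrees are equal. Characteristic
  zero makes the quantum integers below the height in (P) nonzero, also for q_ii = 1.\<close>

definition fscale :: "'k::field \<Rightarrow> ('a \<Rightarrow> 'k) \<Rightarrow> 'a \<Rightarrow> 'k"  (infixr "*f" 75) where
  "c *f f = (\<lambda>x. c * f x)"

lemma fscale_apply: "(c *f f) x = c * f x"
  by (simp add: fscale_def)

text \<open>As simplification rules these would also rewrite unapplied functions.\<close>

declare plus_fun_apply [simp del] zero_fun_apply [simp del] minus_apply [simp del]
  uminus_apply [simp del]

lemmas pointwise = plus_fun_apply zero_fun_apply minus_apply uminus_apply fscale_apply

interpretation fs: vector_space fscale
  by standard (auto simp: fun_eq_iff pointwise algebra_simps)

interpretation fsp: vector_space_pair fscale fscale
  by standard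

definition lin :: "(('a \<Rightarrow> 'k::field) \<Rightarrow> 'b \<Rightarrow> 'k) \<Rightarrow> bool" where
  "lin T \<longleftrightarrow> (\<forall>f g. T (f + g) = T f + T g) \<and> (\<forall>c f. T (c *f f) = c *f T f)"

lemma linI [intro?]:
  "(\<And>f g. T (f + g) = T f + T g) \<Longrightarrow> (\<And>c f. T (c *f f) = c *f T f) \<Longrightarrow> lin T"
  by (simp add: lin_def)

lemma lin_add: "lin T \<Longrightarrow> T (f + g) = T f + T g"
  and lin_scale: "lin T \<Longrightarrow> T (c *f f) = c *f T f"
  by (simp_all add: lin_def)

lemma lin_linear: "lin T \<longleftrightarrow> Vector_Spaces.linear fscale fscale T"
  unfolding lin_def Vector_Spaces.linear_iff by (simp add: fsp.vector_space_pair_axioms fs.vector_space_axioms)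

lemma lin_zero: "lin T \<Longrightarrow> T 0 = 0"
  using lin_scale[of T 0 0] by simp

lemma lin_diff: "lin T \<Longrightarrow> T (f - g) = T f - T g"
  using lin_add[of T "f - g" g] by (simp add: algebra_simps)

lemma lin_sum:
  assumes T: "lin T"
  shows "T (\<Sum>i\<in>A. f i) = (\<Sum>i\<in>A. T (f i))"
  by (induction A rule: infinite_finite_induct) (simp_all only: sum.infinite sum.empty sum.insert
      lin_zero[OF T] lin_add[OF T] not_False_eq_True)

lemma lin_compose: "lin T \<Longrightarrow> lin U \<Longrightarrow> lin (\<lambda>f. T (U f))"
  unfolding lin_def by presburger

lemma lin_funpow:
  fixes T :: "('a \<Rightarrow> 'k::field) \<Rightarrow> 'a \<Rightarrow> 'k"
  assumes "lin T"
  shows "lin (T ^^ n)"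
proof (induction n)
  case 0
  show ?case by (simp add: lin_def)
next
  case (Suc n)
  show ?case using lin_compose[OF assms Suc] by (simp add: comp_def)
qed

lemma subspace_ker:
  assumes V: "fs.subspace V" and T: "lin T"
  shows "fs.subspace {v \<in> V. T v = 0}"
proof (rule fs.subspaceI)
  show "0 \<in> {v \<in> V. T v = 0}" using fs.subspace_0[OF V] lin_zero[OF T] by simp
next
  fix x y assume "x \<in> {v \<in> V. T v = 0}" "y \<in> {v \<in> V. T v = 0}"
  then show "x + y \<in> {v \<in> V. T v = 0}"
    using fs.subspace_add[OF V] lin_add[OF T, of x y] by auto
next
  fix c x assume "x \<in> {v \<in> V. T v = 0}"
  then show "c *f x \<in> {v \<in> V. T v = 0}"
    using fs.subspace_scale[OF V] lin_scale[OF T, of c x] fs.scale_zero_right[of c] by auto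
qed

text \<open>The ambient space has infinite dimension, so finiteness is supplied by a finite
  \<open>W\<close> whose span contains \<open>V\<close>. A basis \<open>b\<close> of the kernel is
  extended to a basis \<open>c\<close> of \<open>V\<close>; then \<open>T\<close> is injective on
  the span of \<open>c - b\<close> and maps \<open>c - b\<close> to a basis of the image.\<close>

lemma dim_kernel_image:
  assumes V: "fs.subspace V" and fin: "finite W" "V \<subseteq> fs.span W" and T: "lin T"
  shows "fs.dim V = fs.dim {v \<in> V. T v = 0} + fs.dim (T ` V)"
proof -
  define N where "N = {v \<in> V. T v = 0}"
  have sN: "fs.subspace N" unfolding N_def by (rule subspace_ker[OF V T])
  obtain b where b: "b \<subseteq> N" "fs.independent b" "N \<subseteq> fs.span b"
    using fs.maximal_independent_subset by blast
  have "b \<subseteq> V" using b N_def by auto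
  then obtain c where c: "b \<subseteq> c" "c \<subseteq> V" "fs.independent c" "V \<subseteq> fs.span c"
    using fs.maximal_independent_subset_extend[OF _ b(2)] by blast
  have "c \<subseteq> fs.span W" using c fin by auto
  then have fc: "finite c" using fs.independent_span_bound[OF fin(1) c(3)] by blast
  then have fb: "finite b" using c(1) finite_subset by blast
  have lT: "Vector_Spaces.linear fscale fscale T" using T lin_linear by blast
  have inj: "inj_on T (fs.span (c - b))"
  proof (subst fsp.linear_inj_on_iff_eq_0[OF lT fs.subspace_span], intro ballI impI)
    fix x assume x: "x \<in> fs.span (c - b)" "T x = 0"
    have "fs.span (c - b) \<subseteq> V" using c(2) V by (metis Diff_subset fs.span_minimal subset_trans)
    with x have "x \<in> N" by (auto simp: N_def)
    with b have xb: "x \<in> fs.span b" by auto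
    obtain u where u: "x = (\<Sum>v\<in>c - b. u v *f v)"
      using x(1) fs.span_finite[of "c - b"] fc by auto
    obtain w where w: "x = (\<Sum>v\<in>b. w v *f v)"
      using xb fs.span_finite[of "b"] fb by auto
    \<comment> \<open>The difference of the two expansions of \<open>x\<close>, over
      \<open>b\<close> and over \<open>c - b\<close>, is a linear relation on the basis
      \<open>c\<close>.\<close>
    define z where "z v = (if v \<in> b then w v else - u v)" for v
    have "(\<Sum>v\<in>c. z v *f v) = (\<Sum>v\<in>b. z v *f v) + (\<Sum>v\<in>c - b. z v *f v)"
      using sum.subset_diff[OF c(1) fc, of "\<lambda>v. z v *f v"] by (simp add: add.commute)
    also have "(\<Sum>v\<in>b. z v *f v) = x" unfolding w by (rule sum.cong) (auto simp: z_def)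
    also have "(\<Sum>v\<in>c - b. z v *f v) = - x"
      unfolding u sum_negf[symmetric] by (rule sum.cong) (auto simp: z_def)
    finally have "(\<Sum>v\<in>c. z v *f v) = 0" by (simp only: add.right_inverse)
    then have "\<forall>v\<in>c. z v = 0" using c(3) fc fs.dependent_finite[of c] by blast
    then have "w v = 0" if "v \<in> b" for v using c(1) that by (metis subsetD z_def)
    then show "x = 0" unfolding w by simp
  qed
  have ind: "fs.independent (T ` (c - b))"
    using fsp.linear_independent_injective_image[OF lT _ inj] c(3) fs.independent_mono by blast
  have "T ` V \<subseteq> fs.span (T ` (c - b))"
  proof -
    have "T ` V \<subseteq> T ` fs.span c" using c by auto
    also have "\<dots> = fs.span (T ` c)" using fsp.linear_span_image[OF lT] by simp
    also have "\<dots> \<subseteq> fs.span (T ` (c - b))"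
    proof (rule fs.span_minimal[OF _ fs.subspace_span], rule image_subsetI)
      fix x assume "x \<in> c"
      show "T x \<in> fs.span (T ` (c - b))"
      proof (cases "x \<in> b")
        case True
        then have "T x = 0" using b by (auto simp: N_def)
        then show ?thesis by (simp add: fs.span_zero)
      next
        case False
        then show ?thesis using \<open>x \<in> c\<close> by (auto intro: fs.span_base)
      qed
    qed
    finally show ?thesis .
  qed
  moreover have "T ` (c - b) \<subseteq> T ` V" using c by auto
  ultimately have "fs.dim (T ` V) = card (T ` (c - b))"
    using fs.basis_card_eq_dim ind by metis
  also have "\<dots> = card (c - b)"
    using inj by (intro card_image) (meson fs.span_superset inj_on_subset)
  also have "\<dots> = card c - card b" using card_Diff_subset[OF fb c(1)] .
  finally have 1: "fs.dim (T ` V) = card c - card b" .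
  have "fs.dim N = card b" using fs.basis_card_eq_dim[OF b(1,3,2)] by simp
  moreover have "fs.dim V = card c" using fs.basis_card_eq_dim[OF c(2,4,3)] by simp
  moreover have "card b \<le> card c" using card_mono[OF fc c(1)] .
  ultimately show ?thesis using 1 unfolding N_def by simp
qed

lemma dim_zero: "fs.dim {0::'a \<Rightarrow> 'k::field} = 0"
  using fs.dim_le_card[of "{0::'a \<Rightarrow> 'k}" "{}"] by (simp add: fs.span_empty)

lemma dim_image_le:
  assumes "fs.subspace V" "finite W" "V \<subseteq> fs.span W" "lin T"
  shows "fs.dim (T ` V) \<le> fs.dim V"
  using dim_kernel_image[OF assms] by simp

lemma dim_mono_finite:
  assumes "V \<subseteq> U" "finite W" "U \<subseteq> fs.span W"
  shows "fs.dim V \<le> fs.dim U"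
proof -
  obtain b where b: "b \<subseteq> V" "fs.independent b" "V \<subseteq> fs.span b" "card b = fs.dim V"
    using fs.basis_exists by blast
  obtain c where c: "c \<subseteq> U" "fs.independent c" "U \<subseteq> fs.span c" "card c = fs.dim U"
    using fs.basis_exists by blast
  have "finite c" using fs.independent_span_bound[OF assms(2) c(2)] c assms by blast
  moreover have "b \<subseteq> fs.span c" using b c assms by auto
  ultimately show ?thesis using fs.independent_span_bound[OF _ b(2)] b c by metis
qed

lemma dim_pos:
  assumes "v \<in> V" "v \<noteq> 0" "finite W" "V \<subseteq> fs.span W"
  shows "0 < fs.dim V"
proof -
  have "fs.dim {v} \<le> fs.dim V" using assms by (intro dim_mono_finite) auto
  moreover have "fs.dim {v} = 1"
    using fs.basis_card_eq_dim[of "{v}" "{v}"] assms fs.span_superset[of "{v}"] by simp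
  ultimately show ?thesis by simp
qed

section \<open>Operators on functions of words\<close>

text \<open>Functions of words form the quantum shuffle algebra, with unit \<open>vac\<close>.  Here \<open>lmul q j\<close> and
  \<open>rmul q j\<close> are the multiplications by \<open>x\<^sub>j\<close> from the left and from the right, \<open>dl k\<close> and \<open>dr k\<close> are
  the two kinds of skew derivations, and \<open>wt c\<close> is the action of the character of \<open>\<int>\<^sup>n\<close> with
  \<open>e\<^sub>a \<mapsto> c a\<close>.\<close>

definition vac :: "'n list \<Rightarrow> 'k::field" where
  "vac w = (if w = [] then 1 else 0)"

fun lmul :: "('n \<Rightarrow> 'n \<Rightarrow> 'k::field) \<Rightarrow> 'n \<Rightarrow> ('n list \<Rightarrow> 'k) \<Rightarrow> 'n list \<Rightarrow> 'k" where
  "lmul q j f [] = 0"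
| "lmul q j f (k # w) = (if j = k then f w else 0) + q j k * lmul q j (\<lambda>v. f (k # v)) w"

fun rmul :: "('n \<Rightarrow> 'n \<Rightarrow> 'k::field) \<Rightarrow> 'n \<Rightarrow> ('n list \<Rightarrow> 'k) \<Rightarrow> 'n list \<Rightarrow> 'k" where
  "rmul q j f [] = 0"
| "rmul q j f (k # w) =
    rmul q j (\<lambda>v. f (k # v)) w + (if k = j then (\<Prod>a\<leftarrow>w. q a j) * f w else 0)"

definition dl :: "'n \<Rightarrow> ('n list \<Rightarrow> 'k) \<Rightarrow> 'n list \<Rightarrow> 'k" where
  "dl k f = (\<lambda>w. f (k # w))"

definition dr :: "'n \<Rightarrow> ('n list \<Rightarrow> 'k) \<Rightarrow> 'n list \<Rightarrow> 'k" where
  "dr k f = (\<lambda>w. f (w @ [k]))"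

definition wt :: "('n \<Rightarrow> 'k::field) \<Rightarrow> ('n list \<Rightarrow> 'k) \<Rightarrow> 'n list \<Rightarrow> 'k" where
  "wt c f = (\<lambda>w. (\<Prod>a\<leftarrow>w. c a) * f w)"

lemma Nil_ops [simp]: "wt c f [] = f []"
  by (simp add: wt_def)

lemma Cons_dl: "f (k # w) = dl k f w"
  by (simp add: dl_def)

lemma snoc_dr: "f (w @ [k]) = dr k f w"
  by (simp add: dr_def)

lemma eq_by_dl: "f [] = g [] \<Longrightarrow> (\<And>k. dl k f = dl k g) \<Longrightarrow> f = g"
  by (rule ext) (metis Cons_dl list.exhaust)

lemmas scale_simps = fs.scale_left_distrib fs.scale_right_distrib fs.scale_left_diff_distrib
  fs.scale_right_diff_distrib

lemma lin_lmul: "lin (lmul q j)"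
proof
  show "lmul q j (f + g) = lmul q j f + lmul q j g" for f g
  proof
    show "lmul q j (f + g) w = (lmul q j f + lmul q j g) w" for w
      by (induction w arbitrary: f g) (simp_all add: plus_fun_def pointwise algebra_simps)
  qed
  show "lmul q j (c *f f) = c *f lmul q j f" for c f
  proof
    show "lmul q j (c *f f) w = (c *f lmul q j f) w" for w
      by (induction w arbitrary: f) (simp_all add: fscale_def algebra_simps)
  qed
qed

lemma lin_rmul: "lin (rmul q j)"
proof
  show "rmul q j (f + g) = rmul q j f + rmul q j g" for f g
  proof
    show "rmul q j (f + g) w = (rmul q j f + rmul q j g) w" for w
      by (induction w arbitrary: f g) (simp_all add: plus_fun_def pointwise algebra_simps)
  qed
  show "rmul q j (c *f f) = c *f rmul q j f" for c f
  proof
    show "rmul q j (c *f f) w = (c *f rmul q j f) w" for w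
      by (induction w arbitrary: f) (simp_all add: fscale_def algebra_simps)
  qed
qed

lemma lin_dl: "lin (dl k)" and lin_dr: "lin (dr k)" and lin_wt: "lin (wt c)"
  by (auto simp: lin_def dl_def dr_def wt_def fun_eq_iff pointwise algebra_simps)

lemmas lin_dr_pow = lin_funpow[OF lin_dr] and lin_lmul_pow = lin_funpow[OF lin_lmul]

lemmas op_add [simp] = lin_lmul[THEN lin_add] lin_rmul[THEN lin_add] lin_dl[THEN lin_add]
  lin_dr[THEN lin_add] lin_wt[THEN lin_add]
lemmas op_diff [simp] = lin_lmul[THEN lin_diff] lin_rmul[THEN lin_diff] lin_dl[THEN lin_diff]
  lin_dr[THEN lin_diff] lin_wt[THEN lin_diff]
lemmas op_scale [simp] = lin_lmul[THEN lin_scale] lin_rmul[THEN lin_scale] lin_dl[THEN lin_scale]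
  lin_dr[THEN lin_scale] lin_wt[THEN lin_scale]
lemmas op_zero [simp] = lin_lmul[THEN lin_zero] lin_rmul[THEN lin_zero] lin_dl[THEN lin_zero]
  lin_dr[THEN lin_zero] lin_wt[THEN lin_zero]

text \<open>Left multiplication inserts the letter \<open>j\<close> at every position and pays
  \<open>q j k\<close> for each letter \<open>k\<close> that it passes. So the first letter of the
  result is either the new one or the old first letter, already passed.\<close>

lemma dl_lmul: "dl k (lmul q j f) = (if j = k then f else 0) + q j k *f lmul q j (dl k f)"
  by (rule ext) (simp add: pointwise dl_def)

text \<open>A letter multiplied from the right reaches the front only by passing the whole word,
  which costs the character e_a -> \<open>q a j\<close>.\<close>

lemma dl_rmul:
  "dl k (rmul q j f) = rmul q j (dl k f) + (if k = j then wt (\<lambda>a. q a j) f else 0)"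
  by (rule ext) (simp add: pointwise dl_def wt_def)

lemma dl_wt: "dl k (wt c f) = c k *f wt c (dl k f)"
  by (rule ext) (simp add: pointwise dl_def wt_def)

lemma dr_wt: "dr k (wt c f) = c k *f wt c (dr k f)"
  by (rule ext) (simp add: pointwise dr_def wt_def)

lemma dr_dl: "dr k (dl l f) = dl l (dr k f)"
  by (rule ext) (simp add: pointwise dr_def dl_def)

lemma wt_wt: "wt c (wt d f) = wt (\<lambda>a. c a * d a) f"
proof
  show "wt c (wt d f) w = wt (\<lambda>a. c a * d a) f w" for w
    by (induction w arbitrary: f) (auto simp: wt_def algebra_simps)
qed

lemma wt_commute: "wt c (wt d f) = wt d (wt c f)"
  by (simp add: wt_wt mult.commute)

text \<open>The pattern of most operator identities below: both sides agree on the empty word, and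
  stripping a letter turns the identity for \<open>f\<close> into the same identity for
  \<open>dl a f\<close>. Hence induction over the word with \<open>f\<close> arbitrary.\<close>

lemma wt_lmul: "wt c (lmul q j f) = c j *f lmul q j (wt c f)"
proof
  show "wt c (lmul q j f) w = (c j *f lmul q j (wt c f)) w" for w
  proof (induction w arbitrary: f)
    case (Cons a w)
    have "dl a (wt c (lmul q j f)) w = dl a (c j *f lmul q j (wt c f)) w"
      using Cons[of "dl a f"] by (simp add: dl_wt dl_lmul pointwise algebra_simps)
    then show ?case by (simp only: Cons_dl)
  qed (simp add: pointwise)
qed

lemma wt_rmul: "wt c (rmul q j f) = c j *f rmul q j (wt c f)"
proof
  show "wt c (rmul q j f) w = (c j *f rmul q j (wt c f)) w" for w
  proof (induction w arbitrary: f)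
    case (Cons a w)
    have "dl a (wt c (rmul q j f)) w = dl a (c j *f rmul q j (wt c f)) w"
      using Cons[of "dl a f"] by (auto simp: dl_wt dl_rmul wt_commute pointwise algebra_simps)
    then show ?case by (simp only: Cons_dl)
  qed (simp add: pointwise)
qed

lemma dr_lmul: "dr k (lmul q j f) = lmul q j (dr k f) + (if j = k then wt (q j) f else 0)"
proof
  show "dr k (lmul q j f) w = (lmul q j (dr k f) + (if j = k then wt (q j) f else 0)) w" for w
  proof (induction w arbitrary: f)
    case Nil
    then show ?case by (simp add: dr_def pointwise)
  next
    case (Cons a w)
    have "dl a (dr k (lmul q j f)) w =
        dl a (lmul q j (dr k f) + (if j = k then wt (q j) f else 0)) w"
      using Cons[of "dl a f"] 
      by (auto simp: dr_dl[symmetric] dl_lmul dl_wt pointwise algebra_simps)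
    then show ?case by (simp only: Cons_dl)
  qed
qed

lemma dr_rmul: "dr k (rmul q j f) = (if j = k then f else 0) + q k j *f rmul q j (dr k f)"
proof
  show "dr k (rmul q j f) w = ((if j = k then f else 0) + q k j *f rmul q j (dr k f)) w" for w
  proof (induction w arbitrary: f)
    case Nil
    then show ?case by (simp add: dr_def pointwise)
  next
    case (Cons a w)
    have "dl a (dr k (rmul q j f)) w =
        dl a ((if j = k then f else 0) + q k j *f rmul q j (dr k f)) w"
      using Cons[of "dl a f"] 
      by (auto simp: dr_dl[symmetric] dl_rmul dr_wt pointwise algebra_simps)
    then show ?case by (simp only: Cons_dl)
  qed
qed

text \<open>Associativity of the quantum shuffle product when both outer factors are
  letters.\<close>

lemma lmul_rmul: "lmul q j (rmul q k f) = rmul q k (lmul q j f)"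
proof
  show "lmul q j (rmul q k f) w = rmul q k (lmul q j f) w" for w
  proof (induction w arbitrary: f)
    case (Cons a w)
    have "dl a (lmul q j (rmul q k f)) w = dl a (rmul q k (lmul q j f)) w"
      using Cons[of "dl a f"] by (auto simp: dl_lmul dl_rmul wt_lmul pointwise algebra_simps)
    then show ?case by (simp only: Cons_dl)
  qed (simp add: pointwise)
qed

lemma vac_ops [simp]: "dl k vac = 0" "dr k vac = 0" "wt c vac = vac"
  by (auto simp: dl_def dr_def wt_def vac_def pointwise)

lemma rmul_vac: "rmul q j vac = lmul q j vac"
proof (rule eq_by_dl)
  show "dl k (rmul q j vac) = dl k (lmul q j vac)" for k
    by (simp add: dl_rmul dl_lmul)
qed simp

section \<open>Quantum integers and powers of a letter\<close>

definition qnum :: "'k::field \<Rightarrow> nat \<Rightarrow> 'k" where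
  "qnum p n = (\<Sum>t<n. p ^ t)"

lemma qnum_simps [simp]: "qnum p 0 = 0" "qnum p (Suc 0) = 1"
  by (simp_all add: qnum_def)

lemma qnum_Suc: "qnum p (Suc n) = 1 + p * qnum p n"
  unfolding qnum_def sum.lessThan_Suc_shift by (simp add: sum_distrib_left)

lemma qnum_Suc': "qnum p (Suc n) = p ^ n + qnum p n"
  by (simp add: qnum_def add.commute)

lemma qnum_eq: "(1 - p) * qnum p n = 1 - p ^ n"
proof (induction n)
  case (Suc n)
  have "(1 - p) * qnum p (Suc n) = (1 - p) * p ^ n + (1 - p) * qnum p n"
    by (simp add: qnum_Suc' distrib_left)
  also have "\<dots> = (1 - p) * p ^ n + (1 - p ^ n)" by (simp only: Suc)
  finally show ?case by (simp add: algebra_simps)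
qed simp

lemma wt_lmul_pow: "wt c ((lmul q j ^^ n) f) = c j ^ n *f (lmul q j ^^ n) (wt c f)"
  by (induction n) (simp_all add: wt_lmul mult.commute)

text \<open>The truncated exponent \<open>n - 1\<close> is harmless at \<open>n = 0\<close>, since
  \<open>qnum p 0 = 0\<close>.\<close>

lemma dl_lmul_pow: "dl k ((lmul q i ^^ n) f) =
   (if k = i then qnum (q i i) n *f (lmul q i ^^ (n - 1)) f else 0) +
   q i k ^ n *f (lmul q i ^^ n) (dl k f)"
proof (induction n)
  case (Suc n)
  show ?case
    by (simp add: dl_lmul Suc scale_simps qnum_Suc)
      (cases n; simp add: mult.commute)
qed simp

lemma dr_lmul_pow: "dr k ((lmul q i ^^ n) f) = (lmul q i ^^ n) (dr k f) +
   (if k = i then qnum (q i i) n *f (lmul q i ^^ (n - 1)) (wt (q i) f) else 0)"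
proof (induction n)
  case (Suc n)
  show ?case
    by (simp add: dr_lmul Suc scale_simps qnum_Suc' wt_lmul_pow) (cases n; simp)
qed simp

lemma dr_rmul_pow: "dr k ((rmul q i ^^ n) f) =
   (if k = i then qnum (q i i) n *f (rmul q i ^^ (n - 1)) f else 0) +
   q k i ^ n *f (rmul q i ^^ n) (dr k f)"
proof (induction n)
  case (Suc n)
  show ?case
    by (simp add: dr_rmul Suc scale_simps qnum_Suc)
      (cases n; simp add: mult.commute)
qed simp

text \<open>Once the quantum integer vanishes, every \<open>dl k\<close> merely moves past the
  power. Induction then ends at the empty word, where a positive power of \<open>lmul\<close> is
  zero.\<close>

lemma lmul_pow_zero:
  assumes "qnum (q i i) n = 0" "0 < n"
  shows "(lmul q i ^^ n) f = 0"
proof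
  show "(lmul q i ^^ n) f w = 0 w" for w
  proof (induction w arbitrary: f)
    case Nil
    then show ?case using assms(2) by (cases n) (auto simp: pointwise)
  next
    case (Cons a w)
    then show ?case using assms by (simp add: Cons_dl dl_lmul_pow pointwise)
  qed
qed

lemma rmul_pow_zero:
  assumes "qnum (q i i) n = 0" "0 < n"
  shows "(rmul q i ^^ n) f = 0"
proof
  show "(rmul q i ^^ n) f w = 0 w" for w
  proof (induction w arbitrary: f rule: rev_induct)
    case Nil
    then show ?case using assms(2) by (cases n) (auto simp: pointwise)
  next
    case (snoc a w)
    then show ?case using assms by (simp add: snoc_dr dr_rmul_pow pointwise)
  qed
qed

lemma lmul_pow_vac_nonzero:
  assumes "\<And>t. 0 < t \<Longrightarrow> t \<le> n \<Longrightarrow> qnum (q i i) t \<noteq> 0"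
  shows "(lmul q i ^^ n) vac \<noteq> 0"
  using assms
proof (induction n)
  case 0
  then show ?case by (auto simp: vac_def fun_eq_iff pointwise)
next
  case (Suc n)
  then have "(lmul q i ^^ n) vac \<noteq> 0" by simp
  moreover have "dl i ((lmul q i ^^ Suc n) vac) = qnum (q i i) (Suc n) *f (lmul q i ^^ n) vac"
    by (simp only: dl_lmul_pow diff_Suc_1 vac_ops op_zero if_True)
      (simp add: fs.scale_zero_right lin_zero[OF lin_lmul_pow] lin_zero[OF lin_lmul])
  moreover have "qnum (q i i) (Suc n) \<noteq> 0" using Suc.prems by blast
  ultimately show ?case by (metis fs.scale_eq_0_iff op_zero(3))
qed

subsection \<open>The adjoint action\<close>

text \<open>\<open>adx q i 1\<close> is the braided adjoint action of \<open>x\<^sub>i\<close>.  The parameter is there because commuting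
  with \<open>dr i\<close> or \<open>dr k\<close> changes it.\<close>

definition adx :: "('n \<Rightarrow> 'n \<Rightarrow> 'k::field) \<Rightarrow> 'n \<Rightarrow> 'k \<Rightarrow> ('n list \<Rightarrow> 'k) \<Rightarrow> 'n list \<Rightarrow> 'k" where
  "adx q i c f = lmul q i f - c *f rmul q i (wt (q i) f)"

lemma lin_adx: "lin (adx q i c)"
  unfolding adx_def by (auto simp: lin_def algebra_simps scale_simps)

lemma adx_vac: "adx q i 1 vac = 0"
  by (simp add: adx_def rmul_vac)

lemmas adx_lin [simp] = lin_adx[THEN lin_add] lin_adx[THEN lin_diff] lin_adx[THEN lin_scale]
  lin_adx[THEN lin_zero]

lemma adx_Nil [simp]: "adx q i c f [] = 0"
  by (simp add: adx_def pointwise)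

lemma wt_adx: "wt c (adx q i d f) = c i *f adx q i d (wt c f)"
  by (simp add: adx_def wt_lmul wt_rmul scale_simps wt_commute mult.commute)

lemma dr_adx_same:
  "dr i (adx q i c f) = adx q i (c * q i i ^ 2) (dr i f) + (1 - c) *f wt (q i) f"
  by (simp add: adx_def dr_lmul dr_rmul dr_wt algebra_simps power2_eq_square
      scale_simps scale_simps)

lemma dr_adx_other:
  "k \<noteq> i \<Longrightarrow> dr k (adx q i c f) = adx q i (c * (q i k * q k i)) (dr k f)"
  by (simp add: adx_def dr_lmul dr_rmul dr_wt algebra_simps)

text \<open>For \<open>c = q i j * q j i\<close> and \<open>n = Suc t\<close> the scalar in the
  second summand is the expression whose first zero is the Cartan integer in \<open>cartan\<close>.
  For \<open>c = 0\<close> the lemma is about plain left multiplication.\<close>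

lemma dr_pow_adx:
  "(dr i ^^ n) (adx q i c f) = adx q i (c * q i i ^ (2 * n)) ((dr i ^^ n) f) +
     (qnum (q i i) n * (1 - c * q i i ^ (n - 1))) *f wt (q i) ((dr i ^^ (n - 1)) f)"
proof (induction n)
  case (Suc n)
  \<comment> \<open>On the right \<open>qnum (q i i) (Suc n)\<close> occurs twice after multiplying
    out; the two occurrences are expanded by the two different recursions for
    \<open>qnum\<close>.\<close>
  have *: "1 - c * q i i ^ (2 * n) + q i i * (qnum (q i i) n * (1 - c * q i i ^ (n - 1)))
      = qnum (q i i) (Suc n) * (1 - c * q i i ^ n)"
  proof (cases n)
    case (Suc n')
    have "qnum (q i i) (Suc n) * (1 - c * q i i ^ n) =
       qnum (q i i) (Suc n) - c * q i i ^ n * qnum (q i i) (Suc n)" by (simp add: algebra_simps)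
    also have "\<dots> = (1 + q i i * qnum (q i i) n) - c * q i i ^ n * (q i i ^ n + qnum (q i i) n)"
      by (simp only: qnum_Suc qnum_Suc'[symmetric])
    also have "\<dots> = 1 - c * q i i ^ (2 * n) +
        q i i * (qnum (q i i) n * (1 - c * q i i ^ (n - 1)))"
      using Suc by (simp add: algebra_simps mult_2_right power_add del: qnum_simps)
    finally show ?thesis by simp
  qed simp
  have "(dr i ^^ Suc n) (adx q i c f) = dr i (adx q i (c * q i i ^ (2 * n)) ((dr i ^^ n) f)) +
     (qnum (q i i) n * (1 - c * q i i ^ (n - 1))) *f
        dr i (wt (q i) ((dr i ^^ (n - 1)) f))"
    by (simp add: Suc)
  also have "dr i (wt (q i) ((dr i ^^ (n - 1)) f)) =
      q i i *f wt (q i) (dr i ((dr i ^^ (n - 1)) f))"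
    by (simp add: dr_wt)
  also have "(qnum (q i i) n * (1 - c * q i i ^ (n - 1))) *f q i i *f
        wt (q i) (dr i ((dr i ^^ (n - 1)) f)) =
     (q i i * (qnum (q i i) n * (1 - c * q i i ^ (n - 1)))) *f wt (q i) ((dr i ^^ n) f)"
    by (cases n) (simp_all add: mult.commute)
  finally have "(dr i ^^ Suc n) (adx q i c f) =
     adx q i (c * q i i ^ (2 * n) * q i i ^ 2) ((dr i ^^ Suc n) f) +
     (1 - c * q i i ^ (2 * n) + q i i * (qnum (q i i) n * (1 - c * q i i ^ (n - 1)))) *f
       wt (q i) ((dr i ^^ n) f)"
    by (simp add: dr_adx_same scale_simps)
  moreover have "c * q i i ^ (2 * n) * q i i ^ 2 = c * q i i ^ (2 * Suc n)"
    by (simp add: power2_eq_square mult_ac)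
  ultimately show ?case by (simp only: * diff_Suc_1)
qed simp

text \<open>The \<open>s\<close>-fold braided commutator of \<open>x\<^sub>i\<close> with \<open>x\<^sub>j\<close>, as a left multiplication.\<close>

primrec adx_mult :: "('n \<Rightarrow> 'n \<Rightarrow> 'k::field) \<Rightarrow> 'n \<Rightarrow> 'n \<Rightarrow> nat \<Rightarrow> ('n list \<Rightarrow> 'k) \<Rightarrow> 'n list \<Rightarrow> 'k"
  where
  "adx_mult q i j 0 = lmul q j"
| "adx_mult q i j (Suc s) =
    (\<lambda>f. lmul q i (adx_mult q i j s f) - (q i j * q i i ^ s) *f adx_mult q i j s (lmul q i f))"

lemma lin_adx_mult: "lin (adx_mult q i j s)"
proof (induction s)
  case 0
  then show ?case by (simp add: lin_lmul)
next
  case (Suc s)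
  show ?case
    by (simp add: lin_def lin_add[OF Suc] lin_scale[OF Suc] scale_simps algebra_simps)
qed

lemmas adx_mult_lin [simp] = lin_adx_mult[THEN lin_add] lin_adx_mult[THEN lin_diff] lin_adx_mult[THEN lin_scale]
  lin_adx_mult[THEN lin_zero]

lemma adx_mult_Nil [simp]: "adx_mult q i j s f [] = 0"
  by (induction s arbitrary: f) (simp_all add: pointwise)

lemma wt_adx_mult: "wt c (adx_mult q i j s f) = (c j * c i ^ s) *f adx_mult q i j s (wt c f)"
  by (induction s arbitrary: f) (simp_all add: wt_lmul scale_simps mult_ac)

lemma adx_mult_rmul: "adx_mult q i j s (rmul q k f) = rmul q k (adx_mult q i j s f)"
  by (induction s arbitrary: f) (simp_all add: lmul_rmul)

lemma adx_adx_mult: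
  "adx q i 1 (adx_mult q i j s f) = adx_mult q i j (Suc s) f + (q i j * q i i ^ s) *f adx_mult q i j s (adx q i 1 f)"
  by (simp add: adx_def wt_adx_mult adx_mult_rmul scale_simps)

text \<open>Every derivation except \<open>dr j\<close> passes the iterated commutator as if it were
  a constant. For \<open>dr i\<close> the two terms of the commutator both leave a weight
  \<open>wt (q i)\<close>, and the scalar \<open>q i j * q i i ^ s\<close> in
  \<open>adx_mult\<close> is the one for which they cancel. For \<open>dr j\<close> each further
  commutator contributes one factor of the product.\<close>

lemma dr_adx_mult:
  assumes "j \<noteq> i"
  shows "dr k (adx_mult q i j s f) = adx_mult q i j s (dr k f) +
    (if k = j then (\<Prod>t<s. 1 - q i i ^ t * (q i j * q j i)) *f (lmul q i ^^ s) (wt (q j) f) else 0)"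
proof (induction s arbitrary: f)
  case 0
  then show ?case by (simp add: dr_lmul)
next
  case (Suc s)
  have *: "lmul q i ((lmul q i ^^ s) g) = (lmul q i ^^ s) (lmul q i g)" for g
    by (simp add: funpow_swap1)
  show ?case using assms
    by (auto simp: dr_lmul Suc scale_simps wt_adx_mult wt_lmul * lin_scale[OF lin_lmul_pow]
        algebra_simps)
qed

text \<open>The hypothesis kills the extra term in \<open>dr_adx_mult\<close>, so every
  \<open>dr k\<close> only moves on to \<open>f\<close>, and stripping last letters leads to the
  empty word.\<close>

lemma adx_mult_eq_0:
  assumes "j \<noteq> i"
    and "(\<Prod>t<s. 1 - q i i ^ t * (q i j * q j i)) = 0 \<or> qnum (q i i) s = 0 \<and> 0 < s"
  shows "adx_mult q i j s f = 0"
proof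
  have *: "(\<Prod>t<s. 1 - q i i ^ t * (q i j * q j i)) *f (lmul q i ^^ s) g = 0" for g
    using assms(2) lmul_pow_zero[of q i s g] by auto
  show "adx_mult q i j s f w = 0 w" for w
    by (induction w arbitrary: f rule: rev_induct)
      (auto simp: snoc_dr dr_adx_mult[OF assms(1)] * pointwise)
qed

lemma dl_adx_same:
  "dl i (adx q i 1 f) = f - wt (\<lambda>a. q i a * q a i) f + q i i *f adx q i 1 (dl i f)"
  by (simp add: adx_def dl_lmul dl_rmul dl_wt wt_wt algebra_simps scale_simps)

lemma dl_adx_other:
  "k \<noteq> i \<Longrightarrow> dl k (adx q i 1 f) = q i k *f adx q i 1 (dl k f)"
  by (simp add: adx_def dl_lmul dl_rmul dl_wt algebra_simps scale_simps)

section \<open>Degrees\<close>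

definition wdeg :: "'n::finite list \<Rightarrow> int ^ 'n" where
  "wdeg w = (\<Sum>i\<leftarrow>w. axis i 1)"

lemma wdeg_simps [simp]: "wdeg [] = 0" "wdeg (k # w) = axis k 1 + wdeg w"
    "wdeg (v @ w) = wdeg v + wdeg w"
  by (simp_all add: wdeg_def)

lemma axis_zero [simp]: "axis i 0 = (0 :: int ^ 'n::finite)"
  by (simp add: vec_eq_iff axis_def)

lemma axis_add: "axis i (a + b) = axis i a + (axis i b :: int ^ 'n::finite)"
  by (simp add: vec_eq_iff axis_def)

lemma axis_uminus: "axis i (- a) = - (axis i a :: int ^ 'n::finite)"
  by (simp add: vec_eq_iff axis_def)

lemma axis_component: "axis i x $ k = (if k = i then x else 0)"
  by (simp add: axis_def)

lemma wdeg_nonneg: "0 \<le> wdeg w $ k"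
  by (induction w) (simp_all add: axis_component)

lemma length_wdeg: "int (length w) = (\<Sum>k\<in>UNIV. wdeg w $ k)"
  by (induction w) (simp_all add: sum.distrib axis_component)

lemma finite_wdeg: "finite {w. wdeg w = d}"
proof (rule finite_subset)
  show "{w. wdeg w = d} \<subseteq> {w. set w \<subseteq> UNIV \<and> length w = nat (\<Sum>k\<in>UNIV. d $ k)}"
    using length_wdeg by (metis (mono_tags, lifting) mem_Collect_eq nat_int subsetI subset_UNIV)
qed (rule finite_lists_length_eq, simp)

definition hcomp :: "int ^ 'n::finite \<Rightarrow> ('n list \<Rightarrow> 'k::field) set" where
  "hcomp d = {f. \<forall>w. wdeg w \<noteq> d \<longrightarrow> f w = 0}"

definition proj :: "int ^ 'n::finite \<Rightarrow> ('n list \<Rightarrow> 'k::field) \<Rightarrow> 'n list \<Rightarrow> 'k" where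
  "proj d f = (\<lambda>w. if wdeg w = d then f w else 0)"

lemma subspace_hcomp: "fs.subspace (hcomp d)"
  by (auto simp: fs.subspace_def hcomp_def pointwise)

text \<open>Provides the finite spanning sets that the dimension lemmas ask for: the indicator
  functions of the words of degree \<open>d\<close>.\<close>

lemma hcomp_finite_span: "\<exists>W. finite W \<and> (hcomp d :: ('n::finite list \<Rightarrow> 'k::field) set) \<subseteq> fs.span W"
proof (intro exI conjI)
  let ?W = "(\<lambda>w v. if v = w then 1 else 0 :: 'k) ` {w::'n list. wdeg w = d}"
  show "finite ?W" using finite_wdeg by blast
  show "hcomp d \<subseteq> fs.span ?W"
  proof
    fix f :: "'n list \<Rightarrow> 'k" assume f: "f \<in> hcomp d"
    have "f = (\<Sum>w | wdeg w = d. f w *f (\<lambda>v. if v = w then 1 else 0))"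
    proof
      fix v
      have "(\<Sum>w | wdeg w = d. f w *f (\<lambda>v. if v = w then 1 else 0)) v =
          (\<Sum>w | wdeg w = d. (f w *f (\<lambda>v. if v = w then 1 else 0)) v)"
        by (induction rule: infinite_finite_induct) (simp_all add: pointwise)
      also have "\<dots> = (\<Sum>w | wdeg w = d. if v = w then f w else 0)"
        by (rule sum.cong) (auto simp: pointwise)
      also have "\<dots> = f v" using f by (auto simp: hcomp_def sum.delta'[OF finite_wdeg])
      finally show "f v = (\<Sum>w | wdeg w = d. f w *f (\<lambda>v. if v = w then 1 else 0)) v" ..
    qed
    moreover have "(\<Sum>w | wdeg w = d. f w *f (\<lambda>v. if v = w then 1 else 0)) \<in> fs.span ?W"
      by (intro fs.span_sum fs.span_scale fs.span_base) blast
    ultimately show "f \<in> fs.span ?W" by simp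
  qed
qed

lemma hcomp_negative:
  assumes "d $ k < 0" "f \<in> hcomp d"
  shows "f = 0"
proof
  fix w
  have "wdeg w \<noteq> d" using wdeg_nonneg[of w k] assms(1) by auto
  then show "f w = 0 w" using assms(2) by (simp add: hcomp_def pointwise)
qed

lemma proj_hcomp: "proj d f \<in> hcomp d"
  by (simp add: proj_def hcomp_def)

lemma hcomp_iff_proj: "f \<in> hcomp d \<longleftrightarrow> proj d f = f"
  by (auto simp: proj_def hcomp_def fun_eq_iff)

lemma lin_proj: "lin (proj d)"
  by (auto simp: lin_def proj_def fun_eq_iff pointwise)

lemmas proj_lin [simp] = lin_proj[THEN lin_add] lin_proj[THEN lin_diff] lin_proj[THEN lin_scale]
  lin_proj[THEN lin_zero]

lemma dl_proj: "dl k (proj d f) = proj (d - axis k 1) (dl k f)"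
  by (auto simp: dl_def proj_def fun_eq_iff algebra_simps)

lemma dr_proj: "dr k (proj d f) = proj (d - axis k 1) (dr k f)"
  by (auto simp: dr_def proj_def fun_eq_iff algebra_simps)

lemma wt_proj: "wt c (proj d f) = proj d (wt c f)"
  by (auto simp: wt_def proj_def)

lemma lmul_proj: "lmul q j (proj d f) = proj (d + axis j 1) (lmul q j f)"
proof
  show "lmul q j (proj d f) w = proj (d + axis j 1) (lmul q j f) w" for w
  proof (induction w arbitrary: d f)
    case (Cons a w)
    have "dl a (lmul q j (proj d f)) w = dl a (proj (d + axis j 1) (lmul q j f)) w"
      using Cons[of "d - axis a 1" "dl a f"]
      by (auto simp: dl_lmul dl_proj pointwise algebra_simps)
    then show ?case by (simp only: Cons_dl)
  qed (simp add: proj_def)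
qed

lemma rmul_proj: "rmul q j (proj d f) = proj (d + axis j 1) (rmul q j f)"
proof
  show "rmul q j (proj d f) w = proj (d + axis j 1) (rmul q j f) w" for w
  proof (induction w arbitrary: d f)
    case (Cons a w)
    have "dl a (rmul q j (proj d f)) w = dl a (proj (d + axis j 1) (rmul q j f)) w"
      using Cons[of "d - axis a 1" "dl a f"]
      by (auto simp: dl_rmul dl_proj wt_proj pointwise algebra_simps)
    then show ?case by (simp only: Cons_dl)
  qed (simp add: proj_def)
qed

lemma proj_vac: "proj d vac = (if d = 0 then vac else 0)"
  by (auto simp: proj_def vac_def fun_eq_iff pointwise)

lemma adx_proj: "adx q i c (proj d f) = proj (d + axis i 1) (adx q i c f)"
  by (simp add: adx_def lmul_proj rmul_proj wt_proj)

lemma dr_pow_proj: "(dr k ^^ n) (proj d f) = proj (d - axis k (int n)) ((dr k ^^ n) f)"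
proof (induction n)
  case (Suc n)
  have "axis k (1 + int n) = axis k 1 + (axis k (int n) :: int ^ 'a)" by (rule axis_add)
  then show ?case by (simp add: Suc dr_proj algebra_simps)
qed simp

lemma rmul_pow_proj: "(rmul q k ^^ n) (proj d f) = proj (d + axis k (int n)) ((rmul q k ^^ n) f)"
proof (induction n)
  case (Suc n)
  have "axis k (1 + int n) = axis k 1 + (axis k (int n) :: int ^ 'a)" by (rule axis_add)
  then show ?case by (simp add: Suc rmul_proj algebra_simps)
qed simp

lemma hcomp_dr_pow: 
  assumes "f \<in> hcomp d"
  shows "(dr k ^^ n) f \<in> hcomp (d - axis k (int n))"
  using assms dr_pow_proj[where k = k and n = n and d = d and f = f]
  by (simp only: hcomp_iff_proj)

lemma hcomp_rmul_pow:
  assumes "f \<in> hcomp d"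
  shows "(rmul q k ^^ n) f \<in> hcomp (d + axis k (int n))"
  using assms rmul_pow_proj[where q = q and k = k and n = n and d = d and f = f]
  by (simp only: hcomp_iff_proj)

section \<open>The shuffle realisation of the Nichols algebra\<close>

inductive_set shuffle_alg :: "('n \<Rightarrow> 'n \<Rightarrow> 'k::field) \<Rightarrow> ('n list \<Rightarrow> 'k) set" for q where
  shuffle_alg_vac: "vac \<in> shuffle_alg q"
| shuffle_alg_add: "f \<in> shuffle_alg q \<Longrightarrow> g \<in> shuffle_alg q \<Longrightarrow> f + g \<in> shuffle_alg q"
| shuffle_alg_scale: "f \<in> shuffle_alg q \<Longrightarrow> c *f f \<in> shuffle_alg q"
| shuffle_alg_lmul: "f \<in> shuffle_alg q \<Longrightarrow> lmul q j f \<in> shuffle_alg q"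

text \<open>By \<open>deriv_ker_eq\<close> below this is the kernel of \<open>dr i\<close>.\<close>

inductive_set deriv_ker :: "('n \<Rightarrow> 'n \<Rightarrow> 'k::field) \<Rightarrow> 'n \<Rightarrow> ('n list \<Rightarrow> 'k) set" for q i where
  deriv_ker_vac: "vac \<in> deriv_ker q i"
| deriv_ker_add: "f \<in> deriv_ker q i \<Longrightarrow> g \<in> deriv_ker q i \<Longrightarrow> f + g \<in> deriv_ker q i"
| deriv_ker_scale: "f \<in> deriv_ker q i \<Longrightarrow> c *f f \<in> deriv_ker q i"
| deriv_ker_lmul: "f \<in> deriv_ker q i \<Longrightarrow> j \<noteq> i \<Longrightarrow> lmul q j f \<in> deriv_ker q i"
| deriv_ker_adx: "f \<in> deriv_ker q i \<Longrightarrow> adx q i 1 f \<in> deriv_ker q i"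

lemma shuffle_alg_zero: "0 \<in> shuffle_alg q"
  using shuffle_alg_scale[OF shuffle_alg_vac, of 0] by simp

lemma deriv_ker_zero: "0 \<in> deriv_ker q i"
  using deriv_ker_scale[OF deriv_ker_vac, of 0] by simp

lemma subspace_shuffle_alg: "fs.subspace (shuffle_alg q)"
  by (simp add: fs.subspace_def shuffle_alg_zero shuffle_alg_add shuffle_alg_scale)

lemma subspace_deriv_ker: "fs.subspace (deriv_ker q i)"
  by (simp add: fs.subspace_def deriv_ker_zero deriv_ker_add deriv_ker_scale)

lemmas shuffle_alg_diff = fs.subspace_diff[OF subspace_shuffle_alg]

lemma shuffle_alg_wt: "f \<in> shuffle_alg q \<Longrightarrow> wt c f \<in> shuffle_alg q"
  by (induction rule: shuffle_alg.induct) (auto simp: wt_lmul intro: shuffle_alg.intros)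

lemma shuffle_alg_rmul: "f \<in> shuffle_alg q \<Longrightarrow> rmul q k f \<in> shuffle_alg q"
  by (induction rule: shuffle_alg.induct) (auto simp: rmul_vac lmul_rmul[symmetric] intro: shuffle_alg.intros)

lemma shuffle_alg_dl: "f \<in> shuffle_alg q \<Longrightarrow> dl k f \<in> shuffle_alg q"
  by (induction rule: shuffle_alg.induct) (auto simp: dl_lmul intro: shuffle_alg.intros shuffle_alg_zero)

lemma shuffle_alg_dr: "f \<in> shuffle_alg q \<Longrightarrow> dr k f \<in> shuffle_alg q"
  by (induction rule: shuffle_alg.induct) (auto simp: dr_lmul intro: shuffle_alg.intros shuffle_alg_zero shuffle_alg_wt)

lemma shuffle_alg_adx: "f \<in> shuffle_alg q \<Longrightarrow> adx q i c f \<in> shuffle_alg q"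
  by (simp add: adx_def shuffle_alg_diff shuffle_alg_lmul shuffle_alg_scale shuffle_alg_rmul shuffle_alg_wt)

lemma shuffle_alg_adx_mult: "f \<in> shuffle_alg q \<Longrightarrow> adx_mult q i j s f \<in> shuffle_alg q"
  by (induction s arbitrary: f) (simp_all add: shuffle_alg_diff shuffle_alg_lmul shuffle_alg_scale)

lemma shuffle_alg_proj: "f \<in> shuffle_alg q \<Longrightarrow> proj d f \<in> shuffle_alg q"
proof (induction arbitrary: d rule: shuffle_alg.induct)
  case (shuffle_alg_lmul f j)
  have "proj d (lmul q j f) = lmul q j (proj (d - axis j 1) f)" by (simp add: lmul_proj)
  then show ?case using shuffle_alg_lmul by (simp add: shuffle_alg.intros)
qed (auto simp: proj_vac intro: shuffle_alg.intros shuffle_alg_zero)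

lemma shuffle_alg_dr_pow: "f \<in> shuffle_alg q \<Longrightarrow> (dr k ^^ n) f \<in> shuffle_alg q"
  by (induction n) (simp_all add: shuffle_alg_dr)

lemma shuffle_alg_rmul_pow: "f \<in> shuffle_alg q \<Longrightarrow> (rmul q k ^^ n) f \<in> shuffle_alg q"
  by (induction n) (simp_all add: shuffle_alg_rmul)

lemma deriv_ker_subset_shuffle_alg: "f \<in> deriv_ker q i \<Longrightarrow> f \<in> shuffle_alg q"
  by (induction rule: deriv_ker.induct) (auto intro: shuffle_alg.intros shuffle_alg_adx)

lemma deriv_ker_dr: "f \<in> deriv_ker q i \<Longrightarrow> dr i f = 0"
  by (induction rule: deriv_ker.induct) (auto simp: dr_lmul dr_adx_same)

lemma deriv_ker_wt: "f \<in> deriv_ker q i \<Longrightarrow> wt c f \<in> deriv_ker q i"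
  by (induction rule: deriv_ker.induct) (auto simp: wt_lmul wt_adx intro: deriv_ker.intros)

definition qfact :: "'k::field \<Rightarrow> nat \<Rightarrow> 'k" where
  "qfact p n = (\<Prod>t<n. qnum p (Suc t))"

text \<open>Together with \<open>dr_pow_rmul_pow_zero\<close> this lets a power of
  \<open>dr i\<close> read off the leading coefficient of an expansion in powers of x_i with
  coefficients in the kernel of \<open>dr i\<close>.\<close>

lemma dr_pow_rmul_pow:
  assumes "dr i u = 0"
  shows "(dr i ^^ n) ((rmul q i ^^ n) u) = qfact (q i i) n *f u"
proof (induction n)
  case 0
  show ?case by (simp add: qfact_def)
next
  case (Suc n)
  have "(dr i ^^ Suc n) ((rmul q i ^^ Suc n) u) = (dr i ^^ n) (dr i ((rmul q i ^^ Suc n) u))"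
    by (simp only: funpow_Suc_right comp_def)
  also have "dr i ((rmul q i ^^ Suc n) u) = qnum (q i i) (Suc n) *f (rmul q i ^^ n) u"
    by (simp only: dr_rmul_pow assms lin_zero[OF lin_funpow[OF lin_rmul]]) simp
  also have "(dr i ^^ n) \<dots> = qnum (q i i) (Suc n) *f (dr i ^^ n) ((rmul q i ^^ n) u)"
    by (rule lin_scale[OF lin_dr_pow])
  finally show ?case by (simp add: Suc qfact_def mult.commute)
qed

lemma dr_pow_lmul_pow:
  assumes "dr i u = 0"
  shows "(dr i ^^ n) ((lmul q i ^^ n) u) = qfact (q i i) n *f wt (\<lambda>a. q i a ^ n) u"
  using assms
proof (induction n arbitrary: u)
  case 0
  have "(\<Prod>a\<leftarrow>w. 1 :: 'b) = 1" for w :: "'a list" by (induction w) auto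
  then have "wt (\<lambda>a. 1) u = u" by (simp add: wt_def)
  then show ?case by (simp add: qfact_def)
next
  case (Suc n)
  have "(dr i ^^ Suc n) ((lmul q i ^^ Suc n) u) = (dr i ^^ n) (dr i ((lmul q i ^^ Suc n) u))"
    by (simp only: funpow_Suc_right comp_def)
  also have "dr i ((lmul q i ^^ Suc n) u) = qnum (q i i) (Suc n) *f (lmul q i ^^ n) (wt (q i) u)"
    by (simp only: dr_lmul_pow Suc.prems lin_zero[OF lin_lmul_pow]) simp
  also have "(dr i ^^ n) \<dots> = qnum (q i i) (Suc n) *f (dr i ^^ n) ((lmul q i ^^ n) (wt (q i) u))"
    by (rule lin_scale[OF lin_dr_pow])
  also have "(dr i ^^ n) ((lmul q i ^^ n) (wt (q i) u)) =
      qfact (q i i) n *f wt (\<lambda>a. q i a ^ n) (wt (q i) u)"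
    using Suc.prems by (intro Suc.IH) (simp add: dr_wt)
  finally show ?case by (simp add: wt_wt qfact_def mult.commute)
qed

lemma dr_pow_rmul_pow_zero:
  assumes "dr i u = 0" "a < n"
  shows "(dr i ^^ n) ((rmul q i ^^ a) u) = 0"
proof -
  define m where "m = n - Suc a"
  have m: "n = Suc m + a" using assms(2) by (simp add: m_def)
  have "(dr i ^^ n) ((rmul q i ^^ a) u) = (dr i ^^ m) (dr i ((dr i ^^ a) ((rmul q i ^^ a) u)))"
    by (simp only: m funpow_add funpow_Suc_right comp_def)
  also have "\<dots> = 0"
    by (simp add: dr_pow_rmul_pow[OF assms(1)] assms lin_zero[OF lin_dr_pow])
  finally show ?thesis .
qed

subsection \<open>Heights\<close>

text \<open>The height that (P) prescribes for a generator of degree d with chi(d,d) =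
  \<open>p\<close>. In characteristic zero it is the least \<open>n > 0\<close> with
  \<open>qnum p n = 0\<close>, or infinity if there is none; this is the content of
  \<open>qnum_nonzero\<close> and \<open>pbw_height_enat\<close>.\<close>

definition pbw_height :: "'k::field \<Rightarrow> enat" where
  "pbw_height p = (if 2 \<le> mult_order p \<and> mult_order p < \<infinity> then mult_order p else \<infinity>)"

lemma mult_order_le: "0 < m \<Longrightarrow> p ^ m = 1 \<Longrightarrow> mult_order p \<le> enat m"
  unfolding mult_order_def by (rule Inf_lower) blast

lemma mult_order_enat:
  assumes "mult_order p = enat m"
  shows "0 < m" "p ^ m = 1"
proof -
  let ?A = "{enat m |m. 0 < m \<and> p ^ m = 1}"
  have ne: "?A \<noteq> {}" using assms unfolding mult_order_def Inf_enat_def by (metis enat.distinct(1))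
  then have "mult_order p = (LEAST x. x \<in> ?A)"
    unfolding mult_order_def Inf_enat_def by (rule if_not_P)
  moreover have "(LEAST x. x \<in> ?A) \<in> ?A" using ne by (metis (no_types, lifting) LeastI ex_in_conv)
  ultimately have "enat m \<in> ?A" using assms by simp
  then show "0 < m" "p ^ m = 1" by auto
qed

text \<open>Here characteristic zero enters: for \<open>p = 1\<close> the quantum integer is the
  integer \<open>a\<close> itself. For \<open>p\<close> different from 1 a zero would make
  \<open>a\<close> an exponent with \<open>p ^ a = 1\<close> below the order of
  \<open>p\<close>.\<close>

lemma qnum_nonzero:
  fixes p :: "'k::field_char_0"
  assumes "0 < a" "enat a < pbw_height p"
  shows "qnum p a \<noteq> 0"
proof
  assume z: "qnum p a = 0"
  show False
  proof (cases "p = 1")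
    case True
    then show False using z assms by (simp add: qnum_def)
  next
    case False
    have pa: "p ^ a = 1" using qnum_eq[of p a] z by simp
    then have le: "mult_order p \<le> enat a" using assms mult_order_le by blast
    then obtain m where m: "mult_order p = enat m" "m \<le> a" by (cases "mult_order p") auto
    have "m \<noteq> 1" using mult_order_enat(2)[OF m(1)] False by auto
    then have "2 \<le> m" using mult_order_enat(1)[OF m(1)] by simp
    then have "pbw_height p = enat m" using m by (simp add: pbw_height_def numeral_eq_enat)
    then show False using assms m by simp
  qed
qed

lemma pbw_height_enat:
  assumes "pbw_height p = enat h"
  shows "2 \<le> h" "qnum p h = 0"
proof -
  have m: "mult_order p = enat h" "2 \<le> mult_order p" using assms by (auto simp: pbw_height_def split: if_splits)
  then show h: "2 \<le> h" by (simp add: numeral_eq_enat)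
  have "p \<noteq> 1"
  proof
    assume "p = 1"
    then have "mult_order p \<le> enat 1" by (intro mult_order_le) auto
    then show False using m h by simp
  qed
  then show "qnum p h = 0" using qnum_eq[of p h] mult_order_enat[OF m(1)] by simp
qed

lemma pbw_height_ge_2: "2 \<le> pbw_height p"
  by (simp add: pbw_height_def)

lemma qfact_nonzero:
  fixes p :: "'k::field_char_0"
  assumes "\<And>a. a < n \<Longrightarrow> enat (Suc a) < pbw_height p"
  shows "qfact p n \<noteq> 0"
  using assms by (auto simp: qfact_def qnum_nonzero)

subsection \<open>Decomposition along one generator\<close>

text \<open>The span contains \<open>vac\<close>, and it is closed under left multiplication by
  letters: for \<open>j \<noteq> i\<close> the letter preserves \<open>deriv_ker q i\<close>, and
  for \<open>j = i\<close> the definition of \<open>adx\<close> rewrites x_i u as an element of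
  \<open>deriv_ker q i\<close> plus an element multiplied by x_i from the right.\<close>

lemma shuffle_alg_deriv_ker_span: 
  assumes "f \<in> shuffle_alg q"
  shows "f \<in> fs.span (\<Union>a. (rmul q i ^^ a) ` deriv_ker q i)" (is "_ \<in> fs.span ?G")
  using assms
proof (induction rule: shuffle_alg.induct)
  case shuffle_alg_vac
  have "vac \<in> (rmul q i ^^ 0) ` deriv_ker q i" by (simp add: deriv_ker_vac)
  then show ?case by (intro fs.span_base) blast
next
  case (shuffle_alg_lmul f j)
  have sub: "fs.subspace {f. lmul q j f \<in> fs.span ?G}"
    by (auto simp: fs.subspace_def fs.span_zero fs.span_add fs.span_scale)
  have pw: "lmul q k ((rmul q i ^^ a) u) = (rmul q i ^^ a) (lmul q k u)" for a u k
    by (induction a) (simp_all add: lmul_rmul)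
  have "?G \<subseteq> {f. lmul q j f \<in> fs.span ?G}"
  proof clarify
    fix a u assume u: "u \<in> deriv_ker q i"
    show "lmul q j ((rmul q i ^^ a) u) \<in> fs.span ?G"
    proof (cases "j = i")
      case False
      then have "lmul q j u \<in> deriv_ker q i" using u by (simp add: deriv_ker.intros)
      then show ?thesis unfolding pw by (intro fs.span_base) blast
    next
      case True
      have "lmul q i u = adx q i 1 u + rmul q i (wt (q i) u)" by (simp add: adx_def)
      then have "lmul q j ((rmul q i ^^ a) u) =
          (rmul q i ^^ a) (adx q i 1 u) + (rmul q i ^^ Suc a) (wt (q i) u)"
        by (simp only: pw True lin_add[OF lin_funpow[OF lin_rmul]] funpow_Suc_right comp_def)
      moreover have "(rmul q i ^^ a) (adx q i 1 u) \<in> ?G" using deriv_ker_adx[OF u] by blast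
      moreover have "(rmul q i ^^ Suc a) (wt (q i) u) \<in> ?G" using deriv_ker_wt[OF u] by blast
      ultimately show ?thesis by (simp only: fs.span_add fs.span_base)
    qed
  qed
  then show ?case using shuffle_alg_lmul fs.span_minimal[OF _ sub] by blast
qed (auto intro: fs.span_add fs.span_scale)

lemma shuffle_alg_deriv_ker_sum:
  assumes "f \<in> shuffle_alg q"
  shows "\<exists>N u. (\<forall>a. u a \<in> deriv_ker q i) \<and> f = (\<Sum>a<N. (rmul q i ^^ a) (u a))"
  using shuffle_alg_deriv_ker_span[OF assms, of i]
proof (induction rule: fs.span_induct_alt)
  case base
  show ?case by (rule exI[of _ 0], rule exI[of _ "\<lambda>_. 0"]) (simp add: deriv_ker_zero)
next
  case (step c x y)
  then obtain N u where u: "\<And>a. u a \<in> deriv_ker q i" "y = (\<Sum>a<N. (rmul q i ^^ a) (u a))" by blast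
  obtain b v where v: "v \<in> deriv_ker q i" "x = (rmul q i ^^ b) v" using step by blast
  define u' where "u' a = (if a < N then u a else 0) + (if a = b then c *f v else 0)" for a
  note lr = lin_funpow[OF lin_rmul]
  have "(\<Sum>a<max N (Suc b). (rmul q i ^^ a) (u' a)) =
     (\<Sum>a<max N (Suc b). if a < N then (rmul q i ^^ a) (u a) else 0) +
     (\<Sum>a<max N (Suc b). if a = b then (rmul q i ^^ a) (c *f v) else 0)"
    unfolding sum.distrib[symmetric]
    by (rule sum.cong) (auto simp: u'_def lin_add[OF lr] lin_zero[OF lr])
  also have "(\<Sum>a<max N (Suc b). if a < N then (rmul q i ^^ a) (u a) else 0) = y"
    unfolding u by (rule sum.mono_neutral_cong_right) auto
  also have "(\<Sum>a<max N (Suc b). if a = b then (rmul q i ^^ a) (c *f v) else 0) = c *f x"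
    by (simp add: lin_scale[OF lr] v less_max_iff_disj)
  finally have "c *f x + y = (\<Sum>a<max N (Suc b). (rmul q i ^^ a) (u' a))" by (simp add: add.commute)
  moreover have "\<forall>a. u' a \<in> deriv_ker q i" using u v by (auto simp: u'_def intro: deriv_ker.intros deriv_ker_zero)
  ultimately show ?case by blast
qed

text \<open>In an expansion of \<open>f\<close> in right powers of x_i the top coefficient
  \<open>u N\<close> with \<open>N > 0\<close> can be removed: below the height
  \<open>(dr i ^^ N) f = 0\<close> returns it up to the nonzero factor \<open>qfact\<close>, and
  from the height on the power of x_i is zero. Only the constant coefficient survives.\<close>

lemma deriv_ker_eq:
  fixes q :: "'n \<Rightarrow> 'n \<Rightarrow> 'k::field_char_0"
  shows "f \<in> deriv_ker q i \<longleftrightarrow> f \<in> shuffle_alg q \<and> dr i f = 0"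
proof (intro iffI conjI; (elim conjE)?)
  assume f: "f \<in> shuffle_alg q" "dr i f = 0"
  note lr = lin_funpow[OF lin_rmul] and ld = lin_dr_pow
  obtain N u where u: "\<And>a. u a \<in> deriv_ker q i" "f = (\<Sum>a<N. (rmul q i ^^ a) (u a))"
    using shuffle_alg_deriv_ker_sum[OF f(1), of i] by blast
  show "f \<in> deriv_ker q i"
    using u(2)
  proof (induction N)
    case 0
    then show ?case by (simp add: deriv_ker_zero)
  next
    case (Suc N)
    show ?case
    proof (cases "N = 0")
      case True
      then show ?thesis using Suc.prems u(1) by simp
    next
      case N: False
      have "(rmul q i ^^ N) (u N) = 0"
      proof (cases "enat N < pbw_height (q i i)")
        case True
        have "0 = (dr i ^^ N) f"
          using N f(2) lin_zero[OF ld] by (cases N) (simp_all add: funpow_Suc_right del: funpow.simps)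
        also have "\<dots> = (\<Sum>a<Suc N. (dr i ^^ N) ((rmul q i ^^ a) (u a)))"
          unfolding Suc.prems by (rule lin_sum[OF ld])
        also have "\<dots> = (dr i ^^ N) ((rmul q i ^^ N) (u N))"
          using dr_pow_rmul_pow_zero[OF deriv_ker_dr[OF u(1)]] by simp
        also have "\<dots> = qfact (q i i) N *f u N"
          by (rule dr_pow_rmul_pow[OF deriv_ker_dr[OF u(1)]])
        finally have "u N = 0"
          using qfact_nonzero[of N "q i i"] True
          by (metis Suc_leI enat_ord_simps(1) fs.scale_eq_0_iff order_le_less_trans)
        then show ?thesis by (simp add: lin_zero[OF lr])
      next
        case False
        then obtain h where h: "pbw_height (q i i) = enat h" "h \<le> N" by (cases "pbw_height (q i i)") auto
        have "rmul q i ^^ N = (\<lambda>x. (rmul q i ^^ h) ((rmul q i ^^ (N - h)) x))"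
          using h(2) by (metis comp_apply funpow_add le_add_diff_inverse)
        then show ?thesis using rmul_pow_zero pbw_height_enat[OF h(1)] by (metis not_numeral_le_zero gr0I)
      qed
      then show ?thesis using Suc.IH Suc.prems by simp
    qed
  qed
qed (auto intro: deriv_ker_subset_shuffle_alg deriv_ker_dr)

lemma shuffle_alg_dr_pow_zero:
  assumes "qnum (q i i) n = 0" "0 < n" "f \<in> shuffle_alg q"
  shows "(dr i ^^ n) f = 0"
  using assms(3)
proof (induction rule: shuffle_alg.induct)
  case shuffle_alg_vac
  then show ?case using assms(2) lin_zero[OF lin_dr_pow]
    by (cases n) (simp_all add: funpow_Suc_right del: funpow.simps)
next
  case (shuffle_alg_lmul f j)
  show ?case
  proof (cases "j = i")
    case True
    \<comment> \<open>With parameter 0 the right multiplication drops out of \<open>adx\<close>, so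
      that \<open>dr_pow_adx\<close> applies; the scalar of its second summand contains
      \<open>qnum (q i i) n = 0\<close>.\<close>
    have "lmul q i f = adx q i 0 f" by (simp add: adx_def)
    then show ?thesis using dr_pow_adx[of n i q 0 f] shuffle_alg_lmul assms(1) True by simp
  next
    case False
    have "(dr i ^^ n) (lmul q j f) = lmul q j ((dr i ^^ n) f)"
      using False by (induction n) (simp_all add: dr_lmul)
    then show ?thesis using shuffle_alg_lmul by simp
  qed
qed (simp_all add: lin_add[OF lin_dr_pow] lin_scale[OF lin_dr_pow])

definition dimB :: "('n::finite \<Rightarrow> 'n \<Rightarrow> 'k::field) \<Rightarrow> int ^ 'n \<Rightarrow> nat" where
  "dimB q d = fs.dim (shuffle_alg q \<inter> hcomp d)"

definition dimK :: "('n::finite \<Rightarrow> 'n \<Rightarrow> 'k::field) \<Rightarrow> 'n \<Rightarrow> int ^ 'n \<Rightarrow> nat" where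
  "dimK q i d = fs.dim (deriv_ker q i \<inter> hcomp d)"

text \<open>The component is filtered by the kernels \<open>V n\<close> of the powers of
  \<open>dr i\<close>. The map \<open>dr i ^^ n\<close> has kernel \<open>V n\<close> on
  \<open>V (Suc n)\<close> and sends it onto the degree \<open>d - axis i n\<close> of
  \<open>deriv_ker q i\<close>, since \<open>(rmul q i ^^ n) g\<close>, divided by the quantum
  factorial, is a preimage of \<open>g\<close>.\<close>

lemma dimB_decomp:
  fixes q :: "'n::finite \<Rightarrow> 'n \<Rightarrow> 'k::field_char_0"
  assumes "d $ i \<le> int N"
  shows "dimB q d = (\<Sum>a | a \<le> N \<and> enat a < pbw_height (q i i). dimK q i (d - axis i (int a)))"
proof -
  define V where "V n = {f \<in> shuffle_alg q \<inter> hcomp d. (dr i ^^ n) f = 0}" for n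
  note ld = lin_dr_pow and lr = lin_funpow[OF lin_rmul]
  obtain W where W: "finite W" "(hcomp d :: ('n list \<Rightarrow> 'k) set) \<subseteq> fs.span W"
    using hcomp_finite_span by blast
  have sV: "fs.subspace (V n)" for n
    unfolding V_def by (intro subspace_ker fs.subspace_inter subspace_shuffle_alg subspace_hcomp ld)
  have VW: "V n \<subseteq> fs.span W" for n using W by (auto simp: V_def)
  have dimV: "fs.dim (V n) = (\<Sum>a<n. dimK q i (d - axis i (int a)))"
    if "\<forall>a<n. enat a < pbw_height (q i i)" for n
    using that
  proof (induction n)
    case 0
    have "V 0 = {0}" using fs.subspace_0[OF sV[of 0]] by (auto simp: V_def)
    then show ?case by (simp add: dim_zero)
  next
    case (Suc n)
    have "{v \<in> V (Suc n). (dr i ^^ n) v = 0} = V n"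
      by (auto simp: V_def)
    moreover have "(dr i ^^ n) ` V (Suc n) = deriv_ker q i \<inter> hcomp (d - axis i (int n))"
    proof (intro equalityI subsetI)
      fix g assume "g \<in> (dr i ^^ n) ` V (Suc n)"
      then obtain f where f: "f \<in> shuffle_alg q" "f \<in> hcomp d" "(dr i ^^ Suc n) f = 0" "g = (dr i ^^ n) f"
        by (auto simp: V_def)
      have "g \<in> shuffle_alg q" "dr i g = 0" using f by (auto simp: shuffle_alg_dr_pow)
      moreover have "g \<in> hcomp (d - axis i (int n))"
        unfolding f(4) by (rule hcomp_dr_pow[OF f(2)])
      ultimately show "g \<in> deriv_ker q i \<inter> hcomp (d - axis i (int n))" by (simp add: deriv_ker_eq)
    next
      fix g assume g: "g \<in> deriv_ker q i \<inter> hcomp (d - axis i (int n))"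
      define f where "f = inverse (qfact (q i i) n) *f (rmul q i ^^ n) g"
      have nz: "qfact (q i i) n \<noteq> 0"
        by (rule qfact_nonzero) (use Suc.prems in auto)
      have dg: "dr i g = 0" using g by (intro deriv_ker_dr[where q = q]) simp
      have drf: "(dr i ^^ n) f = g"
        using dr_pow_rmul_pow[OF dg] nz by (simp add: f_def lin_scale[OF ld])
      have "f \<in> shuffle_alg q"
        unfolding f_def using g by (intro shuffle_alg_scale shuffle_alg_rmul_pow deriv_ker_subset_shuffle_alg[of g q i]) simp
      moreover have "f \<in> hcomp d"
        unfolding f_def using hcomp_rmul_pow[of g "d - axis i (int n)" n q i] g
        by (intro fs.subspace_scale[OF subspace_hcomp]) simp
      ultimately have "f \<in> V (Suc n)" using drf dg by (simp add: V_def)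
      then show "g \<in> (dr i ^^ n) ` V (Suc n)" using drf by blast
    qed
    ultimately show ?case
      using dim_kernel_image[OF sV W(1) VW ld, of "Suc n" n i] Suc by (simp add: dimK_def)
  qed
  \<comment> \<open>The filtration is exhausted either at \<open>Suc N\<close>, where the degree
    becomes negative, or earlier at the height, where \<open>dr i\<close> is nilpotent.\<close>
  have "\<exists>n. (\<forall>a<n. enat a < pbw_height (q i i)) \<and> V n = shuffle_alg q \<inter> hcomp d \<and>
     {a. a \<le> N \<and> enat a < pbw_height (q i i)} = {..<n}"
  proof (cases "enat N < pbw_height (q i i)")
    case True
    have "(dr i ^^ Suc N) f = 0" if "f \<in> hcomp d" for f :: "'n list \<Rightarrow> 'k"
    proof (rule hcomp_negative)
      show "(d - axis i (int (Suc N))) $ i < 0" using assms by simp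
      show "(dr i ^^ Suc N) f \<in> hcomp (d - axis i (int (Suc N)))"
        by (rule hcomp_dr_pow[OF that])
    qed
    then have "V (Suc N) = shuffle_alg q \<inter> hcomp d" by (auto simp: V_def)
    moreover have "enat a < pbw_height (q i i)" if "a \<le> N" for a
      using True that by (meson enat_ord_simps(1) order_le_less_trans)
    ultimately show ?thesis by (intro exI[of _ "Suc N"]) auto
  next
    case False
    then obtain h where h: "pbw_height (q i i) = enat h" "h \<le> N" by (cases "pbw_height (q i i)") auto
    have "V h = shuffle_alg q \<inter> hcomp d"
      using shuffle_alg_dr_pow_zero[of q i h] pbw_height_enat[OF h(1)] by (auto simp: V_def)
    then show ?thesis using h by (intro exI[of _ h]) auto
  qed
  then obtain n where "\<forall>a<n. enat a < pbw_height (q i i)" "V n = shuffle_alg q \<inter> hcomp d"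
     "{a. a \<le> N \<and> enat a < pbw_height (q i i)} = {..<n}" by blast
  then show ?thesis using dimV[of n] by (simp add: dimB_def)
qed

section \<open>Bicharacters\<close>

lemma mult_hom_axis:
  fixes f :: "int ^ 'n::finite \<Rightarrow> 'k::field"
  assumes f: "\<And>a b. f (a + b) = f a * f b" and nz: "\<And>a. f a \<noteq> 0"
  shows "f (axis k x) = f (axis k 1) powi x"
proof (induction x rule: int_induct[where k = 0])
  case base
  have "f 0 * f 0 = f 0 * 1" using f[of 0 0] by simp
  then show ?case using nz[of 0] by simp
next
  case (step1 x)
  then show ?case using nz[of "axis k 1"] by (simp add: axis_add f power_int_add)
next
  case (step2 x)
  have "f (axis k (x - 1)) * f (axis k 1) = f (axis k x)"
    using axis_add[of k "x - 1" 1] f[of "axis k (x - 1)" "axis k 1"] by simp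
  then show ?case using step2 nz[of "axis k 1"] by (simp add: power_int_diff field_simps)
qed

lemma mult_hom_sum:
  assumes f: "\<And>a b. f (a + b) = f a * f b" and "f 0 = (1::'k::field)"
  shows "f (\<Sum>k\<in>A. g k) = (\<Prod>k\<in>A. f (g k))"
  by (induction A rule: infinite_finite_induct) (simp_all add: assms)

lemma mult_hom_eq:
  fixes f g :: "int ^ 'n::finite \<Rightarrow> 'k::field"
  assumes f: "\<And>a b. f (a + b) = f a * f b" and nzf: "\<And>a. f a \<noteq> 0"
    and g: "\<And>a b. g (a + b) = g a * g b" and nzg: "\<And>a. g a \<noteq> 0"
    and ax: "\<And>k. f (axis k 1) = g (axis k 1)"
  shows "f v = g v"
proof -
  have v: "v = (\<Sum>k\<in>UNIV. axis k (v $ k))"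
    by (simp add: vec_eq_iff sum_component axis_component)
  have f0: "f 0 = 1" using mult_hom_axis[of f, OF f nzf, of undefined 0] by simp
  have g0: "g 0 = 1" using mult_hom_axis[of g, OF g nzg, of undefined 0] by simp
  have "f (axis k x) = g (axis k x)" for k x
    unfolding mult_hom_axis[of f, OF f nzf, of k x] mult_hom_axis[of g, OF g nzg, of k x] ax ..
  then have "f (\<Sum>k\<in>UNIV. axis k (v $ k)) = g (\<Sum>k\<in>UNIV. axis k (v $ k))"
    unfolding mult_hom_sum[of f, OF f f0] mult_hom_sum[of g, OF g g0] by simp
  then show ?thesis using v by simp
qed

text \<open>The simple reflection e_i -> -e_i, e_j -> e_j + m_j e_i, where \<open>m j\<close> is
  minus the Cartan integer.\<close>

definition reflect :: "'n \<Rightarrow> ('n \<Rightarrow> nat) \<Rightarrow> int ^ 'n::finite \<Rightarrow> int ^ 'n" where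
  "reflect i m v = (\<chi> k. if k = i then (\<Sum>j\<in>UNIV - {i}. int (m j) * v $ j) - v $ i else v $ k)"

lemma reflect_component:
  "reflect i m v $ k = (if k = i then (\<Sum>j\<in>UNIV - {i}. int (m j) * v $ j) - v $ i else v $ k)"
  by (simp add: reflect_def)

lemma reflect_add: "reflect i m (v + w) = reflect i m v + reflect i m w"
  by (simp add: vec_eq_iff reflect_component sum.distrib algebra_simps)

lemma reflect_diff: "reflect i m (v - w) = reflect i m v - reflect i m w"
  by (simp add: vec_eq_iff reflect_component sum_subtractf algebra_simps)

lemma reflect_uminus: "reflect i m (- v) = - reflect i m v"
  by (simp add: vec_eq_iff reflect_component sum_negf)

lemma reflect_reflect [simp]: "reflect i m (reflect i m v) = v"
  by (simp add: vec_eq_iff reflect_component)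

lemma reflect_zero [simp]: "reflect i m 0 = 0"
  by (simp add: vec_eq_iff reflect_component)

lemma reflect_axis_same: "reflect i m (axis i x) = axis i (- x)"
  by (auto simp add: vec_eq_iff reflect_component axis_component intro!: sum.neutral)

lemma reflect_axis_other: "j \<noteq> i \<Longrightarrow> reflect i m (axis j 1) = axis j 1 + axis i (int (m j))"
  by (auto simp add: vec_eq_iff reflect_component axis_component if_distrib[of "\<lambda>x. _ * x"] cong: if_cong)

text \<open>This is the reflected matrix, inverted and transposed.  The modification is the price for
  describing the reflected algebra by the derivations at hand; it affects neither the heights nor
  the Cartan integers.\<close>

definition reflect_q :: "('n::finite \<Rightarrow> 'n \<Rightarrow> 'k::field) \<Rightarrow> 'n \<Rightarrow> ('n \<Rightarrow> nat) \<Rightarrow> 'n \<Rightarrow> 'n \<Rightarrow> 'k" where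
  "reflect_q q i m a b = inverse (bichar q (reflect i m (axis b 1)) (reflect i m (axis a 1)))"

locale braiding =
  fixes q :: "'n::finite \<Rightarrow> 'n \<Rightarrow> 'k::field_char_0"
  assumes q_nz: "q i j \<noteq> 0"
begin

lemma bichar_nz: "bichar q a b \<noteq> 0"
  by (simp add: bichar_def q_nz power_int_eq_0_iff)

lemmas add_left = bichar_add_left[OF q_nz] and add_right = bichar_add_right[OF q_nz]

lemma axis_left: "bichar q (axis j x) b = bichar q (axis j 1) b powi x"
  by (rule mult_hom_axis[of "\<lambda>a. bichar q a b"]) (simp_all add: add_left bichar_nz)

lemma axis_right: "bichar q b (axis j x) = bichar q b (axis j 1) powi x"
  by (rule mult_hom_axis[of "bichar q b"]) (simp_all add: add_right bichar_nz)

lemma reflect_q_nz: "reflect_q q i m a b \<noteq> 0"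
  by (simp add: reflect_q_def bichar_nz)

lemma braiding_reflect_q: "braiding (reflect_q q i m)"
  by standard (rule reflect_q_nz)

lemma bichar_reflect_q: "bichar (reflect_q q i m) v w = inverse (bichar q (reflect i m w) (reflect i m v))"
proof -
  interpret r: braiding "reflect_q q i m" by (rule braiding_reflect_q)
  have "bichar (reflect_q q i m) (axis a 1) w = inverse (bichar q (reflect i m w) (reflect i m (axis a 1)))" for a
    by (rule mult_hom_eq[where f = "\<lambda>w. bichar (reflect_q q i m) (axis a 1) w"
          and g = "\<lambda>w. inverse (bichar q (reflect i m w) (reflect i m (axis a 1)))"])
      (simp_all add: r.add_right add_left r.bichar_nz bichar_nz reflect_add bichar_axis, simp add: reflect_q_def)
  note ax = this
  show ?thesis
    by (rule mult_hom_eq[where f = "\<lambda>v. bichar (reflect_q q i m) v w"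
          and g = "\<lambda>v. inverse (bichar q (reflect i m w) (reflect i m v))"])
      (simp_all add: r.add_left add_right r.bichar_nz bichar_nz reflect_add ax)
qed

lemma reflect_q_reflect_q: "reflect_q (reflect_q q i m) i m = q"
proof (intro ext)
  interpret r: braiding "reflect_q q i m" by (rule braiding_reflect_q)
  show "reflect_q (reflect_q q i m) i m a b = q a b" for a b
    unfolding reflect_q_def[of "reflect_q q i m"] by (simp add: bichar_reflect_q bichar_axis)
qed

lemma reflect_q_simps:
  "reflect_q q i m i i = inverse (q i i)"
  "j \<noteq> i \<Longrightarrow> reflect_q q i m i j = q j i * q i i ^ m j"
  "j \<noteq> i \<Longrightarrow> reflect_q q i m j i = q i j * q i i ^ m j"
  by (simp_all add: reflect_q_def reflect_axis_same reflect_axis_other add_left add_right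
      axis_left[of _ "int _"] axis_right[of _ _ "int _"] axis_left[of _ "-1"] axis_right[of _ _ "-1"]
      bichar_axis power_int_minus field_simps)

end

text \<open>\<open>m j\<close> is the largest \<open>s\<close> for which the \<open>s\<close>-fold
  commutator of x_i with x_j is nonzero: by \<open>dr_adx_mult\<close> its derivative is a multiple
  of x_i^s, and the expression tested here collects one factor of the scalar and one quantum integer
  for that power.\<close>

definition cartan :: "('n \<Rightarrow> 'n \<Rightarrow> 'k::field) \<Rightarrow> 'n \<Rightarrow> ('n \<Rightarrow> nat) \<Rightarrow> bool" where
  "cartan q i m \<longleftrightarrow> (\<forall>j. j \<noteq> i \<longrightarrow>
     qnum (q i i) (Suc (m j)) * (1 - q i i ^ m j * (q i j * q j i)) = 0 \<and>
     (\<forall>t<m j. qnum (q i i) (Suc t) * (1 - q i i ^ t * (q i j * q j i)) \<noteq> 0))"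

lemma qnum_inverse:
  assumes "(p::'k::field) \<noteq> 0"
  shows "p ^ t * qnum (inverse p) (Suc t) = qnum p (Suc t)"
proof (induction t)
  case (Suc t)
  have "p ^ Suc t * qnum (inverse p) (Suc (Suc t)) =
      p * (p ^ t * qnum (inverse p) (Suc t)) + (p * inverse p) ^ Suc t"
    by (subst qnum_Suc') (simp add: algebra_simps power_mult_distrib)
  also have "\<dots> = qnum p (Suc (Suc t))" using Suc assms by (subst (2) qnum_Suc) simp
  finally show ?case .
qed simp

text \<open>Reflection turns \<open>p\<close> into its inverse and \<open>Q\<close> into
  \<open>Q * p ^ (2 * M)\<close>, so the \<open>t\<close>-th factor becomes
  \<open>1 - p ^ (2 * M - t) * Q\<close>. At \<open>t = M\<close> it is the old one. A zero at
  \<open>t < M\<close> contradicts the minimality of \<open>M\<close>: if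
  \<open>p ^ M * Q = 1\<close>, the quantum integer of \<open>M - t\<close> would vanish, and if
  \<open>p ^ Suc M = 1\<close>, the old factor at \<open>M - 1 - t\<close> would.\<close>

lemma cartan_reflect_q:
  assumes "braiding q" "cartan q i m"
  shows "cartan (reflect_q q i m) i m"
  unfolding cartan_def
proof (intro allI impI)
  interpret braiding q by fact
  fix j assume j: "j \<noteq> i"
  define p Q M where "p = q i i" and "Q = q i j * q j i" and "M = m j"
  have p: "p \<noteq> 0" by (simp add: p_def q_nz)
  have c0: "qnum p (Suc M) * (1 - p ^ M * Q) = 0"
    and c: "\<And>t. t < M \<Longrightarrow> qnum p (Suc t) \<noteq> 0 \<and> 1 - p ^ t * Q \<noteq> 0"
    using assms(2) j by (auto simp: cartan_def p_def Q_def M_def)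
  have Q': "reflect_q q i m i j * reflect_q q i m j i = Q * p ^ (2 * M)"
    using j by (simp add: reflect_q_simps Q_def p_def M_def mult_2_right power_add algebra_simps)
  have qz: "qnum (inverse p) (Suc t) = 0 \<longleftrightarrow> qnum p (Suc t) = 0" for t
    using qnum_inverse[OF p, of t] p by (metis mult_eq_0_iff power_not_zero)
  have pw: "inverse p ^ t * (Q * p ^ (2 * M)) = p ^ (2 * M - t) * Q" if "t \<le> M" for t
  proof -
    have "p ^ (2 * M) = p ^ t * p ^ (2 * M - t)" using that by (simp add: power_add[symmetric])
    then show ?thesis using p by (simp add: field_simps)
  qed
  have cases: "p ^ M * Q = 1 \<or> qnum p (Suc M) = 0" using c0 by auto
  have "qnum (inverse p) (Suc M) * (1 - inverse p ^ M * (Q * p ^ (2 * M))) = 0"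
  proof -
    have "2 * M - M = M" by simp
    then have "inverse p ^ M * (Q * p ^ (2 * M)) = p ^ M * Q"
      using pw[OF order_refl] by (simp only:)
    then show ?thesis using cases qz[of M] by (metis cancel_comm_monoid_add_class.diff_cancel mult_eq_0_iff)
  qed
  moreover have "qnum (inverse p) (Suc t) * (1 - inverse p ^ t * (Q * p ^ (2 * M))) \<noteq> 0"
    if t: "t < M" for t
  proof -
    have "p ^ (2 * M - t) * Q \<noteq> 1"
    proof
      assume one: "p ^ (2 * M - t) * Q = 1"
      show False using cases
      proof
        assume "p ^ M * Q = 1"
        moreover have "p ^ (2 * M - t) * Q = p ^ (M - t) * (p ^ M * Q)"
          using t by (simp add: power_add[symmetric] mult.assoc[symmetric] mult_2)
        ultimately have pt: "p ^ (M - t) = 1" using one by simp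
        \<comment> \<open>Minimality at 0 gives \<open>Q \<noteq> 1\<close>, hence
          \<open>p \<noteq> 1\<close>; only then does \<open>p ^ (M - t) = 1\<close> force the
          quantum integer to vanish.\<close>
        have "1 - p ^ 0 * Q \<noteq> 0" using c[of 0] t by auto
        then have "p \<noteq> 1" using \<open>p ^ M * Q = 1\<close> by auto
        then have "qnum p (Suc (M - t - 1)) = 0" using qnum_eq[of p "M - t"] pt t by (simp add: Suc_diff_Suc)
        then show False using c[of "M - t - 1"] t by auto
      next
        assume "qnum p (Suc M) = 0"
        then have pM: "p ^ Suc M = 1" using qnum_eq[of p "Suc M"] by simp
        have "p ^ (2 * M - t) = p ^ Suc M * p ^ (M - 1 - t)"
          using t by (simp only: power_add[symmetric]) (rule arg_cong, simp)
        then have "p ^ (M - 1 - t) * Q = 1" using one pM by simp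
        then show False using c[of "M - 1 - t"] t by auto
      qed
    qed
    moreover have e: "inverse p ^ t * (Q * p ^ (2 * M)) = p ^ (2 * M - t) * Q"
      using t by (intro pw) simp
    ultimately show ?thesis unfolding e using qz[of t] c[OF t] by simp
  qed
  ultimately show "qnum (reflect_q q i m i i) (Suc (m j)) *
       (1 - reflect_q q i m i i ^ m j * (reflect_q q i m i j * reflect_q q i m j i)) = 0 \<and>
     (\<forall>t<m j. qnum (reflect_q q i m i i) (Suc t) *
       (1 - reflect_q q i m i i ^ t * (reflect_q q i m i j * reflect_q q i m j i)) \<noteq> 0)"
    unfolding Q' by (simp add: reflect_q_simps p_def M_def)
qed

section \<open>Reflections of Nichols algebras\<close>

locale reflection = braiding q for q :: "'n::finite \<Rightarrow> 'n \<Rightarrow> 'k::field_char_0" +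
  fixes i :: 'n and m :: "'n \<Rightarrow> nat"
  assumes cartan: "cartan q i m"
begin

abbreviation "s \<equiv> reflect i m"
abbreviation "q' \<equiv> reflect_q q i m"
abbreviation "char k \<equiv> (\<lambda>a. bichar q (s (axis k 1)) (axis a 1))"

text \<open>The operators \<open>eop k\<close> play the role of the derivations \<open>dl k\<close> for \<open>q'\<close>, so \<open>psi u\<close>, which
  collects the constant terms of their iterates at \<open>u\<close>, is the element of the shuffle algebra of \<open>q'\<close>
  that corresponds to \<open>u\<close>.\<close>

definition eop :: "'n \<Rightarrow> ('n list \<Rightarrow> 'k) \<Rightarrow> 'n list \<Rightarrow> 'k" where
  "eop k u = (if k = i then (- q i i) *f adx q i 1 u
     else (dr i ^^ m k) (dr k (wt (\<lambda>a. inverse (char k a)) u)))"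

fun psi :: "('n list \<Rightarrow> 'k) \<Rightarrow> 'n list \<Rightarrow> 'k" where
  "psi u [] = u []"
| "psi u (k # w) = psi (eop k u) w"

lemma lin_eop: "lin (eop k)"
  unfolding eop_def
  by (auto simp: lin_def lin_add[OF lin_dr_pow] lin_scale[OF lin_dr_pow]
      scale_simps mult.commute)

lemma dl_psi: "dl k (psi u) = psi (eop k u)"
  by (rule ext) (simp add: dl_def)

lemma lin_psi: "lin psi"
proof
  show "psi (f + g) = psi f + psi g" for f g
  proof
    show "psi (f + g) w = (psi f + psi g) w" for w
      by (induction w arbitrary: f g) (simp_all add: pointwise lin_add[OF lin_eop])
  qed
  show "psi (c *f f) = c *f psi f" for c f
  proof
    show "psi (c *f f) w = (c *f psi f) w" for w
      by (induction w arbitrary: f) (simp_all add: pointwise lin_scale[OF lin_eop])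
  qed
qed

lemmas psi_lin [simp] = lin_psi[THEN lin_add] lin_psi[THEN lin_diff] lin_psi[THEN lin_scale]
  lin_psi[THEN lin_zero]

lemma psi_vac: "psi vac = vac"
proof (rule eq_by_dl)
  show "dl k (psi vac) = dl k vac" for k
    by (simp add: dl_psi eop_def adx_vac lin_zero[OF lin_dr_pow])
qed simp

lemma dr_pow_wt: "(dr k ^^ n) (wt c f) = c k ^ n *f wt c ((dr k ^^ n) f)"
  by (induction n) (simp_all add: dr_wt mult.commute)

text \<open>\<open>psi\<close> maps degree d to degree \<open>s d\<close>, so a character has to be
  composed with \<open>s\<close>; the new values are those of the old character at
  \<open>s (axis k 1)\<close>.\<close>

lemma psi_wt:
  assumes "\<And>k. c k \<noteq> 0"
  shows "psi (wt c u) = wt (\<lambda>k. if k = i then inverse (c i) else c k * c i ^ m k) (psi u)"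
    (is "_ = wt ?c _")
proof
  have *: "eop k (wt c u) = ?c k *f wt c (eop k u)" for k u
  proof (cases "k = i")
    case True
    then show ?thesis using assms[of i]
      by (simp add: eop_def wt_adx mult.left_commute del: fs.scale_minus_left)
  next
    case False
    have "dr k (wt (\<lambda>a. inverse (char k a)) (wt c u)) =
        c k *f wt c (dr k (wt (\<lambda>a. inverse (char k a)) u))"
      by (simp add: wt_commute[of _ c] dr_wt[of k c])
    then show ?thesis using False
      by (simp add: eop_def lin_scale[OF lin_dr_pow] dr_pow_wt)
  qed
  show "psi (wt c u) w = wt ?c (psi u) w" for w
  proof (induction w arbitrary: u)
    case (Cons k w)
    have "dl k (psi (wt c u)) w = dl k (wt ?c (psi u)) w"
      using Cons[of "eop k u"] by (simp add: dl_psi dl_wt * pointwise del: if_split)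
    then show ?case by (simp only: Cons_dl)
  qed simp
qed

text \<open>This is why \<open>eop k\<close> preserves \<open>deriv_ker q i\<close>: after
  \<open>m k\<close> applications \<open>dr i\<close> has nothing left to strip. In the only
  critical case, \<open>adx\<close>, the remaining term of \<open>dr_pow_adx\<close> carries exactly
  the scalar that vanishes by \<open>cartan\<close>.\<close>

lemma deriv_ker_dr_pow:
  assumes "u \<in> deriv_ker q i" "k \<noteq> i"
  shows "(dr i ^^ Suc (m k)) (dr k u) = 0"
  using assms(1)
proof (induction rule: deriv_ker.induct)
  case deriv_ker_vac
  then show ?case by (simp only: vac_ops lin_zero[OF lin_dr_pow])
next
  case (deriv_ker_add f g)
  then show ?case by (simp only: op_add lin_add[OF lin_dr_pow]) simp
next
  case (deriv_ker_scale f c)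
  then show ?case by (simp only: op_scale lin_scale[OF lin_dr_pow]) simp
next
  case (deriv_ker_lmul f j)
  have pw: "(dr i ^^ n) (lmul q j g) = lmul q j ((dr i ^^ n) g)" for n g
    using deriv_ker_lmul.hyps(2) by (induction n) (simp_all add: dr_lmul)
  let ?x = "if j = k then wt (q j) f else 0"
  have "dr i ?x = 0" using deriv_ker_dr[OF deriv_ker_lmul.hyps(1)] by (simp add: dr_wt)
  then have x: "(dr i ^^ Suc (m k)) ?x = 0"
    by (simp only: funpow_Suc_right comp_def lin_zero[OF lin_dr_pow])
  show ?case
    by (simp only: dr_lmul lin_add[OF lin_dr_pow] x pw deriv_ker_lmul.IH op_zero add_0_right)
next
  case (deriv_ker_adx f)
  have c: "qnum (q i i) (Suc (m k)) * (1 - q i i ^ m k * (q i k * q k i)) = 0"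
    using cartan assms(2) by (simp add: cartan_def)
  have "dr k (adx q i 1 f) = adx q i (q i k * q k i) (dr k f)"
    using dr_adx_other[OF assms(2), of q 1 f] by simp
  then show ?case
    using dr_pow_adx[of "Suc (m k)" i q "q i k * q k i" "dr k f"] c deriv_ker_adx.IH
    by (simp only: diff_Suc_1 adx_lin add_0_left) (simp add: mult.commute)
qed

lemma eop_deriv_ker:
  assumes "u \<in> deriv_ker q i"
  shows "eop k u \<in> deriv_ker q i"
proof (cases "k = i")
  case True
  then show ?thesis using assms by (simp add: eop_def deriv_ker.intros del: fs.scale_minus_left)
next
  case False
  let ?u = "wt (\<lambda>a. inverse (char k a)) u"
  have u: "?u \<in> deriv_ker q i" by (rule deriv_ker_wt[OF assms])
  have "dr i ((dr i ^^ m k) (dr k ?u)) = 0" using deriv_ker_dr_pow[OF u False] by simp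
  moreover have "(dr i ^^ m k) (dr k ?u) \<in> shuffle_alg q"
    by (intro shuffle_alg_dr_pow shuffle_alg_dr deriv_ker_subset_shuffle_alg[OF u])
  ultimately show ?thesis using False by (simp add: deriv_ker_eq eop_def)
qed

text \<open>Both sides are compared under \<open>dl k\<close>. For \<open>k = i\<close> the rule
  \<open>dl_adx_same\<close> for \<open>q\<close> and the one for \<open>q'\<close> are the same
  relation with the roles of \<open>adx\<close> and \<open>dl i\<close> exchanged, provided that
  \<open>adx\<close> is rescaled by \<open>- q i i\<close>; this fixes the scalar in
  \<open>eop i\<close>. For \<open>k \<noteq> i\<close> left and right stripping commute, and the
  character in \<open>eop k\<close> contributes \<open>q' i k\<close>.\<close>

lemma psi_dl:
  assumes "u \<in> deriv_ker q i"
  shows "psi (dl i u) = adx q' i 1 (psi u)"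
proof
  let ?Q = "\<lambda>a. q i a * q a i" and ?Q' = "\<lambda>a. q' i a * q' a i"
  have "?Q' = (\<lambda>k. if k = i then inverse (?Q i) else ?Q k * ?Q i ^ m k)"
    by (auto simp: fun_eq_iff reflect_q_simps power_mult_distrib)
  then have wtQ: "wt ?Q' (psi u) = psi (wt ?Q u)" for u
    using psi_wt[of ?Q u] q_nz by simp
  show "psi (dl i u) w = adx q' i 1 (psi u) w" for w
    using assms
  proof (induction w arbitrary: u)
    case Nil
    have "dl i u [] = dr i u []" by (simp add: dl_def dr_def)
    then show ?case using deriv_ker_dr[OF Nil] by (simp add: pointwise)
  next
    case (Cons k w)
    show ?case
    proof (cases "k = i")
      case True
      have e: "psi (dl i (eop i u)) = - (q i i *f psi (dl i (adx q i 1 u)))"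
        by (simp add: eop_def fs.scale_minus_left[symmetric] del: fs.scale_minus_left)
      have e2: "psi (eop i f) = - (q i i *f psi (adx q i 1 f))" for f
        by (simp add: eop_def fs.scale_minus_left[symmetric] del: fs.scale_minus_left)
      have "dl i (adx q' i 1 (psi u)) w =
          (psi u - psi (wt ?Q u) + inverse (q i i) *f adx q' i 1 (psi (eop i u))) w"
        by (simp add: dl_adx_same wtQ dl_psi reflect_q_simps)
      also have "\<dots> = (psi u - psi (wt ?Q u) + inverse (q i i) *f psi (dl i (eop i u))) w"
        using Cons.IH[OF eop_deriv_ker[OF Cons.prems], of i] by (simp add: pointwise)
      also have "psi u - psi (wt ?Q u) + inverse (q i i) *f psi (dl i (eop i u)) =
          psi (eop i (dl i u))"
        using q_nz[of i i] unfolding e e2 by (simp add: dl_adx_same)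
      finally show ?thesis using True by (simp add: Cons_dl dl_psi del: psi.simps)
    next
      case False
      have pw: "(dr i ^^ n) (dl i f) = dl i ((dr i ^^ n) f)" for n f
        by (induction n) (simp_all add: dr_dl)
      have e: "eop k (dl i u) = char k i *f dl i (eop k u)"
      proof -
        have "wt (\<lambda>a. inverse (char k a)) (dl i u) =
            char k i *f dl i (wt (\<lambda>a. inverse (char k a)) u)"
          by (simp add: dl_wt bichar_nz)
        then show ?thesis using False
          by (simp add: eop_def dr_dl pw lin_scale[OF lin_dr_pow])
      qed
      have "char k i = q' i k"
        using False by (simp add: reflect_q_simps reflect_axis_other add_left axis_left[of _ "int _"] bichar_axis)
      then have "dl k (adx q' i 1 (psi u)) w = dl k (psi (dl i u)) w"
        using Cons.IH[OF eop_deriv_ker[OF Cons.prems], of k] False by (simp add: dl_adx_other dl_psi e pointwise)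
      then show ?thesis by (simp only: Cons_dl)
    qed
  qed
qed

lemma adx_mult_deriv_ker:
  assumes "u \<in> deriv_ker q i" "j \<noteq> i"
  shows "adx_mult q i j n u \<in> deriv_ker q i"
  using assms deriv_ker_dr[OF assms(1)] by (auto simp: deriv_ker_eq shuffle_alg_adx_mult dr_adx_mult)

text \<open>The scalar that \<open>eop j\<close> produces on the commutator replacing x'_j:
  \<open>q' j j\<close> comes from the character in \<open>eop j\<close>, the product from
  \<open>dr_adx_mult\<close>, and the factorial from \<open>dr i\<close> acting on a power of
  x_i.\<close>

definition kap :: "'n \<Rightarrow> 'k" where
  "kap j = q' j j * (\<Prod>t<m j. 1 - q i i ^ t * (q i j * q j i)) * qfact (q i i) (m j)"

lemma kap_nz: "j \<noteq> i \<Longrightarrow> kap j \<noteq> 0"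
  using cartan reflect_q_nz[of i m j j] by (auto simp: kap_def cartan_def qfact_def)

text \<open>Up to \<open>kap j\<close> this is the rule \<open>dl_lmul\<close> for
  \<open>q'\<close>, with \<open>eop k\<close> in place of \<open>dl k\<close> and the commutator in
  place of the letter. Hence the commutator of order \<open>m j\<close> is the generator
  x'_j.\<close>

lemma eop_adx_mult:
  assumes u: "u \<in> deriv_ker q i" and j: "j \<noteq> i"
  shows "eop k (adx_mult q i j (m j) u) = (if j = k then kap j *f u else 0) +
    q' j k *f adx_mult q i j (m j) (eop k u)"
proof (cases "k = i")
  case True
  \<comment> \<open>The next commutator vanishes by the choice of \<open>m j\<close>, so
    \<open>adx\<close> passes the commutator with a mere scalar.\<close>
  have "adx_mult q i j (Suc (m j)) u = 0"
    using cartan j by (intro adx_mult_eq_0[OF j]) (auto simp: cartan_def)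
  then have "adx q i 1 (adx_mult q i j (m j) u) = (q i j * q i i ^ m j) *f adx_mult q i j (m j) (adx q i 1 u)"
    by (simp only: adx_adx_mult add_0_left)
  then show ?thesis using True j
    by (auto simp: eop_def reflect_q_simps mult_ac simp del: fs.scale_minus_left)
next
  case False
  let ?c = "\<lambda>a. inverse (char k a)"
  let ?v = "wt ?c u"
  have vk: "?v \<in> deriv_ker q i" by (rule deriv_ker_wt[OF u])
  have pw: "(dr i ^^ n) (adx_mult q i j (m j) f) = adx_mult q i j (m j) ((dr i ^^ n) f)" for n f
    using j by (induction n) (simp_all add: dr_adx_mult)
  have "q' j k = ?c j * ?c i ^ m j"
    using j by (simp add: reflect_q_def reflect_axis_other[of j] add_right axis_right[of _ _ "int _"]
        power_inverse)
  then have 1: "wt ?c (adx_mult q i j (m j) u) = q' j k *f adx_mult q i j (m j) ?v"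
    by (simp add: wt_adx_mult)
  define C where "C = (\<Prod>t<m j. 1 - q i i ^ t * (q i j * q j i))"
  have 2: "(dr i ^^ m k) (dr k (adx_mult q i j (m j) ?v)) = adx_mult q i j (m j) ((dr i ^^ m k) (dr k ?v)) +
     (if k = j then (C * qfact (q i i) (m j)) *f u else 0)"
  proof (cases "k = j")
    case kj: True
    have z: "dr i (wt (q j) ?v) = 0" using deriv_ker_dr[OF deriv_ker_wt[OF vk]] .
    have "char j a = q j a * q i a ^ m j" for a
      using j by (simp add: reflect_axis_other add_left axis_left[of _ "int _"] bichar_axis)
    \<comment> \<open>The character in \<open>eop\<close> is chosen for this cancellation: it undoes
      the weight \<open>q j\<close> left by \<open>dr j\<close> and the weights \<open>q i\<close>
      left by the \<open>m j\<close> derivations \<open>dr i\<close>.\<close>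
    then have "(\<lambda>a. q i a ^ m j * (q j a * ?c a)) = (\<lambda>a. 1)"
      using kj by (simp add: fun_eq_iff q_nz field_simps)
    moreover have "(\<Prod>a\<leftarrow>w. 1 :: 'k) = 1" for w :: "'n list" by (induction w) auto
    then have "wt (\<lambda>a. 1) u = u" by (simp add: wt_def)
    ultimately have "wt (\<lambda>a. q i a ^ m j) (wt (q j) ?v) = u" by (simp add: wt_wt)
    then have "(dr i ^^ m j) ((lmul q i ^^ m j) (wt (q j) ?v)) = qfact (q i i) (m j) *f u"
      using dr_pow_lmul_pow[OF z, of "m j" q] by simp
    then show ?thesis using kj
      by (simp add: dr_adx_mult[OF j] C_def[symmetric] pw lin_add[OF lin_dr_pow]
          lin_scale[OF lin_dr_pow])
  next
    case False
    then show ?thesis by (simp add: dr_adx_mult[OF j] pw)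
  qed
  show ?thesis
    using False 2 by (auto simp: eop_def 1 lin_scale[OF lin_dr_pow] kap_def C_def
        scale_simps mult_ac)
qed

lemma psi_adx_mult:
  assumes "u \<in> deriv_ker q i" and j: "j \<noteq> i"
  shows "psi (adx_mult q i j (m j) u) = kap j *f lmul q' j (psi u)"
proof
  show "psi (adx_mult q i j (m j) u) w = (kap j *f lmul q' j (psi u)) w" for w
    using assms(1)
  proof (induction w arbitrary: u)
    case (Cons k w)
    have "dl k (psi (adx_mult q i j (m j) u)) w = dl k (kap j *f lmul q' j (psi u)) w"
      using Cons.IH[OF eop_deriv_ker[OF Cons.prems], of k]
      by (auto simp: dl_psi eop_adx_mult[OF Cons.prems j] dl_lmul scale_simps pointwise mult_ac)
    then show ?case by (simp only: Cons_dl)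
  qed (simp add: pointwise)
qed

text \<open>Each operation that generates \<open>deriv_ker q' i\<close> lifts along
  \<open>psi\<close>: a letter \<open>j \<noteq> i\<close> to the commutator of order
  \<open>m j\<close>, and the adjoint action of x'_i to \<open>dl i\<close>.\<close>

lemma deriv_ker_subset_psi: "f \<in> deriv_ker q' i \<Longrightarrow> f \<in> psi ` deriv_ker q i"
proof (induction rule: deriv_ker.induct)
  case deriv_ker_vac
  then show ?case using psi_vac deriv_ker.deriv_ker_vac by (metis image_eqI)
next
  case (deriv_ker_add f g)
  then show ?case by (auto simp flip: psi_lin(1) intro!: imageI deriv_ker.deriv_ker_add)
next
  case (deriv_ker_scale f c)
  then show ?case by (auto simp flip: psi_lin(3) intro!: imageI deriv_ker.deriv_ker_scale)
next
  case (deriv_ker_lmul f j)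
  then obtain u where u: "u \<in> deriv_ker q i" "f = psi u" by blast
  have "lmul q' j f = psi (inverse (kap j) *f adx_mult q i j (m j) u)"
    using psi_adx_mult[OF u(1) deriv_ker_lmul.hyps(2)] kap_nz[OF deriv_ker_lmul.hyps(2)] u by simp
  moreover have "inverse (kap j) *f adx_mult q i j (m j) u \<in> deriv_ker q i"
    by (intro deriv_ker.deriv_ker_scale adx_mult_deriv_ker[OF u(1) deriv_ker_lmul.hyps(2)])
  ultimately show ?case by (simp only: image_eqI)
next
  case (deriv_ker_adx f)
  then obtain u where u: "u \<in> deriv_ker q i" "f = psi u" by blast
  have "dl i u \<in> deriv_ker q i" using u deriv_ker_dr[OF u(1)] by (simp add: deriv_ker_eq shuffle_alg_dl dr_dl)
  then show ?case using psi_dl[OF u(1)] u(2) by (metis image_eqI)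
qed

lemma psi_proj: "psi (proj d u) = proj (s d) (psi u)"
proof
  show "psi (proj d u) w = proj (s d) (psi u) w" for w
  proof (induction w arbitrary: d u)
    case Nil
    have "s d = 0 \<longleftrightarrow> d = 0" by (metis reflect_reflect reflect_zero)
    then show ?case by (auto simp: proj_def)
  next
    case (Cons k w)
    \<comment> \<open>For \<open>k = i\<close> the degree rises by \<open>axis i 1\<close>;
      otherwise \<open>dr k\<close> and \<open>m k\<close> times \<open>dr i\<close> take away
      \<open>axis k 1 + axis i (m k)\<close>. Both are a drop by
      \<open>s (axis k 1)\<close>.\<close>
    have "eop k (proj d u) = proj (d - s (axis k 1)) (eop k u)"
    proof (cases "k = i")
      case True
      then show ?thesis
        by (simp add: eop_def adx_proj reflect_axis_same axis_uminus del: fs.scale_minus_left)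
    next
      case False
      then show ?thesis
        by (simp add: eop_def wt_proj dr_proj dr_pow_proj reflect_axis_other algebra_simps)
    qed
    then have "dl k (psi (proj d u)) w = dl k (proj (s d) (psi u)) w"
      using Cons[of "d - s (axis k 1)" "eop k u"] by (simp add: dl_psi dl_proj reflect_diff)
    then show ?case by (simp only: Cons_dl)
  qed
qed

lemma dimK_refl_le: "dimK q' i (s d) \<le> dimK q i d"
proof -
  let ?V = "deriv_ker q i \<inter> hcomp d"
  obtain W where W: "finite W" "(hcomp d :: ('n list \<Rightarrow> 'k) set) \<subseteq> fs.span W"
    using hcomp_finite_span by blast
  obtain W' where W': "finite W'" "(hcomp (s d) :: ('n list \<Rightarrow> 'k) set) \<subseteq> fs.span W'"
    using hcomp_finite_span by blast
  have "psi ` ?V \<subseteq> hcomp (s d)"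
    using psi_proj by (auto simp: hcomp_iff_proj) metis
  then have fin: "psi ` ?V \<subseteq> fs.span W'" using W' by blast
  have "deriv_ker q' i \<inter> hcomp (s d) \<subseteq> psi ` ?V"
  proof
    fix f assume f: "f \<in> deriv_ker q' i \<inter> hcomp (s d)"
    then obtain u where u: "u \<in> deriv_ker q i" "f = psi u" using deriv_ker_subset_psi by blast
    have "f = proj (s d) f" using f by (simp add: hcomp_iff_proj)
    then have "f = psi (proj d u)" using psi_proj u by metis
    moreover have "proj d u \<in> ?V"
      using u(1) deriv_ker_dr[OF u(1)] by (simp add: deriv_ker_eq shuffle_alg_proj dr_proj proj_hcomp)
    ultimately show "f \<in> psi ` ?V" by blast
  qed
  then have "dimK q' i (s d) \<le> fs.dim (psi ` ?V)"
    unfolding dimK_def by (intro dim_mono_finite[OF _ W'(1) fin])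
  also have "\<dots> \<le> dimK q i d"
    unfolding dimK_def using W
    by (intro dim_image_le[OF _ W(1) _ lin_psi] fs.subspace_inter subspace_deriv_ker subspace_hcomp) blast
  finally show ?thesis .
qed

end

lemma dimK_refl:
  fixes q :: "'n::finite \<Rightarrow> 'n \<Rightarrow> 'k::field_char_0"
  assumes "braiding q" "cartan q i m"
  shows "dimK (reflect_q q i m) i (reflect i m d) = dimK q i d"
proof (rule antisym)
  interpret reflection q i m using assms by (simp add: reflection_def reflection_axioms_def)
  interpret r: reflection "reflect_q q i m" i m
    using braiding_reflect_q cartan_reflect_q[OF assms] by (simp add: reflection_def reflection_axioms_def)
  show "dimK (reflect_q q i m) i (reflect i m d) \<le> dimK q i d" by (rule dimK_refl_le)
  show "dimK q i d \<le> dimK (reflect_q q i m) i (reflect i m d)"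
    using r.dimK_refl_le[of "reflect i m d"] by (simp add: reflect_q_reflect_q)
qed

section \<open>Root systems\<close>

definition exponents :: "'b set \<Rightarrow> ('b \<Rightarrow> enat) \<Rightarrow> ('b \<Rightarrow> int ^ 'n::finite) \<Rightarrow> int ^ 'n \<Rightarrow> ('b \<Rightarrow> nat) set"
  where
  "exponents S H g d = {a. (\<forall>s. s \<notin> S \<longrightarrow> a s = 0) \<and> (\<forall>s\<in>S. enat (a s) < H s) \<and>
     (\<Sum>s\<in>S. int (a s) *s g s) = d}"

text \<open>The last clause says that the Hilbert series of the Nichols algebra is the product, over
  \<open>s\<close> in \<open>S\<close>, of the series 1 + X^(g s) + X^(2 g s) + ... cut off before
  the power \<open>H s\<close>. The index type is kept abstract so that different indices may share
  a degree.\<close>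

definition rootsys ::
  "('n::finite \<Rightarrow> 'n \<Rightarrow> 'k::field) \<Rightarrow> 'b set \<Rightarrow> ('b \<Rightarrow> enat) \<Rightarrow> ('b \<Rightarrow> int ^ 'n) \<Rightarrow> bool" where
  "rootsys q S H g \<longleftrightarrow> finite S \<and>
     (\<forall>s\<in>S. (\<forall>k. 0 \<le> g s $ k) \<and> g s \<noteq> 0 \<and> H s = pbw_height (bichar q (g s) (g s))) \<and>
     (\<forall>d. dimB q d = card (exponents S H g d))"

lemma exponents_component:
  "a \<in> exponents S H g d \<Longrightarrow> d $ k = (\<Sum>s\<in>S. int (a s) * g s $ k)"
  by (auto simp: exponents_def vector_smult_component)

lemma exponents_le:
  assumes "finite S" "\<forall>s\<in>S. \<forall>k. 0 \<le> g s $ k" "a \<in> exponents S H g d" "s \<in> S"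
  shows "int (a s) * g s $ k \<le> d $ k"
  unfolding exponents_component[OF assms(3)] using assms by (intro member_le_sum) auto

lemma nonzero_component: "v \<noteq> (0 :: int ^ 'n::finite) \<Longrightarrow> \<exists>k. v $ k \<noteq> 0"
  by (auto simp: vec_eq_iff)

lemma finite_exponents:
  assumes "finite S" "\<forall>s\<in>S. (\<forall>k. 0 \<le> g s $ k) \<and> g s \<noteq> 0"
  shows "finite (exponents S H g d)"
proof (rule finite_subset)
  let ?N = "nat (\<Sum>k\<in>UNIV. d $ k)"
  show "exponents S H g d \<subseteq> {a. \<forall>s. (s \<in> S \<longrightarrow> a s \<in> {..?N}) \<and> (s \<notin> S \<longrightarrow> a s = 0)}"
  proof clarify
    fix a s assume a: "a \<in> exponents S H g d"
    have "a s \<le> ?N" if s: "s \<in> S"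
    proof -
      have pos: "0 \<le> d $ k" for k
        unfolding exponents_component[OF a] using assms by (intro sum_nonneg) auto
      obtain k where k: "g s $ k \<noteq> 0" using assms s nonzero_component by blast
      then have "1 \<le> g s $ k" using assms s by (metis int_one_le_iff_zero_less order_le_neq_trans)
      then have "int (a s) \<le> int (a s) * g s $ k"
        using mult_left_mono[of 1 "g s $ k" "int (a s)"] by simp
      also have "\<dots> \<le> d $ k" using exponents_le[OF assms(1) _ a s] assms(2) by blast
      also have "\<dots> \<le> (\<Sum>k\<in>UNIV. d $ k)" using pos by (intro member_le_sum) auto
      finally show ?thesis by simp
    qed
    then show "(s \<in> S \<longrightarrow> a s \<in> {..?N}) \<and> (s \<notin> S \<longrightarrow> a s = 0)"
      using a by (auto simp: exponents_def)
  qed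
  show "finite {a. \<forall>s. (s \<in> S \<longrightarrow> a s \<in> {..?N}) \<and> (s \<notin> S \<longrightarrow> a s = 0)}"
    using assms(1) by (intro finite_set_of_finite_funs) auto
qed

lemma exponents_multiple:
  assumes "finite S" "s \<in> S" "enat c < H s" "\<forall>t\<in>S. 2 \<le> H t"
  shows "(\<lambda>t. if t = s then c else 0) \<in> exponents S H g (int c *s g s)"
proof -
  have "0 < H t" if "t \<in> S" for t
    using assms(4) that by (metis gr_zeroI not_numeral_le_zero)
  moreover have "(\<Sum>t\<in>S. int (if t = s then c else 0) *s g t) = int c *s g s"
    using assms by (simp add: vec_eq_iff vector_smult_component if_distrib[of int] if_distrib[of "\<lambda>x. x * _"] cong: if_cong)
  ultimately show ?thesis using assms by (auto simp: exponents_def zero_enat_def)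
qed

lemma exponents_single:
  assumes "finite S" "s \<in> S" "\<forall>t\<in>S. 2 \<le> H t"
  shows "(\<lambda>t. if t = s then 1 else 0) \<in> exponents S H g (g s)"
proof -
  have "enat 1 < 2" by (simp add: numeral_eq_enat)
  then have "enat 1 < H s" using assms order_less_le_trans by blast
  moreover have "int 1 *s g s = g s" by (simp add: vec_eq_iff vector_smult_component)
  ultimately show ?thesis using exponents_multiple[OF assms(1,2) _ assms(3), of 1 g] by simp
qed

text \<open>The combinatorial mirror of \<open>dimB_decomp\<close>: the exponent of
  \<open>s0\<close> is split off.\<close>

lemma card_exponents_split:
  assumes S: "finite S" "\<forall>s\<in>S. (\<forall>k. 0 \<le> g s $ k) \<and> g s \<noteq> 0"
    and s0: "s0 \<in> S" "g s0 = axis i 1" and N: "d $ i \<le> int N"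
  shows "card (exponents S H g d) =
    (\<Sum>a | a \<le> N \<and> enat a < H s0. card (exponents (S - {s0}) H g (d - axis i (int a))))"
proof -
  let ?A = "{a. a \<le> N \<and> enat a < H s0}"
  let ?E = "\<lambda>a. (\<lambda>b. b(s0 := a)) ` exponents (S - {s0}) H g (d - axis i (int a))"
  have ax: "int a *s g s0 = axis i (int a)" for a
    by (simp add: vec_eq_iff s0 vector_smult_component axis_component)
  have sm: "(\<Sum>s\<in>S. int (b s) *s g s) =
      axis i (int (b s0)) + (\<Sum>s\<in>S - {s0}. int (b s) *s g s)" for b
    using sum.remove[OF S(1) s0(1), of "\<lambda>s. int (b s) *s g s"] ax by simp
  have "exponents S H g d = (\<Union>a\<in>?A. ?E a)"
  proof (intro equalityI subsetI)
    fix b assume b: "b \<in> exponents S H g d"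
    have "int (b s0) \<le> d $ i"
      using exponents_le[OF S(1) _ b s0(1), of i] S(2) by (simp add: s0 axis_component)
    then have 1: "b s0 \<in> ?A" using N b s0 by (auto simp: exponents_def)
    have "b(s0 := 0) \<in> exponents (S - {s0}) H g (d - axis i (int (b s0)))"
    proof -
      have "(\<Sum>s\<in>S - {s0}. int ((b(s0 := 0)) s) *s g s) = (\<Sum>s\<in>S - {s0}. int (b s) *s g s)"
        by (rule sum.cong) auto
      also have "\<dots> = d - axis i (int (b s0))" using b sm[of b] by (auto simp: exponents_def algebra_simps)
      finally show ?thesis using b by (auto simp: exponents_def)
    qed
    moreover have "b = (b(s0 := 0))(s0 := b s0)" by simp
    ultimately have "b \<in> ?E (b s0)" by blast
    then show "b \<in> (\<Union>a\<in>?A. ?E a)" using 1 by blast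
  next
    fix b assume "b \<in> (\<Union>a\<in>?A. ?E a)"
    then obtain a c where a: "a \<in> ?A" "c \<in> exponents (S - {s0}) H g (d - axis i (int a))"
      "b = c(s0 := a)" by blast
    have "(\<Sum>s\<in>S - {s0}. int (b s) *s g s) = (\<Sum>s\<in>S - {s0}. int (c s) *s g s)"
      by (rule sum.cong) (auto simp: a)
    then have "(\<Sum>s\<in>S. int (b s) *s g s) = d" using a by (simp add: sm exponents_def)
    then show "b \<in> exponents S H g d" using a s0 by (auto simp: exponents_def)
  qed
  also have "card \<dots> = (\<Sum>a\<in>?A. card (?E a))"
  proof (rule card_UN_disjoint)
    show "finite ?A" by (rule finite_subset[of _ "{..N}"]) auto
    show "\<forall>a\<in>?A. finite (?E a)" using S by (auto intro!: finite_imageI finite_exponents)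
    show "\<forall>a\<in>?A. \<forall>b\<in>?A. a \<noteq> b \<longrightarrow> ?E a \<inter> ?E b = {}"
      by (auto simp: fun_eq_iff split: if_splits)
  qed
  also have "\<dots> = (\<Sum>a\<in>?A. card (exponents (S - {s0}) H g (d - axis i (int a))))"
  proof (intro sum.cong refl card_image inj_onI)
    fix a b c
    assume b: "b \<in> exponents (S - {s0}) H g (d - axis i (int a))"
      and c: "c \<in> exponents (S - {s0}) H g (d - axis i (int a))" and e: "b(s0 := a) = c(s0 := a)"
    have "b s0 = c s0" using b c by (auto simp: exponents_def)
    then show "b = c" using e by (metis fun_upd_triv fun_upd_upd)
  qed
  finally show ?thesis .
qed

section \<open>Dimensions in the multiples of a simple root\<close>

lemma dimK_pos_nonneg:
  assumes "0 < dimK q i d"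
  shows "0 \<le> d $ k"
proof (rule ccontr)
  assume "\<not> 0 \<le> d $ k"
  then have "deriv_ker q i \<inter> hcomp d = {0}"
    using hcomp_negative[of d k] subspace_deriv_ker subspace_hcomp fs.subspace_0 by fastforce
  then show False using assms by (simp add: dimK_def dim_zero)
qed

text \<open>A nonempty word whose degree is a multiple of e_i ends in \<open>i\<close>, so a
  function annihilated by \<open>dr i\<close> vanishes on it.\<close>

lemma dimK_axis:
  fixes q :: "'n::finite \<Rightarrow> 'n \<Rightarrow> 'k::field_char_0"
  shows "dimK q i (axis i c) = (if c = 0 then 1 else 0)"
proof (cases "c = 0")
  case True
  have "wdeg w = 0 \<longleftrightarrow> w = []" for w :: "'n list"
    using length_wdeg[of w] by auto
  then have "f \<in> deriv_ker q i \<inter> hcomp 0 \<longleftrightarrow> f \<in> fs.span {vac}" for f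
  proof (intro iffI)
    assume "f \<in> deriv_ker q i \<inter> hcomp 0" "\<And>w :: 'n list. (wdeg w = 0) = (w = [])"
    then have "f = f [] *f vac" by (auto simp: fun_eq_iff pointwise vac_def hcomp_def)
    then show "f \<in> fs.span {vac}" by (metis fs.span_base fs.span_scale singletonI)
  next
    assume f: "f \<in> fs.span {vac}" and w: "\<And>w :: 'n list. (wdeg w = 0) = (w = [])"
    have "vac \<in> deriv_ker q i \<inter> hcomp 0" by (auto simp: deriv_ker_vac hcomp_def vac_def w)
    then show "f \<in> deriv_ker q i \<inter> hcomp 0"
      using f fs.span_minimal[of "{vac}" "deriv_ker q i \<inter> hcomp 0"]
        fs.subspace_inter[OF subspace_deriv_ker subspace_hcomp] by blast
  qed
  then have "deriv_ker q i \<inter> hcomp 0 = fs.span {vac}" by blast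
  moreover have "vac \<noteq> (0 :: 'n list \<Rightarrow> 'k)" by (auto simp: fun_eq_iff vac_def pointwise)
  ultimately show ?thesis using True
    by (simp add: dimK_def fs.dim_eq_card_independent)
next
  case False
  have "f = 0" if f: "f \<in> deriv_ker q i" "f \<in> hcomp (axis i c)" for f
  proof
    fix w
    show "f w = 0 w"
    proof (cases "wdeg w = axis i c")
      case True
      then have "w \<noteq> []" using False by (metis axis_component wdeg_simps(1) zero_index)
      then obtain v k where w: "w = v @ [k]" by (metis rev_exhaust)
      have "1 \<le> wdeg w $ k" using wdeg_nonneg[of v k] by (simp add: w axis_component)
      then have "k = i" using True by (auto simp: axis_component split: if_splits)
      then show ?thesis using deriv_ker_dr[OF f(1)] by (simp add: w snoc_dr pointwise)
    next
      case False
      then show ?thesis using f by (simp add: hcomp_def pointwise)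
    qed
  qed
  then have "deriv_ker q i \<inter> hcomp (axis i c) = {0}"
    using deriv_ker_zero[of q i] fs.subspace_0[OF subspace_hcomp, of "axis i c"] by auto
  then show ?thesis using False by (simp add: dimK_def dim_zero)
qed

lemma dimB_axis:
  fixes q :: "'n::finite \<Rightarrow> 'n \<Rightarrow> 'k::field_char_0"
  shows "dimB q (axis i (int a)) = (if enat a < pbw_height (q i i) then 1 else 0)"
proof -
  have "dimB q (axis i (int a)) =
     (\<Sum>b | b \<le> a \<and> enat b < pbw_height (q i i). dimK q i (axis i (int a) - axis i (int b)))"
    by (rule dimB_decomp) (simp add: axis_component)
  also have "\<dots> = (\<Sum>b | b \<le> a \<and> enat b < pbw_height (q i i). if b = a then 1 else 0)"
  proof (rule sum.cong)
    fix b
    have "axis i (int a) - axis i (int b) = (axis i (int a - int b) :: int ^ 'n)"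
      by (simp add: vec_eq_iff axis_component)
    then show "dimK q i (axis i (int a) - axis i (int b)) = (if b = a then 1 else 0)"
      by (simp add: dimK_axis)
  qed simp
  finally show ?thesis by (simp add: sum.delta)
qed

lemma adx_mult_proj: "adx_mult q i j s (proj d f) = proj (d + axis j 1 + axis i (int s)) (adx_mult q i j s f)"
proof (induction s arbitrary: d f)
  case (Suc s)
  have "axis i (1 + int s) = axis i 1 + (axis i (int s) :: int ^ 'a)" by (rule axis_add)
  then show ?case by (simp add: Suc lmul_proj algebra_simps)
qed (simp add: lmul_proj)

lemma mult_order_inverse: "mult_order (inverse x) = mult_order (x::'k::field)"
  by (simp add: mult_order_def power_inverse)

lemma pbw_height_inverse: "pbw_height (inverse x) = pbw_height (x::'k::field)"
  by (simp add: pbw_height_def mult_order_inverse)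

section \<open>Factorised Hilbert series and their reflections\<close>

locale rootsystem = braiding q for q :: "'n::finite \<Rightarrow> 'n \<Rightarrow> 'k::field_char_0" +
  fixes S :: "'b set" and H :: "'b \<Rightarrow> enat" and g :: "'b \<Rightarrow> int ^ 'n"
  assumes rootsys: "rootsys q S H g"
begin

lemma fin: "finite S" and pos: "\<forall>s\<in>S. (\<forall>k. 0 \<le> g s $ k) \<and> g s \<noteq> 0"
  and H: "s \<in> S \<Longrightarrow> H s = pbw_height (bichar q (g s) (g s))"
  and dimB: "dimB q d = card (exponents S H g d)"
  using rootsys by (auto simp: rootsys_def)

lemma H2: "\<forall>t\<in>S. 2 \<le> H t"
  by (simp add: H pbw_height_ge_2)

text \<open>Degree e_i has dimension 1, so some monomial has this degree; any of its factors has a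
  nonzero degree that is componentwise at most e_i.\<close>

lemma simple_root_exists: "\<exists>s\<in>S. g s = axis i 1"
proof -
  have "card (exponents S H g (axis i 1)) = 1"
  proof -
    have "enat 1 < 2" by (simp add: numeral_eq_enat)
    then have "enat 1 < pbw_height (q i i)" using pbw_height_ge_2 order_less_le_trans by blast
    then show ?thesis using dimB_axis[of q i 1] dimB by simp
  qed
  then obtain a where a: "a \<in> exponents S H g (axis i 1)" by (metis card_eq_0_iff ex_in_conv zero_neq_one)
  have "\<exists>s\<in>S. a s \<noteq> 0"
  proof (rule ccontr)
    assume "\<not> ?thesis"
    then have "(axis i 1 :: int ^ 'n) $ i = 0" unfolding exponents_component[OF a] by simp
    then show False by (simp add: axis_component)
  qed
  then obtain s where s: "s \<in> S" "a s \<noteq> 0" by blast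
  have le: "g s $ k \<le> axis i 1 $ k" for k
  proof -
    have "g s $ k \<le> int (a s) * g s $ k"
      using mult_right_mono[of 1 "int (a s)" "g s $ k"] s pos by simp
    also have "\<dots> \<le> axis i 1 $ k" using exponents_le[OF fin _ a s(1)] pos by blast
    finally show ?thesis .
  qed
  have 0: "g s $ k = 0" if "k \<noteq> i" for k
    using le[of k] pos s(1) that by (simp add: axis_component order_antisym)
  obtain k where "g s $ k \<noteq> 0" using nonzero_component pos s(1) by blast
  then have "g s $ i \<noteq> 0" using 0 by metis
  moreover have "0 \<le> g s $ i" using pos s(1) by blast
  ultimately have "g s $ i = 1" using le[of i] by (simp add: axis_component)
  then have "g s = axis i 1" using 0 by (simp add: vec_eq_iff axis_component)
  then show ?thesis using s by blast
qed

text \<open>If they differed, the generator \<open>s\<close> and the \<open>n\<close>-th power of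
  \<open>s0\<close> would be two monomials of degree n e_i, where the dimension is at most 1. The
  power is admissible because \<open>s\<close> makes this dimension nonzero, which puts
  \<open>n\<close> below the height.\<close>

lemma simple_root_unique:
  assumes s0: "s0 \<in> S" "g s0 = axis i 1" and s: "s \<in> S" "g s = axis i c"
  shows "s = s0"
proof (rule ccontr)
  assume ne: "s \<noteq> s0"
  have "c \<noteq> 0" using s pos by (metis axis_zero)
  moreover have "0 \<le> c" using s pos by (metis axis_component)
  ultimately obtain n where n: "c = int n" "0 < n" by (metis zero_le_imp_eq_int gr0I int_ops(1))
  have a: "(\<lambda>t. if t = s then 1 else 0) \<in> exponents S H g (axis i (int n))"
    using exponents_single[OF fin s(1) H2, of g] s n by simp
  have fe: "finite (exponents S H g (axis i (int n)))" by (rule finite_exponents[OF fin pos])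
  have "card (exponents S H g (axis i (int n))) \<noteq> 0" using a fe by auto
  then have "enat n < pbw_height (q i i)" and c1: "card (exponents S H g (axis i (int n))) = 1"
    using dimB_axis[of q i n] dimB[of "axis i (int n)"] by (auto split: if_splits)
  then have "enat n < H s0" using H[OF s0(1)] s0(2) by (simp add: bichar_axis)
  moreover have "int n *s g s0 = axis i (int n)"
    by (simp add: vec_eq_iff s0 vector_smult_component axis_component)
  ultimately have b: "(\<lambda>t. if t = s0 then n else 0) \<in> exponents S H g (axis i (int n))"
    using exponents_multiple[OF fin s0(1) _ H2, of n g] by simp
  obtain x where "exponents S H g (axis i (int n)) = {x}" using c1 card_1_singletonE by blast
  then have "(\<lambda>t. if t = s then 1 else 0) = (\<lambda>t. if t = s0 then n else (0::nat))" using a b by simp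
  then show False using ne n by (metis zero_neq_one)
qed

text \<open>Both sides satisfy the same recursion, by \<open>dimB_decomp\<close> and
  \<open>card_exponents_split\<close>: the wanted term is the one with \<open>a = 0\<close>, and the
  others have a smaller \<open>i\<close>-coordinate.\<close>

lemma dimK_card:
  assumes s0: "s0 \<in> S" "g s0 = axis i 1"
  shows "dimK q i d = card (exponents (S - {s0}) H g d)"
\<comment> \<open>The \<open>+ 1\<close> separates the coordinate 0 from the negative ones, which
  all have measure 0.\<close>
proof (induction "nat (d $ i + 1)" arbitrary: d rule: less_induct)
  case less
  show ?case
  proof (cases "d $ i < 0")
    case True
    have "exponents (S - {s0}) H g d = {}"
    proof (rule equals0I)
      fix a assume a: "a \<in> exponents (S - {s0}) H g d"
      have "0 \<le> d $ i" unfolding exponents_component[OF a] using pos by (intro sum_nonneg) auto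
      then show False using True by simp
    qed
    then show ?thesis using dimK_pos_nonneg[of q i d i] True by auto
  next
    case False
    define N where "N = nat (d $ i)"
    have N: "d $ i \<le> int N" using False by (simp add: N_def)
    let ?A = "{a. a \<le> N \<and> enat a < pbw_height (q i i)}"
    have fA: "finite ?A" by (rule finite_subset[of _ "{..N}"]) auto
    have "0 < pbw_height (q i i)" using pbw_height_ge_2[of "q i i"] by (metis gr_zeroI not_numeral_le_zero)
    then have 0: "0 \<in> ?A" by (simp add: zero_enat_def)
    have h: "H s0 = pbw_height (q i i)" using H[OF s0(1)] s0(2) by (simp add: bichar_axis)
    have "(\<Sum>a\<in>?A. dimK q i (d - axis i (int a))) =
        (\<Sum>a\<in>?A. card (exponents (S - {s0}) H g (d - axis i (int a))))"
      using dimB_decomp[OF N, of q] card_exponents_split[OF fin pos s0 N, of H] dimB[of d] h by simp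
    moreover have "(\<Sum>a\<in>?A - {0}. dimK q i (d - axis i (int a))) =
        (\<Sum>a\<in>?A - {0}. card (exponents (S - {s0}) H g (d - axis i (int a))))"
      using False by (intro sum.cong refl less) (auto simp: axis_component)
    ultimately show ?thesis
      using sum.remove[OF fA 0, of "\<lambda>a. dimK q i (d - axis i (int a))"]
        sum.remove[OF fA 0, of "\<lambda>a. card (exponents (S - {s0}) H g (d - axis i (int a)))"] by simp
  qed
qed

text \<open>Otherwise the \<open>t\<close>-fold commutator of x_i with x_j is, for every
  \<open>t\<close>, a nonzero element of \<open>deriv_ker q i\<close> of degree e_j + t e_i. A
  monomial of this degree without \<open>s0\<close> has only factors with positive
  \<open>j\<close>-coordinate. These coordinates add up to 1, so \<open>t\<close> is at most the
  bound \<open>M\<close> for all \<open>i\<close>-coordinates in the finite set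
  \<open>S\<close>.\<close>

lemma cartan_exists: "\<exists>m. cartan q i m"
proof -
  let ?P = "\<lambda>j t. qnum (q i i) (Suc t) * (1 - q i i ^ t * (q i j * q j i)) = 0"
  have ex: "\<exists>t. ?P j t" if j: "j \<noteq> i" for j
  proof (rule ccontr)
    assume "\<not> ?thesis"
    then have nz: "qnum (q i i) (Suc t) \<noteq> 0" "1 - q i i ^ t * (q i j * q j i) \<noteq> 0" for t by auto
    obtain s0 where s0: "s0 \<in> S" "g s0 = axis i 1" using simple_root_exists by blast
    define M where "M = (\<Sum>s\<in>S. g s $ i)"
    have "int t \<le> M" for t
    proof -
      let ?d = "axis j 1 + axis i (int t)" and ?f = "adx_mult q i j t vac"
      have "?f \<in> deriv_ker q i" using j by (auto simp: deriv_ker_eq shuffle_alg_adx_mult shuffle_alg_vac dr_adx_mult)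
      moreover have "?f \<in> hcomp ?d"
        using adx_mult_proj[of q i j t 0 vac] by (simp add: proj_vac hcomp_iff_proj)
      moreover have "?f \<noteq> 0"
      proof
        assume "?f = 0"
        then have "(\<Prod>u<t. 1 - q i i ^ u * (q i j * q j i)) *f (lmul q i ^^ t) vac = 0"
          using dr_adx_mult[OF j, of j q t vac] by simp
        moreover have "qnum (q i i) u \<noteq> 0" if "0 < u" for u using nz(1)[of "u - 1"] that by simp
        ultimately show False using nz(2) lmul_pow_vac_nonzero[of t q i] by auto
      qed
      moreover obtain W where "finite W" "(hcomp ?d :: ('n list \<Rightarrow> 'k) set) \<subseteq> fs.span W"
        using hcomp_finite_span by blast
      ultimately have "0 < dimK q i ?d"
        unfolding dimK_def by (intro dim_pos[of ?f _ W]) auto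
      then obtain a where a: "a \<in> exponents (S - {s0}) H g ?d"
        unfolding dimK_card[OF s0] by (metis card.empty ex_in_conv less_numeral_extra(3))
      have fin': "finite (S - {s0})" and pos': "\<forall>s\<in>S - {s0}. \<forall>k. 0 \<le> g s $ k"
        using fin pos by auto
      have M: "g s $ i \<le> M" if "s \<in> S" for s
        unfolding M_def using fin pos that by (intro member_le_sum) auto
      \<comment> \<open>A factor without x_j would have a multiple of e_i as its degree, and only
        \<open>s0\<close> has such a degree.\<close>
      have ge: "1 \<le> g s $ j" if s: "s \<in> S - {s0}" "a s \<noteq> 0" for s
      proof (rule ccontr)
        assume "\<not> 1 \<le> g s $ j"
        then have zj: "g s $ j = 0" using pos' s(1) by (metis int_one_le_iff_zero_less order_le_less)
        have "g s $ k = 0" if k: "k \<noteq> i" for k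
        proof (cases "k = j")
          case False
          then have "int (a s) * g s $ k \<le> 0"
            using exponents_le[OF fin' pos' a s(1), of k] k by (simp add: axis_component)
          then show ?thesis using pos' s by (metis mult_le_0_iff of_nat_le_0_iff order_antisym)
        qed (use zj in simp)
        then have "g s = axis i (g s $ i)" by (auto simp: vec_eq_iff axis_component)
        then show False using simple_root_unique[OF s0, of s] s by blast
      qed
      have "int t = (\<Sum>s\<in>S - {s0}. int (a s) * g s $ i)"
        using exponents_component[OF a, of i] j by (simp add: axis_component)
      also have "\<dots> \<le> (\<Sum>s\<in>S - {s0}. int (a s) * g s $ j * M)"
      proof (rule sum_mono)
        fix s assume s: "s \<in> S - {s0}"
        show "int (a s) * g s $ i \<le> int (a s) * g s $ j * M"
        proof (cases "a s = 0")
          case False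
          have "0 \<le> M" using M[of s0] s0 by (simp add: axis_component)
          then have "g s $ i \<le> g s $ j * M"
            using M[of s] s mult_right_mono[OF ge[OF s False], of M] by simp
          then show ?thesis by (simp add: mult.assoc mult_left_mono)
        qed simp
      qed
      also have "\<dots> = ?d $ j * M"
        unfolding exponents_component[OF a, of j] by (simp add: sum_distrib_right)
      also have "\<dots> = M" using j by (simp add: axis_component)
      finally show ?thesis .
    qed
    from this[of "nat (M + 1)"] this[of 0] show False by simp
  qed
  define m where "m j = (LEAST t. ?P j t)" for j
  have "cartan q i m"
    unfolding cartan_def
  proof (intro allI impI conjI)
    fix j assume "j \<noteq> i"
    show "?P j (m j)" unfolding m_def by (rule LeastI_ex[OF ex[OF \<open>j \<noteq> i\<close>]])
    show "\<not> ?P j t" if "t < m j" for t using that not_less_Least unfolding m_def by blast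
  qed
  then show ?thesis by blast
qed

text \<open>The factors of \<open>S - {s0}\<close> describe \<open>deriv_ker\<close> and are
  reflected by \<open>dimK_refl\<close>; the factor of \<open>s0\<close> is put back by
  \<open>dimB_decomp\<close> for the new matrix. Heights persist since the new bicharacter takes
  inverse values at the reflected degrees.\<close>

lemma rootsys_reflect:
  assumes s0: "s0 \<in> S" "g s0 = axis i 1" and m: "cartan q i m"
  defines "g' \<equiv> \<lambda>s. if s = s0 then axis i 1 else reflect i m (g s)"
  shows "rootsys (reflect_q q i m) S H g'"
proof -
  have b: "braiding q" ..
  have fin': "finite (S - {s0})" and H2': "\<forall>t\<in>S - {s0}. 2 \<le> H t" using fin H2 by auto
  have pos': "(\<forall>k. 0 \<le> g' s $ k) \<and> g' s \<noteq> 0" if s: "s \<in> S" for s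
  proof (cases "s = s0")
    case True
    then show ?thesis by (auto simp: g'_def axis_component vec_eq_iff)
  next
    case False
    have "finite (exponents (S - {s0}) H g (g s))" by (rule finite_exponents[OF fin']) (use pos in auto)
    then have "0 < card (exponents (S - {s0}) H g (g s))"
      using exponents_single[OF fin' _ H2', of s g] s False by (auto simp: card_gt_0_iff)
    \<comment> \<open>No reflected degree gets a negative coordinate, because it is the degree of a
      nonzero element of the reflected kernel.\<close>
    then have "0 < dimK (reflect_q q i m) i (reflect i m (g s))"
      by (simp add: dimK_refl[OF b m] dimK_card[OF s0])
    then have "\<forall>k. 0 \<le> reflect i m (g s) $ k" using dimK_pos_nonneg by blast
    moreover have "reflect i m (g s) \<noteq> 0"
      using pos s by (metis reflect_reflect reflect_zero)
    ultimately show ?thesis using False by (simp add: g'_def)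
  qed
  have hg: "H s = pbw_height (bichar (reflect_q q i m) (g' s) (g' s))" if s: "s \<in> S" for s
  proof (cases "s = s0")
    case True
    then show ?thesis using H[OF s0(1)] by (simp add: g'_def s0 bichar_axis reflect_q_simps pbw_height_inverse)
  next
    case False
    then show ?thesis using H[OF s] by (simp add: g'_def bichar_reflect_q pbw_height_inverse)
  qed
  have reflect_sum: "reflect i m (\<Sum>s\<in>A. f s) = (\<Sum>s\<in>A. reflect i m (f s))"
    for A and f :: "'b \<Rightarrow> int ^ 'n"
    by (induction A rule: infinite_finite_induct) (simp_all add: reflect_add)
  have reflect_smult: "reflect i m (c *s v) = c *s reflect i m v" for c v
    by (simp add: vec_eq_iff reflect_component vector_smult_component sum_distrib_left algebra_simps)
  have ex: "exponents (S - {s0}) H g' d = exponents (S - {s0}) H g (reflect i m d)" for d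
  proof -
    have "(\<Sum>s\<in>S - {s0}. int (a s) *s g' s) = reflect i m (\<Sum>s\<in>S - {s0}. int (a s) *s g s)" for a
      unfolding reflect_sum by (intro sum.cong) (auto simp: g'_def reflect_smult)
    then have "(\<Sum>s\<in>S - {s0}. int (a s) *s g' s) = d \<longleftrightarrow>
        (\<Sum>s\<in>S - {s0}. int (a s) *s g s) = reflect i m d" for a
      by (metis reflect_reflect)
    then show ?thesis by (simp add: exponents_def)
  qed
  have "dimB (reflect_q q i m) d = card (exponents S H g' d)" for d
  proof -
    define N where "N = nat (d $ i)"
    have N: "d $ i \<le> int N" by (simp add: N_def)
    have h: "pbw_height (reflect_q q i m i i) = H s0"
      using H[OF s0(1)] by (simp add: s0 bichar_axis reflect_q_simps pbw_height_inverse)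
    have pos'': "\<forall>s\<in>S. (\<forall>k. 0 \<le> g' s $ k) \<and> g' s \<noteq> 0" using pos' by blast
    have g0: "g' s0 = axis i 1" by (simp add: g'_def)
    have "dimK (reflect_q q i m) i v = card (exponents (S - {s0}) H g' v)" for v
      using dimK_refl[OF b m, of "reflect i m v"] by (simp add: ex dimK_card[OF s0])
    then show ?thesis
      unfolding dimB_decomp[OF N, of "reflect_q q i m"] card_exponents_split[OF fin pos'' s0(1) g0 N] h by simp
  qed
  then show ?thesis using fin pos' hg by (simp add: rootsys_def)
qed

end

text \<open>Walk through the Weyl groupoid: \<open>g\<close> is the image of the original system \<open>g0\<close> under the
  linear map \<open>f\<close>, up to the sign that is positive exactly on \<open>P\<close>.  As long as \<open>P\<close> is not empty,
  some simple root of \<open>g\<close> comes from a member of \<open>P\<close>, and reflecting in it removes this member.\<close>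

lemma roots_not_proportional_aux:
  fixes q :: "'n::finite \<Rightarrow> 'n \<Rightarrow> 'k::field_char_0" and g0 :: "'b \<Rightarrow> int ^ 'n"
    and f f' :: "int ^ 'n \<Rightarrow> int ^ 'n"
  assumes "braiding q" "rootsys q S H g" "P \<subseteq> S"
    and "\<forall>s\<in>S. (\<forall>k. 0 \<le> g0 s $ k) \<and> g0 s \<noteq> 0"
    and "\<And>x y. f (x + y) = f x + f y" "\<And>x y. f' (x + y) = f' x + f' y"
    and "\<And>x. f' (f x) = x"
    and "\<And>s. s \<in> P \<Longrightarrow> g s = f (g0 s)" "\<And>s. s \<in> S - P \<Longrightarrow> g s = - f (g0 s)"
    and "s \<in> P" "t \<in> S" "a \<noteq> 0" "a *s g0 t = b *s g0 s"
  shows "t = s"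
  using assms(1-3,5-10,13)
proof (induction "card P" arbitrary: q g P f f' s rule: less_induct)
  case less
  interpret rootsystem q S H g
    using less.prems(1,2) by (simp add: rootsystem_def rootsystem_axioms_def)
  note fadd = less.prems(4) and f'add = less.prems(5)
  have fP: "finite P" using fin less.prems(3) finite_subset by blast
  have f0: "f 0 = 0" 
  proof -
    have "f 0 + f 0 = f 0 + 0" using fadd[of 0 0, symmetric] by (simp only: add_0_right)
    then show ?thesis by (simp only: add_left_cancel)
  qed
  have fneg: "f (- x) = - f x" for x using fadd[of "- x" x] f0 by (simp add: eq_neg_iff_add_eq_0)
  have f'0: "f' 0 = 0"
    
  proof -
    have "f' 0 + f' 0 = f' 0 + 0" using f'add[of 0 0, symmetric] by (simp only: add_0_right)
    then show ?thesis by (simp only: add_left_cancel)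
  qed
  have f'neg: "f' (- x) = - f' x" for x using f'add[of "- x" x] f'0 by (simp add: eq_neg_iff_add_eq_0)
  have fscale: "f (c *s x) = c *s f x" for c x
  proof (induction c rule: int_induct[where k = 0])
    case base
    have z: "0 *s v = 0" for v :: "int ^ 'n" by (simp add: vec_eq_iff vector_smult_component)
    show ?case by (simp add: z f0)
  next
    case (step1 c)
    have z: "(c + 1) *s v = c *s v + v" for v :: "int ^ 'n"
      by (simp add: vec_eq_iff vector_smult_component distrib_right)
    show ?case by (simp add: z fadd step1)
  next
    case (step2 c)
    have z: "(c - 1) *s v = c *s v + - v" for v :: "int ^ 'n"
      by (simp add: vec_eq_iff vector_smult_component left_diff_distrib)
    show ?case by (simp only: z fadd fneg step2)
  qed
  \<comment> \<open>Otherwise all simple roots of \<open>g\<close> come from outside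
    \<open>P\<close>, so \<open>f'\<close> sends them to nonpositive vectors, and likewise their
    nonnegative combination \<open>g s\<close>; but \<open>f' (g s) = g0 s\<close> is nonnegative
    and nonzero.\<close>
  have "\<exists>i s0. s0 \<in> P \<and> g s0 = axis i 1"
  proof (rule ccontr)
    assume no: "\<nexists>i s0. s0 \<in> P \<and> g s0 = axis i 1"
    have neg: "f' (axis i 1) $ k \<le> 0" for i k
    proof -
      obtain u where u: "u \<in> S" "g u = axis i 1" using simple_root_exists by blast
      then have "u \<in> S - P" using no by blast
      then have "axis i 1 = - f (g0 u)" using less.prems(8) u by metis
      then have "f' (axis i 1) = - g0 u" by (simp add: f'neg less.prems(6))
      then show ?thesis using assms(4) u by simp
    qed
    have neg_axis: "f' (axis i (int n)) $ k \<le> 0" for i n k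
    proof (induction n)
      case (Suc n)
      have "axis i (int (Suc n)) = axis i 1 + (axis i (int n) :: int ^ 'n)"
        using axis_add[of i 1 "int n"] by simp
      then show ?case using Suc neg[of i k] by (simp add: f'add)
    qed (simp add: f'0)
    have f'sum: "f' (\<Sum>i\<in>A. h i) = (\<Sum>i\<in>A. f' (h i))" for A and h :: "'n \<Rightarrow> int ^ 'n"
      by (induction A rule: infinite_finite_induct) (simp_all add: f'add f'0)
    have s: "s \<in> S" using less.prems(3,9) by blast
    have "g s = (\<Sum>i\<in>UNIV. axis i (int (nat (g s $ i))))"
      using pos s by (simp add: vec_eq_iff axis_component)
    then have "f' (g s) = (\<Sum>i\<in>UNIV. f' (axis i (int (nat (g s $ i)))))"
      using f'sum by metis
    moreover have "f' (g s) = g0 s" using less.prems(6,7,9) by simp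
    ultimately have eq: "g0 s = (\<Sum>i\<in>UNIV. f' (axis i (int (nat (g s $ i)))))" by (simp only:)
    have "g0 s $ k \<le> 0" for k
      unfolding eq sum_component by (rule sum_nonpos) (rule neg_axis)
    then show False
      using assms(4) s nonzero_component[of "g0 s"] by (metis order_antisym)
  qed
  then obtain i s0 where s0: "s0 \<in> P" "g s0 = axis i 1" by blast
  then have s0S: "s0 \<in> S" using less.prems(3) by blast
  show "t = s"
  proof (cases "s = s0")
    case True
    \<comment> \<open>Applying \<open>f\<close> to the relation makes \<open>g t\<close>, up to
      sign, a multiple of a simple root, and only \<open>s0\<close> has such a degree.\<close>
    have "a *s f (g0 t) = b *s axis i 1"
      using fscale[of a "g0 t"] fscale[of b "g0 s"] less.prems(10) less.prems(7)[OF s0(1)]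
      by (simp only: True s0(2))
    then have "a * f (g0 t) $ k = b * axis i 1 $ k" for k by (metis vector_smult_component)
    then have "f (g0 t) $ k = 0" if "k \<noteq> i" for k
      using that assms(12) by (metis axis_component mult_eq_0_iff mult_zero_right)
    then have "f (g0 t) = axis i (f (g0 t) $ i)" by (simp add: vec_eq_iff axis_component)
    moreover have "g t = f (g0 t) \<or> g t = - f (g0 t)"
      using less.prems(7,8) assms(11) by blast
    ultimately have "g t = axis i (f (g0 t) $ i) \<or> g t = axis i (- f (g0 t) $ i)"
      by (metis axis_uminus vector_uminus_component)
    then show ?thesis using simple_root_unique[OF s0S s0(2) assms(11)] True by blast
  next
    case False
    obtain m where m: "cartan q i m" using cartan_exists by blast
    define g1 where "g1 s = (if s = s0 then axis i 1 else reflect i m (g s))" for s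
    have r: "rootsys (reflect_q q i m) S H g1"
      using rootsys_reflect[OF s0S s0(2) m] by (simp add: g1_def[abs_def])
    have c: "card (P - {s0}) < card P" using fP s0(1) by (intro psubset_card_mono) auto
    show ?thesis
    proof (rule less.hyps[OF c braiding_reflect_q r, of "\<lambda>x. reflect i m (f x)" "\<lambda>x. f' (reflect i m x)"])
      show "P - {s0} \<subseteq> S" using less.prems(3) by blast
      show "reflect i m (f (x + y)) = reflect i m (f x) + reflect i m (f y)" for x y
        by (simp add: fadd reflect_add)
      show "f' (reflect i m (x + y)) = f' (reflect i m x) + f' (reflect i m y)" for x y
        by (simp add: f'add reflect_add)
      show "f' (reflect i m (reflect i m (f x))) = x" for x by (simp add: less.prems(6))
      show "g1 u = reflect i m (f (g0 u))" if "u \<in> P - {s0}" for u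
        using that less.prems(7) by (simp add: g1_def)
      show "g1 u = - reflect i m (f (g0 u))" if u: "u \<in> S - (P - {s0})" for u
      proof (cases "u = s0")
        case True
        have "f (g0 s0) = axis i 1" using less.prems(7)[OF s0(1)] s0(2) by (simp only:)
        then have "reflect i m (f (g0 s0)) = - axis i 1" by (simp only: reflect_axis_same axis_uminus)
        then show ?thesis using True by (simp add: g1_def)
      next
        case False
        then have "g u = - f (g0 u)" using u less.prems(8) by blast
        then show ?thesis using False by (simp add: g1_def reflect_uminus)
      qed
      show "s \<in> P - {s0}" using False less.prems(9) by blast
      show "a *s g0 t = b *s g0 s" by (rule less.prems(10))
    qed
  qed
qed

lemma roots_not_proportional:
  fixes q :: "'n::finite \<Rightarrow> 'n \<Rightarrow> 'k::field_char_0"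
  assumes "braiding q" "rootsys q S H g" "s \<in> S" "t \<in> S" "a \<noteq> 0" "a *s g t = b *s g s"
  shows "t = s"
  by (rule roots_not_proportional_aux[OF assms(1,2) order_refl, of g "\<lambda>x. x" "\<lambda>x. x"])
    (use assms in \<open>auto simp: rootsys_def\<close>)

section \<open>Braided symmetrizers and shuffles\<close>

definition bword :: "('n \<Rightarrow> 'n \<Rightarrow> 'k::field) \<Rightarrow> 'n list \<Rightarrow> 'n list \<Rightarrow> 'k" where
  "bword q w = foldr (lmul q) w vac"

lemma bword_simps [simp]: "bword q [] = vac" "bword q (j # w) = lmul q j (bword q w)"
  by (simp_all add: bword_def)

section \<open>Inversions and reduced expressions\<close>

definition swapl :: "nat \<Rightarrow> 'a list \<Rightarrow> 'a list" where
  "swapl i xs = xs[i := xs ! (i + 1), i + 1 := xs ! i]"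

lemma swapl_0 [simp]: "swapl 0 (a # b # xs) = b # a # xs"
  by (simp add: swapl_def)

lemma swapl_Suc [simp]: "swapl (Suc i) (a # xs) = a # swapl i xs"
  by (simp add: swapl_def)

lemma length_swapl [simp]: "length (swapl i xs) = length xs"
  by (simp add: swapl_def)

lemma swapl_nth:
  "i + 1 < length xs \<Longrightarrow> k < length xs \<Longrightarrow> swapl i xs ! k = xs ! transpose i (i + 1) k"
  by (auto simp: swapl_def nth_list_update transpose_def)

lemma swapl_swapl: "i + 1 < length xs \<Longrightarrow> swapl i (swapl i xs) = xs"
  by (rule nth_equalityI) (auto simp: swapl_def nth_list_update)

lemma mset_swapl: "i + 1 < length xs \<Longrightarrow> mset (swapl i xs) = mset xs"
  unfolding swapl_def using mset_swap[of "i + 1" xs i] by (simp add: list_update_swap)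

lemma set_swapl: "i + 1 < length xs \<Longrightarrow> set (swapl i xs) = set xs"
  by (metis mset_swapl set_mset_mset)

lemma distinct_swapl: "i + 1 < length xs \<Longrightarrow> distinct (swapl i xs) = distinct xs"
  by (metis mset_swapl distinct_count_atmost_1 set_mset_mset)

lemma map_swapl: "i + 1 < length xs \<Longrightarrow> map f (swapl i xs) = swapl i (map f xs)"
  by (rule nth_equalityI) (auto simp: swapl_def nth_list_update)

fun ninv :: "nat list \<Rightarrow> nat" where
  "ninv [] = 0"
| "ninv (x # xs) = card {y \<in> set xs. y < x} + ninv xs"

text \<open>For \<open>c y x = q (v ! y) (v ! x)\<close> this is the coefficient with which the
  braiding of a permutation acts on the word \<open>v\<close>.\<close>

fun invw :: "(nat \<Rightarrow> nat \<Rightarrow> 'k::field) \<Rightarrow> nat list \<Rightarrow> 'k" where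
  "invw c [] = 1"
| "invw c (x # xs) = (\<Prod>y | y \<in> set xs \<and> y < x. c y x) * invw c xs"

lemma inv_swapl:
  assumes "i + 1 < length xs" "distinct xs" "xs ! i < xs ! (i + 1)"
  shows "invw c (swapl i xs) = c (xs ! i) (xs ! (i + 1)) * invw c xs"
    and "ninv (swapl i xs) = Suc (ninv xs)"
proof -
  have "invw c (swapl i xs) = c (xs ! i) (xs ! (i + 1)) * invw c xs \<and>
      ninv (swapl i xs) = Suc (ninv xs)"
    using assms
  proof (induction i arbitrary: xs)
    case 0
    then obtain a b r where xs: "xs = a # b # r"
      by (cases xs; cases "tl xs") auto
    have ab: "a < b" using 0 xs by simp
    have 1: "{y. (y = a \<or> y \<in> set r) \<and> y < b} = insert a {y. y \<in> set r \<and> y < b}"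
      using ab by auto
    have 2: "{y. (y = b \<or> y \<in> set r) \<and> y < a} = {y. y \<in> set r \<and> y < a}"
      using ab by auto
    show ?case using 0 xs by (simp add: 1 2 mult_ac)
  next
    case (Suc i)
    then obtain a r where xs: "xs = a # r" by (cases xs) auto
    show ?case using Suc xs by (simp add: set_swapl mult_ac)
  qed
  then show "invw c (swapl i xs) = c (xs ! i) (xs ! (i + 1)) * invw c xs"
    and "ninv (swapl i xs) = Suc (ninv xs)" by blast+
qed

lemma ninv_swapl_descent:
  assumes "i + 1 < length xs" "distinct xs" "xs ! (i + 1) < xs ! i"
  shows "ninv xs = Suc (ninv (swapl i xs))"
proof -
  have "swapl i xs ! i = xs ! (i + 1)" "swapl i xs ! (i + 1) = xs ! i"
    using assms by (simp_all add: swapl_nth)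
  then show ?thesis
    using inv_swapl(2)[of i "swapl i xs"] assms by (simp add: distinct_swapl swapl_swapl)
qed

lemma ninv_swapl_le:
  assumes "i + 1 < length xs" "distinct xs"
  shows "ninv (swapl i xs) \<le> Suc (ninv xs)"
proof -
  have "xs ! i \<noteq> xs ! (i + 1)" using assms by (simp add: nth_eq_iff_index_eq)
  then show ?thesis
    using inv_swapl(2)[OF assms] ninv_swapl_descent[OF assms] by (cases "xs ! i < xs ! (i + 1)") auto
qed

definition elist :: "nat \<Rightarrow> nat list \<Rightarrow> nat list" where
  "elist m es = foldr swapl es [0..<m]"

lemma elist_simps [simp]: "elist m [] = [0..<m]" "elist m (i # es) = swapl i (elist m es)"
  by (simp_all add: elist_def)

lemma length_elist [simp]: "length (elist m es) = m"
  by (induction es) simp_all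

lemma distinct_elist: "\<forall>i\<in>set es. i + 1 < m \<Longrightarrow> distinct (elist m es)"
  by (induction es) (auto simp: distinct_swapl)

lemma ninv_upt [simp]: "ninv [j..<m] = 0"
proof (induction "m - j" arbitrary: j)
  case (Suc n)
  then have "[j..<m] = j # [Suc j..<m]" by (simp add: upt_rec)
  moreover have "ninv [Suc j..<m] = 0" using Suc by simp
  moreover have "{y. Suc j \<le> y \<and> y < m \<and> y < j} = {}" by auto
  ultimately show ?case by simp
qed simp

lemma ninv_elist_le: "\<forall>i\<in>set es. i + 1 < m \<Longrightarrow> ninv (elist m es) \<le> length es"
proof (induction es)
  case (Cons i es)
  then show ?case using ninv_swapl_le[of i "elist m es"] distinct_elist[of es m] by auto
qed simp

text \<open>Bubble sort: a list that is not sorted has an adjacent descent, and swapping it removes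
  exactly one inversion.\<close>

lemma elist_exists:
  assumes "distinct xs" "set xs = {..<m}"
  shows "\<exists>es. (\<forall>i\<in>set es. i + 1 < m) \<and> elist m es = xs \<and> length es = ninv xs"
  using assms
proof (induction "ninv xs" arbitrary: xs rule: less_induct)
  case less
  have len: "length xs = m" using distinct_card[OF less.prems(1)] less.prems(2) by simp
  show ?case
  proof (cases "sorted xs")
    case True
    have xs: "xs = [0..<m]"
      by (rule sorted_distinct_set_unique[OF True less.prems(1)])
        (simp_all add: less.prems(2) atLeast0LessThan)
    show ?thesis unfolding xs by (intro exI[of _ "[]"]) simp
  next
    case False
    then obtain i where i: "i + 1 < length xs" "xs ! (i + 1) < xs ! i"
      by (auto simp: sorted_iff_nth_Suc not_le)
    have n: "ninv xs = Suc (ninv (swapl i xs))" by (rule ninv_swapl_descent[OF i(1) less.prems(1) i(2)])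
    have "distinct (swapl i xs)" "set (swapl i xs) = {..<m}"
      using i(1) less.prems by (simp_all only: distinct_swapl set_swapl)
    then obtain es where es: "\<forall>i\<in>set es. i + 1 < m" "elist m es = swapl i xs"
      "length es = ninv (swapl i xs)"
      using less.hyps[of "swapl i xs"] n by auto
    show ?thesis
      by (rule exI[of _ "i # es"]) (use es i n len in \<open>simp add: swapl_swapl\<close>)
  qed
qed

lemma perm_of_expr_simps [simp]:
  "perm_of_expr [] = id" "perm_of_expr (i # es) = transpose i (i + 1) \<circ> perm_of_expr es"
  by (simp_all add: perm_of_expr_def)

text \<open>Prepending a transposition composes the inverse permutation with it from the right,
  which swaps two positions of its one-line notation. Hence the list belongs to the inverse
  permutation.\<close>

lemma perm_of_expr_elist:
  assumes "\<forall>i\<in>set es. i + 1 < m"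
  shows "perm_of_expr es permutes {..<m} \<and> map (inv_into UNIV (perm_of_expr es)) [0..<m] = elist m es"
  using assms
proof (induction es)
  case Nil
  then show ?case using permutes_id[unfolded id_def] by (simp add: id_def)
next
  case (Cons i es)
  then have i: "i + 1 < m" and p: "perm_of_expr es permutes {..<m}"
    and e: "map (inv_into UNIV (perm_of_expr es)) [0..<m] = elist m es" by auto
  have t: "transpose i (i + 1) permutes {..<m}" using i by (intro permutes_swap_id) auto
  have "inv_into UNIV (transpose i (i + 1) \<circ> perm_of_expr es) = inv_into UNIV (perm_of_expr es) \<circ> transpose i (i + 1)"
    using o_inv_distrib[OF permutes_bij[OF t] permutes_bij[OF p]] by simp
  moreover have "map (inv_into UNIV (perm_of_expr es) \<circ> transpose i (i + 1)) [0..<m] = swapl i (elist m es)"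
  proof (rule nth_equalityI)
    fix k assume k: "k < length (map (inv_into UNIV (perm_of_expr es) \<circ> transpose i (i + 1)) [0..<m])"
    then have "transpose i (i + 1) k < m"
      using permutes_in_image[OF t, of k] by simp
    then show "map (inv_into UNIV (perm_of_expr es) \<circ> transpose i (i + 1)) [0..<m] ! k = swapl i (elist m es) ! k"
      using k i by (simp add: swapl_nth del: Suc_eq_plus1 flip: e)
  qed simp
  ultimately show ?case using permutes_compose[OF p t]
    by (simp only: perm_of_expr_simps elist_simps simp_thms)
qed

definition plist :: "nat \<Rightarrow> (nat \<Rightarrow> nat) \<Rightarrow> nat list" where
  "plist m p = map (inv_into UNIV p) [0..<m]"

lemma plist_inj:
  assumes "p permutes {..<m}" "p' permutes {..<m}" "plist m p = plist m p'"
  shows "p = p'"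
proof -
  have "inv_into UNIV p x = inv_into UNIV p' x" for x
  proof (cases "x < m")
    case True
    then show ?thesis using assms(3) by (auto simp: plist_def)
  next
    case False
    then show ?thesis
      using permutes_not_in[OF permutes_inv[OF assms(1)]] permutes_not_in[OF permutes_inv[OF assms(2)]]
      by simp
  qed
  then have "inv_into UNIV p = inv_into UNIV p'" by blast
  then show ?thesis by (metis assms(1,2) permutes_inv_inv)
qed

lemma plist_permutation:
  assumes "p permutes {..<m}"
  shows "distinct (plist m p)" "set (plist m p) = {..<m}"
proof -
  have "inj (inv_into UNIV p)" using permutes_inj[OF permutes_inv[OF assms]] .
  then show "distinct (plist m p)" unfolding plist_def
    by (simp add: distinct_map inj_on_subset[OF _ subset_UNIV])
  show "set (plist m p) = {..<m}" unfolding plist_def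
    using permutes_image[OF permutes_inv[OF assms]] by (simp add: atLeast0LessThan)
qed

lemma bij_betw_plist: "bij_betw (plist m) {p. p permutes {..<m}} (permutations_of_set {..<m})"
  unfolding bij_betw_def
proof
  show inj: "inj_on (plist m) {p. p permutes {..<m}}"
    using plist_inj by (auto simp: inj_on_def)
  have "card (plist m ` {p. p permutes {..<m}}) = card (permutations_of_set {..<m})"
    using card_image[OF inj] card_permutations[of "{..<m}" m] by simp
  moreover have "plist m ` {p. p permutes {..<m}} \<subseteq> permutations_of_set {..<m}"
    using plist_permutation by (auto simp: permutations_of_set_def)
  ultimately show "plist m ` {p. p permutes {..<m}} = permutations_of_set {..<m}"
    by (intro card_subset_eq) auto
qed

text \<open>A transposition adds at most one inversion, and bubble sort attains this bound. With
  \<open>braid_expr_single\<close> this makes the choice in \<open>braid_perm\<close>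
  harmless.\<close>

lemma reduced_expr_length:
  assumes "p permutes {..<m}"
  shows "\<exists>es. reduced_expr m p es"
    and "reduced_expr m p es \<Longrightarrow> (\<forall>i\<in>set es. i + 1 < m) \<and> elist m es = plist m p \<and>
      length es = ninv (plist m p)"
proof -
  obtain js where js: "\<forall>i\<in>set js. i + 1 < m" "elist m js = plist m p" "length js = ninv (plist m p)"
    using elist_exists[OF plist_permutation[OF assms]] by blast
  have "perm_of_expr js = p"
    using perm_of_expr_elist[OF js(1)] js(2) assms by (intro plist_inj) (auto simp: plist_def)
  then have e: "expr_of m p js" using js by (simp add: expr_of_def)
  have le: "ninv (plist m p) \<le> length ks \<and> elist m ks = plist m p" if "expr_of m p ks" for ks
    using that perm_of_expr_elist[of ks m] ninv_elist_le[of ks m]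
    by (auto simp: expr_of_def plist_def)
  have "reduced_expr m p js" using e le js(3) by (auto simp: reduced_expr_def)
  then show "\<exists>es. reduced_expr m p es" by blast
  assume r: "reduced_expr m p es"
  then show "(\<forall>i\<in>set es. i + 1 < m) \<and> elist m es = plist m p \<and> length es = ninv (plist m p)"
    using le[of es] e js(3) by (auto simp: reduced_expr_def expr_of_def intro!: antisym)
qed

section \<open>The action of permutations on words\<close>

lemma braid_superset:
  assumes "finite A" "Poly_Mapping.keys f \<subseteq> A"
  shows "braid q i f = (\<Sum>w\<in>A. Poly_Mapping.single (swap_letters i w)
      (Poly_Mapping.lookup f w * q (letters w ! i) (letters w ! (i + 1))))"
  unfolding braid_def
  by (rule sum.mono_neutral_left[OF assms]) (auto simp: in_keys_iff)

lemma braid_add: "braid q i (f + g) = braid q i f + braid q i g"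
proof -
  let ?A = "Poly_Mapping.keys f \<union> Poly_Mapping.keys g"
  have "Poly_Mapping.keys (f + g) \<subseteq> ?A" by (rule Poly_Mapping.keys_add)
  then show ?thesis
    by (simp add: braid_superset[of ?A] lookup_add distrib_right single_add sum.distrib)
qed

lemma braid_zero [simp]: "braid q i 0 = 0"
  by (simp add: braid_def)

lemma braid_single:
  "braid q i (Poly_Mapping.single (Word v) c) =
    Poly_Mapping.single (Word (swapl i v)) (c * q (v ! i) (v ! (i + 1)))"
  by (simp add: braid_def swap_letters_def swapl_def)

lemma sum_monomials:
  "(\<Sum>w\<in>Poly_Mapping.keys f. Poly_Mapping.single w (Poly_Mapping.lookup f w)) = f"
  by (rule poly_mapping_eqI) (auto simp: lookup_sum lookup_single when_def in_keys_iff)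

lemma additive_sum_monomials:
  fixes T :: "('a \<Rightarrow>\<^sub>0 'b::comm_monoid_add) \<Rightarrow> 'c::comm_monoid_add"
  assumes "\<And>f g. T (f + g) = T f + T g" "T 0 = 0"
  shows "T f = (\<Sum>w\<in>Poly_Mapping.keys f. T (Poly_Mapping.single w (Poly_Mapping.lookup f w)))"
proof -
  have sum: "T (\<Sum>x\<in>A. h x) = (\<Sum>x\<in>A. T (h x))" for A and h :: "'a \<Rightarrow> 'a \<Rightarrow>\<^sub>0 'b"
    by (induction A rule: infinite_finite_induct) (simp_all add: assms)
  show ?thesis
    by (subst sum_monomials[symmetric]) (simp only: sum)
qed

lemma braid_expr_additive:
  "foldr (\<lambda>i g. braid q i \<circ> g) es id (f + g) =
    foldr (\<lambda>i g. braid q i \<circ> g) es id f + foldr (\<lambda>i g. braid q i \<circ> g) es id g"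
  "foldr (\<lambda>i g. braid q i \<circ> g) es id 0 = 0"
  by (induction es) (simp_all add: braid_add)

text \<open>In a reduced expression every adjacent transposition creates a new inversion, so each
  braiding contributes the factor of exactly one inverted pair.\<close>

lemma braid_expr_single:
  assumes "\<forall>i\<in>set es. i + 1 < m" "length v = m" "ninv (elist m es) = length es"
  shows "foldr (\<lambda>i g. braid q i \<circ> g) es id (Poly_Mapping.single (Word v) c) =
    Poly_Mapping.single (Word (map ((!) v) (elist m es)))
      (c * invw (\<lambda>x y. q (v ! x) (v ! y)) (elist m es))"
  using assms
proof (induction es)
  case Nil
  have "map ((!) v) [0..<m] = v" using Nil map_nth[of v] by simp
  moreover have "invw c [j..<m] = 1" for c :: "nat \<Rightarrow> nat \<Rightarrow> 'b" and j
  proof (induction "m - j" arbitrary: j)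
    case (Suc n)
    then have "[j..<m] = j # [Suc j..<m]" by (simp add: upt_rec)
    moreover have "invw c [Suc j..<m] = 1" using Suc by simp
    moreover have e: "{y. Suc j \<le> y \<and> y < m \<and> y < j} = {}" by auto
    ultimately show ?case by (simp add: e)
  qed simp
  ultimately show ?case by simp
next
  case (Cons i es)
  let ?x = "elist m es"
  have i: "i + 1 < length ?x" and d: "distinct ?x"
    using Cons.prems distinct_elist[of es m] by auto
  have le: "ninv ?x \<le> length es" using ninv_elist_le[of es m] Cons.prems by simp
  have es: "\<forall>i\<in>set es. i + 1 < m" using Cons.prems(1) by simp
  have n: "ninv (swapl i ?x) = Suc (length es)" using Cons.prems by simp
  have asc: "?x ! i < ?x ! (i + 1)"
  proof -
    have "\<not> ?x ! (i + 1) < ?x ! i" using ninv_swapl_descent[OF i d] le n by auto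
    moreover have "?x ! i \<noteq> ?x ! (i + 1)" using i d by (simp add: nth_eq_iff_index_eq)
    ultimately show ?thesis by simp
  qed
  then have nx: "ninv ?x = length es" using inv_swapl(2)[OF i d] n by simp
  have "foldr (\<lambda>i g. braid q i \<circ> g) (i # es) id (Poly_Mapping.single (Word v) c) =
     braid q i (Poly_Mapping.single (Word (map ((!) v) ?x)) (c * invw (\<lambda>x y. q (v ! x) (v ! y)) ?x))"
    by (simp only: foldr.simps comp_apply Cons.IH[OF es Cons.prems(2) nx])
  also have "\<dots> = Poly_Mapping.single (Word (map ((!) v) (swapl i ?x)))
     (c * invw (\<lambda>x y. q (v ! x) (v ! y)) (swapl i ?x))"
    using i by (simp add: braid_single map_swapl inv_swapl(1)[OF i d asc] mult_ac)
  finally show ?case by (simp only: elist_simps)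
qed

lemma braid_perm_single:
  assumes "p permutes {..<m}" "length v = m"
  shows "braid_perm q m p (Poly_Mapping.single (Word v) c) =
    Poly_Mapping.single (Word (map ((!) v) (plist m p)))
      (c * invw (\<lambda>x y. q (v ! x) (v ! y)) (plist m p))"
proof -
  have "reduced_expr m p (SOME es. reduced_expr m p es)"
    using reduced_expr_length(1)[OF assms(1)] by (rule someI_ex)
  from reduced_expr_length(2)[OF assms(1) this] show ?thesis
    unfolding braid_perm_def using braid_expr_single[OF _ assms(2)] by metis
qed

lemma sum_apply: "(\<Sum>x\<in>A. F x) v = (\<Sum>x\<in>A. F x v :: 'k::field)"
  by (induction A rule: infinite_finite_induct) (simp_all add: pointwise)

text \<open>Here \<open>xs\<close> lists positions and \<open>f\<close> their letters, so equal
  letters stay distinguishable. The letter that comes first has passed everything to its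
  left.\<close>

lemma dl_bword:
  assumes "sorted_wrt (<) (xs :: nat list)"
  shows "dl k (bword q (map f xs)) = (\<Sum>x\<in>set xs. if f x = k
    then (\<Prod>y | y \<in> set xs \<and> y < x. q (f y) k) *f bword q (map f (remove1 x xs)) else 0)"
  using assms
proof (induction xs)
  case (Cons a xs)
  have a: "a < x" if "x \<in> set xs" for x using Cons.prems that by simp
  then have an: "a \<notin> set xs" by blast
  have "dl k (bword q (map f (a # xs))) = (if f a = k then bword q (map f xs) else 0) +
     q (f a) k *f lmul q (f a) (dl k (bword q (map f xs)))"
    by (simp add: dl_lmul)
  also have "q (f a) k *f lmul q (f a) (dl k (bword q (map f xs))) =
     (\<Sum>x\<in>set xs. if f x = k then (\<Prod>y | y \<in> set (a # xs) \<and> y < x. q (f y) k) *f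
        bword q (map f (remove1 x (a # xs))) else 0)"
    unfolding Cons.IH[OF Cons.prems[simplified, THEN conjunct2]] lin_sum[OF lin_lmul] fs.scale_sum_right
  proof (rule sum.cong)
    fix x assume x: "x \<in> set xs"
    have "{y. y \<in> set (a # xs) \<and> y < x} = insert a {y. y \<in> set xs \<and> y < x}"
      using a[OF x] by auto
    then have "(\<Prod>y | y \<in> set (a # xs) \<and> y < x. q (f y) k) =
        q (f a) k * (\<Prod>y | y \<in> set xs \<and> y < x. q (f y) k)" using an by simp
    then show "q (f a) k *f lmul q (f a) (if f x = k then
        (\<Prod>y | y \<in> set xs \<and> y < x. q (f y) k) *f bword q (map f (remove1 x xs)) else 0) =
      (if f x = k then (\<Prod>y | y \<in> set (a # xs) \<and> y < x. q (f y) k) *f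
        bword q (map f (remove1 x (a # xs))) else 0)"
      using a[OF x] by simp
  qed simp
  moreover have "{y. y \<in> set (a # xs) \<and> y < a} = {}" using a by force
  then have "(\<Prod>y | y \<in> set (a # xs) \<and> y < a. q (f y) k) = 1" by (simp only: prod.empty)
  ultimately show ?case using an by simp
qed simp

text \<open>By \<open>dl_bword\<close> the induction picks the position that comes first; the price
  of moving it there is the head factor of \<open>invw\<close>.\<close>

lemma bword_permutations:
  assumes "sorted_wrt (<) (xs :: nat list)"
  shows "bword q (map f xs) v = (\<Sum>ys\<in>permutations_of_set (set xs).
    if map f ys = v then invw (\<lambda>x y. q (f x) (f y)) ys else 0)"
  using assms
proof (induction v arbitrary: xs)
  case Nil
  show ?case
  proof (cases xs)
    case (Cons a r)
    have "ys \<noteq> []" if "ys \<in> permutations_of_set (set xs)" for ys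
      using that Cons by (auto simp: permutations_of_set_def)
    then show ?thesis using Cons by (auto intro!: sum.neutral[symmetric])
  qed (simp add: vac_def)
next
  case (Cons k v)
  let ?c = "\<lambda>x y. q (f x) (f y)"
  let ?P = "permutations_of_set (set xs)"
  have dist: "distinct xs" using Cons.prems by (simp add: strict_sorted_iff)
  have "bword q (map f xs) (k # v) = (\<Sum>x\<in>set xs. if f x = k
    then (\<Prod>y | y \<in> set xs \<and> y < x. q (f y) k) *f bword q (map f (remove1 x xs)) else 0) v"
    by (simp only: Cons_dl dl_bword[OF Cons.prems])
  also have "\<dots> = (\<Sum>x\<in>set xs. (if f x = k
    then (\<Prod>y | y \<in> set xs \<and> y < x. q (f y) k) *f bword q (map f (remove1 x xs)) else 0) v)"
    by (rule sum_apply)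
  also have "\<dots> = (\<Sum>x\<in>set xs. \<Sum>ys\<in>permutations_of_set (set xs - {x}).
     if map f (x # ys) = k # v then invw ?c (x # ys) else 0)"
  proof (rule sum.cong)
    fix x assume x: "x \<in> set xs"
    have so: "sorted_wrt (<) (remove1 x xs)"
      using Cons.prems by (simp add: strict_sorted_iff sorted_remove1)
    have "bword q (map f (remove1 x xs)) v = (\<Sum>ys\<in>permutations_of_set (set xs - {x}).
        if map f ys = v then invw ?c ys else 0)"
      using Cons.IH[OF so] dist by simp
    moreover have "{y. y \<in> set ys \<and> y < x} = {y. y \<in> set xs \<and> y < x}"
      if "ys \<in> permutations_of_set (set xs - {x})" for ys
      using that by (auto simp: permutations_of_set_def)
    ultimately show "(if f x = k then (\<Prod>y | y \<in> set xs \<and> y < x. q (f y) k) *f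
        bword q (map f (remove1 x xs)) else 0) v =
      (\<Sum>ys\<in>permutations_of_set (set xs - {x}). if map f (x # ys) = k # v then invw ?c (x # ys) else 0)"
      by (auto simp: pointwise sum_distrib_left intro!: sum.cong)
  qed simp
  also have "\<dots> = (\<Sum>ys\<in>?P. if map f ys = k # v then invw ?c ys else 0)"
  proof (cases "xs = []")
    case False
    then have P: "?P = (\<Union>x\<in>set xs. (#) x ` permutations_of_set (set xs - {x}))"
      by (intro permutations_of_set_nonempty) simp
    show ?thesis unfolding P
      by (subst sum.UNION_disjoint) (auto simp: sum.reindex)
  qed simp
  finally show ?case .
qed

text \<open>The algebra map from T(V) to the quantum shuffle algebra that is the identity on
  letters.\<close>

definition shuffle_map :: "('n \<Rightarrow> 'n \<Rightarrow> 'k::field) \<Rightarrow> ('n, 'k) tensor \<Rightarrow> 'n list \<Rightarrow> 'k" where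
  "shuffle_map q f = (\<Sum>w\<in>Poly_Mapping.keys f. Poly_Mapping.lookup f w *f bword q (letters w))"

text \<open>On either side a word contributes one term per permutation, with the same weight
  \<open>invw\<close>; \<open>plist\<close> matches the two index sets. So the braided symmetrizers
  have the kernel of one algebra map.\<close>

lemma lookup_symmetrizer:
  assumes "f \<in> tensor_power m"
  shows "Poly_Mapping.lookup (braided_symmetrizer q m f) (Word v) = shuffle_map q f v"
proof -
  let ?K = "Poly_Mapping.keys f"
  let ?P = "{p. p permutes {..<m}}"
  let ?c = "\<lambda>w x y. q (letters w ! x) (letters w ! y)"
  have "braid_perm q m p f = (\<Sum>w\<in>?K. Poly_Mapping.single (Word (map ((!) (letters w)) (plist m p)))
      (Poly_Mapping.lookup f w * invw (?c w) (plist m p)))" if p: "p permutes {..<m}" for p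
  proof -
    have "braid_perm q m p f =
        (\<Sum>w\<in>?K. braid_perm q m p (Poly_Mapping.single w (Poly_Mapping.lookup f w)))"
      by (rule additive_sum_monomials) (simp_all add: braid_perm_def braid_expr_additive)
    also have "\<dots> = (\<Sum>w\<in>?K. Poly_Mapping.single (Word (map ((!) (letters w)) (plist m p)))
      (Poly_Mapping.lookup f w * invw (?c w) (plist m p)))"
    proof (rule sum.cong)
      fix w assume "w \<in> ?K"
      then have "length (letters w) = m" using assms by (simp add: tensor_power_def)
      from braid_perm_single[OF p this, of q "Poly_Mapping.lookup f w"]
      show "braid_perm q m p (Poly_Mapping.single w (Poly_Mapping.lookup f w)) =
        Poly_Mapping.single (Word (map ((!) (letters w)) (plist m p)))
          (Poly_Mapping.lookup f w * invw (?c w) (plist m p))" by simp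
    qed simp
    finally show ?thesis .
  qed
  then have "Poly_Mapping.lookup (braided_symmetrizer q m f) (Word v) =
      (\<Sum>p\<in>?P. \<Sum>w\<in>?K. Poly_Mapping.lookup f w *
        (if map ((!) (letters w)) (plist m p) = v then invw (?c w) (plist m p) else 0))"
    by (auto simp: braided_symmetrizer_def lookup_sum lookup_single when_def intro!: sum.cong)
  also have "\<dots> = (\<Sum>w\<in>?K. Poly_Mapping.lookup f w *
      (\<Sum>p\<in>?P. if map ((!) (letters w)) (plist m p) = v then invw (?c w) (plist m p) else 0))"
    unfolding sum_distrib_left by (rule sum.swap)
  also have "\<dots> = (\<Sum>w\<in>?K. Poly_Mapping.lookup f w * bword q (letters w) v)"
  proof (rule sum.cong)
    fix w assume "w \<in> ?K"
    then have len: "length (letters w) = m" using assms by (simp add: tensor_power_def)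
    have "(\<Sum>p\<in>?P. if map ((!) (letters w)) (plist m p) = v then invw (?c w) (plist m p) else 0) =
      (\<Sum>ys\<in>permutations_of_set {..<m}. if map ((!) (letters w)) ys = v then invw (?c w) ys else 0)"
      by (rule sum.reindex_bij_betw[OF bij_betw_plist])
    also have "\<dots> = bword q (map ((!) (letters w)) [0..<m]) v"
      by (subst bword_permutations) (simp_all add: atLeast0LessThan)
    also have "map ((!) (letters w)) [0..<m] = letters w" using len map_nth[of "letters w"] by simp
    finally show "Poly_Mapping.lookup f w *
      (\<Sum>p\<in>?P. if map ((!) (letters w)) (plist m p) = v then invw (?c w) (plist m p) else 0) =
      Poly_Mapping.lookup f w * bword q (letters w) v" by simp
  qed simp
  also have "\<dots> = shuffle_map q f v" by (simp add: shuffle_map_def sum_apply pointwise)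
  finally show ?thesis .
qed

section \<open>The Nichols algebra as a quotient\<close>

lemma shuffle_map_superset:
  assumes "finite A" "Poly_Mapping.keys f \<subseteq> A"
  shows "shuffle_map q f = (\<Sum>w\<in>A. Poly_Mapping.lookup f w *f bword q (letters w))"
  unfolding shuffle_map_def by (rule sum.mono_neutral_left[OF assms]) (auto simp: in_keys_iff)

lemma shuffle_map_add: "shuffle_map q (f + g) = shuffle_map q f + shuffle_map q g"
proof -
  let ?A = "Poly_Mapping.keys f \<union> Poly_Mapping.keys g"
  have "Poly_Mapping.keys (f + g) \<subseteq> ?A" by (rule Poly_Mapping.keys_add)
  then show ?thesis
    by (simp add: shuffle_map_superset[of ?A] lookup_add scale_simps sum.distrib)
qed

lemma shuffle_map_zero [simp]: "shuffle_map q 0 = 0"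
  by (simp add: shuffle_map_def)

lemma shuffle_map_diff: "shuffle_map q (f - g) = shuffle_map q f - shuffle_map q g"
  using shuffle_map_add[of q "f - g" g] by (simp add: algebra_simps)

lemma shuffle_map_sum: "shuffle_map q (\<Sum>x\<in>A. F x) = (\<Sum>x\<in>A. shuffle_map q (F x))"
  by (induction A rule: infinite_finite_induct) (simp_all add: shuffle_map_add)

lemma shuffle_map_single: "shuffle_map q (Poly_Mapping.single w c) = c *f bword q (letters w)"
  by (simp add: shuffle_map_def)

lemma shuffle_map_one: "shuffle_map q 1 = vac"
  by (simp add: shuffle_map_single zero_word_def flip: single_one)

lemma letters_add: "letters (u + v) = letters u @ letters v"
  by (simp add: plus_word_def)

lemma lin_foldr_lmul: "lin (foldr (lmul q) w)"
proof (induction w)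
  case (Cons a w)
  then show ?case using lin_compose[OF lin_lmul Cons] by (simp add: comp_def)
qed (simp add: lin_def)

lemma foldr_lmul_rmul: "foldr (lmul q) w (rmul q j f) = rmul q j (foldr (lmul q) w f)"
  by (induction w) (simp_all add: lmul_rmul)

lemma lin_foldl_rmul: "lin (\<lambda>f. foldl (\<lambda>f j. rmul q j f) f w)"
proof (induction w)
  case (Cons a w)
  then show ?case using lin_compose[OF Cons lin_rmul] by (simp add: comp_def)
qed (simp add: lin_def)

lemma bword_append:
  "bword q (u @ w) = foldr (lmul q) u (bword q w)"
  "bword q (u @ w) = foldl (\<lambda>f j. rmul q j f) (bword q u) w"
proof -
  show 1: "bword q (u @ w) = foldr (lmul q) u (bword q w)" for u w by (simp add: bword_def)
  show "bword q (u @ w) = foldl (\<lambda>f j. rmul q j f) (bword q u) w"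
  proof (induction w rule: rev_induct)
    case (snoc j w)
    have "bword q (u @ w @ [j]) = foldr (lmul q) (u @ w) (rmul q j vac)"
      using 1[of "u @ w" "[j]"] by (simp add: rmul_vac)
    also have "\<dots> = rmul q j (bword q (u @ w))" by (simp only: foldr_lmul_rmul bword_def)
    finally show ?case by (simp add: snoc)
  qed simp
qed

lemma shuffle_map_single_mult:
  "shuffle_map q (Poly_Mapping.single w c * g) = c *f foldr (lmul q) (letters w) (shuffle_map q g)"
proof -
  note ll = lin_foldr_lmul[of q "letters w"]
  have "shuffle_map q (Poly_Mapping.single w c * g) = (\<Sum>u\<in>Poly_Mapping.keys g.
      shuffle_map q (Poly_Mapping.single w c * Poly_Mapping.single u (Poly_Mapping.lookup g u)))"
    by (rule additive_sum_monomials) (simp_all add: distrib_left shuffle_map_add)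
  also have "\<dots> = (\<Sum>u\<in>Poly_Mapping.keys g. c *f foldr (lmul q) (letters w)
      (Poly_Mapping.lookup g u *f bword q (letters u)))"
    by (simp add: mult_single shuffle_map_single letters_add bword_append(1) lin_scale[OF ll])
  also have "\<dots> = c *f foldr (lmul q) (letters w) (shuffle_map q g)"
    by (simp only: shuffle_map_def lin_sum[OF ll] fs.scale_sum_right)
  finally show ?thesis .
qed

lemma shuffle_map_mult_single:
  "shuffle_map q (g * Poly_Mapping.single w c) = c *f foldl (\<lambda>f j. rmul q j f) (shuffle_map q g) (letters w)"
proof -
  note ll = lin_foldl_rmul[of q "letters w"]
  have "shuffle_map q (g * Poly_Mapping.single w c) = (\<Sum>u\<in>Poly_Mapping.keys g.
      shuffle_map q (Poly_Mapping.single u (Poly_Mapping.lookup g u) * Poly_Mapping.single w c))"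
    by (rule additive_sum_monomials) (simp_all add: distrib_right shuffle_map_add)
  also have "\<dots> = (\<Sum>u\<in>Poly_Mapping.keys g. c *f foldl (\<lambda>f j. rmul q j f)
      (Poly_Mapping.lookup g u *f bword q (letters u)) (letters w))"
    by (simp add: mult_single shuffle_map_single letters_add bword_append(2) lin_scale[OF ll] mult.commute)
  also have "\<dots> = c *f foldl (\<lambda>f j. rmul q j f) (shuffle_map q g) (letters w)"
    by (simp only: shuffle_map_def lin_sum[OF ll] fs.scale_sum_right)
  finally show ?thesis .
qed

lemma shuffle_map_mult_zero:
  assumes "shuffle_map q f = 0"
  shows "shuffle_map q (g * f) = 0" "shuffle_map q (f * g) = 0"
proof -
  have "shuffle_map q (g * f) = (\<Sum>u\<in>Poly_Mapping.keys g.
      shuffle_map q (Poly_Mapping.single u (Poly_Mapping.lookup g u) * f))"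
    by (rule additive_sum_monomials) (simp_all add: distrib_right shuffle_map_add)
  then show "shuffle_map q (g * f) = 0"
    by (simp add: shuffle_map_single_mult assms lin_zero[OF lin_foldr_lmul])
  have "shuffle_map q (f * g) = (\<Sum>u\<in>Poly_Mapping.keys g.
      shuffle_map q (f * Poly_Mapping.single u (Poly_Mapping.lookup g u)))"
    by (rule additive_sum_monomials) (simp_all add: distrib_left shuffle_map_add)
  then show "shuffle_map q (f * g) = 0"
    by (simp add: shuffle_map_mult_single assms lin_zero[OF lin_foldl_rmul])
qed

lemma shuffle_map_mult_cong:
  assumes "shuffle_map q f = shuffle_map q f'" "shuffle_map q g = shuffle_map q g'"
  shows "shuffle_map q (f * g) = shuffle_map q (f' * g')"
proof -
  have "shuffle_map q (f - f') = 0" "shuffle_map q (g - g') = 0" using assms by (simp_all add: shuffle_map_diff)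
  then have "shuffle_map q ((f - f') * g) = 0" "shuffle_map q (f' * (g - g')) = 0" by (simp_all only: shuffle_map_mult_zero)
  then show ?thesis by (simp add: shuffle_map_diff algebra_simps)
qed

lemma bword_hcomp: "bword q w \<in> hcomp (wdeg w)"
proof (induction w)
  case Nil
  then show ?case by (simp add: hcomp_iff_proj proj_vac)
next
  case (Cons a w)
  then have "proj (wdeg w) (bword q w) = bword q w" by (simp only: hcomp_iff_proj)
  then show ?case using lmul_proj[of q a "wdeg w" "bword q w"]
    by (simp add: hcomp_iff_proj add.commute)
qed

lemma bword_length:
  fixes q :: "'n::finite \<Rightarrow> 'n \<Rightarrow> 'k::field"
  shows "bword q w v \<noteq> 0 \<Longrightarrow> length v = length w"
proof -
  assume "bword q w v \<noteq> 0"
  then have "wdeg v = wdeg w" using bword_hcomp[of q w] by (auto simp: hcomp_def)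
  then have "int (length v) = int (length w)" by (simp only: length_wdeg)
  then show ?thesis by simp
qed

lemma bword_short:
  "bword q w [] = (if w = [] then 1 else 0)" "bword q w [j] = (if w = [j] then 1 else 0)"
proof -
  show 1: "bword q w [] = (if w = [] then 1 else 0)" for w by (cases w) (simp_all add: vac_def)
  show "bword q w [j] = (if w = [j] then 1 else 0)" by (cases w) (simp_all add: vac_def 1)
qed

lemma shuffle_map_apply:
  "shuffle_map q f v = (\<Sum>w\<in>Poly_Mapping.keys f. Poly_Mapping.lookup f w * bword q (letters w) v)"
  by (simp add: shuffle_map_def sum_apply pointwise)

lemma letters_eq_iff: "letters w = xs \<longleftrightarrow> w = Word xs"
  by (cases w) simp

text \<open>\<open>bword q w\<close> lives on words as long as \<open>w\<close>, so the kernel of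
  \<open>shuffle_map\<close> splits into parts of fixed length, which are the kernels of the
  symmetrizers.\<close>

lemma nichols_ideal_eq:
  fixes q :: "'n::finite \<Rightarrow> 'n \<Rightarrow> 'k::field"
  shows "nichols_ideal q = {f. shuffle_map q f = 0}"
proof (intro equalityI subsetI)
  fix f assume "f \<in> nichols_ideal q"
  then obtain M g where M: "f = (\<Sum>m\<in>M. g m)" "\<forall>m\<in>M. g m \<in> symmetrizer_kernel q m"
    by (auto simp: nichols_ideal_def)
  have "shuffle_map q (g m) = 0" if "m \<in> M" for m
  proof
    fix v
    show "shuffle_map q (g m) v = 0 v"
      using M(2) that lookup_symmetrizer[of "g m" m q v]
      by (auto simp: symmetrizer_kernel_def pointwise)
  qed
  then show "f \<in> {f. shuffle_map q f = 0}" by (simp add: M(1) shuffle_map_sum)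
next
  fix f assume "f \<in> {f. shuffle_map q f = 0}"
  then have f: "shuffle_map q f = 0" by simp
  let ?K = "Poly_Mapping.keys f" and ?l = "\<lambda>w. length (letters w)"
  let ?s = "\<lambda>w. Poly_Mapping.single w (Poly_Mapping.lookup f w)"
  define g where "g m = (\<Sum>w | w \<in> ?K \<and> ?l w = m. ?s w)" for m
  \<comment> \<open>On words of length 0 and 1 \<open>shuffle_map\<close> is the identity, so an
    element of the kernel has no such terms.\<close>
  have short: "2 \<le> ?l w" if w: "w \<in> ?K" for w
  proof (rule ccontr)
    assume "\<not> 2 \<le> ?l w"
    then have "letters w = [] \<or> (\<exists>j. letters w = [j])"
      by (cases "letters w"; cases "tl (letters w)") auto
    then have "bword q u (letters w) = (if u = letters w then 1 else 0)" for u
      by (auto simp: bword_short simp del: bword_simps)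
    then have "shuffle_map q f (letters w) = Poly_Mapping.lookup f w"
      by (auto simp: shuffle_map_apply letters_eq_iff if_distrib[of "\<lambda>x. _ * x"] in_keys_iff word.expand cong: if_cong)
    then show False using f w by (simp add: pointwise in_keys_iff)
  qed
  have "f = (\<Sum>m\<in>?l ` ?K. g m)"
    unfolding g_def by (subst sum.image_gen[symmetric]) (simp_all add: sum_monomials)
  moreover have "g m \<in> symmetrizer_kernel q m" for m
  proof -
    have K: "Poly_Mapping.keys (g m) \<subseteq> {w \<in> ?K. ?l w = m}"
      unfolding g_def by (rule order_trans[OF keys_sum]) (auto split: if_splits)
    then have tp: "g m \<in> tensor_power m" by (auto simp: tensor_power_def)
    have "shuffle_map q (g m) v = 0" for v
    proof (cases "length v = m")
      case True
      have "shuffle_map q (g m) v = (\<Sum>w | w \<in> ?K \<and> ?l w = m. Poly_Mapping.lookup f w * bword q (letters w) v)"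
        by (simp add: g_def shuffle_map_sum shuffle_map_single sum_apply pointwise)
      also have "\<dots> = shuffle_map q f v"
        unfolding shuffle_map_apply using True bword_length[of q _ v]
        by (intro sum.mono_neutral_left) auto
      finally show ?thesis using f by (simp add: pointwise)
    next
      case False
      then show ?thesis using K bword_length[of q _ v] unfolding shuffle_map_apply
        by (intro sum.neutral) fastforce
    qed
    then have "Poly_Mapping.lookup (braided_symmetrizer q m (g m)) w = 0" for w
      using lookup_symmetrizer[OF tp, of q "letters w"] by (cases w) simp
    then have "braided_symmetrizer q m (g m) = 0" by (intro poly_mapping_eqI) simp
    then show ?thesis using tp by (simp add: symmetrizer_kernel_def)
  qed
  ultimately show "f \<in> nichols_ideal q"
    unfolding nichols_ideal_def using short
    by (intro CollectI exI[of _ "?l ` ?K"] exI[of _ g]) auto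
qed

section \<open>The quotient ring and the shuffle algebra\<close>

context
  fixes q :: "'n::finite \<Rightarrow> 'n \<Rightarrow> 'k::field"
begin

abbreviation "NA \<equiv> nichols_algebra q"
abbreviation "cls \<equiv> nichols_class q"

lemma cls_eq: "cls f = {g. shuffle_map q g = shuffle_map q f}"
proof -
  have "cls f = {h + f | h. shuffle_map q h = 0}"
    by (auto simp: nichols_class_def a_r_coset_def' tensor_ring_def nichols_ideal_eq)
  also have "\<dots> = {g. shuffle_map q g = shuffle_map q f}"
  proof (intro equalityI subsetI)
    fix g assume "g \<in> {g. shuffle_map q g = shuffle_map q f}"
    then have "g = (g - f) + f" "shuffle_map q (g - f) = 0" by (simp_all add: shuffle_map_diff)
    then show "g \<in> {h + f | h. shuffle_map q h = 0}" by blast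
  qed (auto simp: shuffle_map_add)
  finally show ?thesis .
qed

lemma cls_eq_iff: "cls f = cls g \<longleftrightarrow> shuffle_map q f = shuffle_map q g"
  by (auto simp: cls_eq)

lemma NA_simps:
  "carrier NA = range cls" "add NA (cls f) (cls g) = cls (f + g)" "zero NA = cls 0"
  "one NA = cls 1" "mult NA (cls f) (cls g) = cls (f * g)"
  "smult NA c (cls f) = cls (Poly_Mapping.single 0 c * f)"
proof -
  note defs = nichols_algebra_def ring.defs module.defs FactRing_def
  show "carrier NA = range cls"
    by (auto simp: defs A_RCOSETS_def' tensor_ring_def nichols_class_def)
  show "zero NA = cls 0" by (simp add: defs cls_eq nichols_ideal_eq)
  show "one NA = cls 1" by (simp add: defs nichols_class_def tensor_ring_def)
  have "{a + b | a b. a \<in> cls f \<and> b \<in> cls g} = cls (f + g)"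
  proof (intro equalityI subsetI)
    fix h assume "h \<in> cls (f + g)"
    then have "h = f + (h - f)" "f \<in> cls f" "h - f \<in> cls g"
      by (simp_all add: cls_eq shuffle_map_diff shuffle_map_add)
    then show "h \<in> {a + b | a b. a \<in> cls f \<and> b \<in> cls g}" by blast
  qed (auto simp: cls_eq shuffle_map_add)
  moreover have "add NA (cls f) (cls g) = {a + b | a b. a \<in> cls f \<and> b \<in> cls g}"
    by (auto simp: defs set_add_def' tensor_ring_def)
  ultimately show "add NA (cls f) (cls g) = cls (f + g)" by simp
  have "mult NA (cls f) (cls g) = (\<Union>a\<in>cls f. \<Union>b\<in>cls g. cls (a * b))"
    by (simp add: defs rcoset_mult_def nichols_class_def tensor_ring_def)
  also have "\<dots> = (\<Union>a\<in>cls f. \<Union>b\<in>cls g. cls (f * g))"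
    by (intro SUP_cong refl) (auto simp: cls_eq_iff cls_eq[of f] cls_eq[of g] intro: shuffle_map_mult_cong)
  also have "\<dots> = cls (f * g)" by (auto simp: cls_eq[of f] cls_eq[of g])
  finally show "mult NA (cls f) (cls g) = cls (f * g)" .
  have "smult NA c (cls f) = (\<Union>g\<in>cls f. cls (Poly_Mapping.single 0 c * g))"
    by (simp add: defs)
  also have "\<dots> = (\<Union>g\<in>cls f. cls (Poly_Mapping.single 0 c * f))"
    by (intro SUP_cong refl) (auto simp: cls_eq_iff cls_eq[of f] intro: shuffle_map_mult_cong)
  also have "\<dots> = cls (Poly_Mapping.single 0 c * f)" by (auto simp: cls_eq[of f])
  finally show "smult NA c (cls f) = cls (Poly_Mapping.single 0 c * f)" .
qed

lemma abelian_monoid_NA: "abelian_monoid NA"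
  by (rule abelian_monoidI) (auto simp: NA_simps add.assoc add.commute add.left_commute)

text \<open>The isomorphism from the Nichols algebra onto \<open>shuffle_alg q\<close>. Any
  representative will do, since the classes are the fibres of \<open>shuffle_map\<close>.\<close>

definition class_map :: "('n, 'k) tensor set \<Rightarrow> 'n list \<Rightarrow> 'k" where
  "class_map X = shuffle_map q (SOME f. f \<in> X)"

lemma class_map_cls: "class_map (cls f) = shuffle_map q f"
proof -
  have "f \<in> cls f" by (simp add: cls_eq)
  then have "(SOME f'. f' \<in> cls f) \<in> cls f" by (rule someI)
  then show ?thesis by (simp add: class_map_def cls_eq)
qed

lemma class_map_inj: "X \<in> carrier NA \<Longrightarrow> Y \<in> carrier NA \<Longrightarrow> class_map X = class_map Y \<longleftrightarrow> X = Y"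
  unfolding NA_simps(1) by (elim rangeE) (simp add: class_map_cls cls_eq_iff)

lemma class_map_carrier: "class_map ` carrier NA = shuffle_alg q"
proof (intro equalityI subsetI)
  fix x assume "x \<in> class_map ` carrier NA"
  then obtain f where x: "x = shuffle_map q f" by (auto simp: NA_simps class_map_cls)
  have "bword q w \<in> shuffle_alg q" for w by (induction w) (auto intro: shuffle_alg.intros)
  then show "x \<in> shuffle_alg q"
    unfolding x shuffle_map_def by (intro fs.subspace_sum[OF subspace_shuffle_alg] shuffle_alg_scale)
next
  fix x assume "x \<in> shuffle_alg q"
  then have "x \<in> range (shuffle_map q)"
  proof (induction rule: shuffle_alg.induct)
    case shuffle_alg_vac
    then show ?case using shuffle_map_one by (metis rangeI)
  next
    case (shuffle_alg_add f g)
    then show ?case by (auto simp flip: shuffle_map_add)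
  next
    case (shuffle_alg_scale f c)
    then obtain g where "f = shuffle_map q g" by blast
    then have "c *f f = shuffle_map q (Poly_Mapping.single 0 c * g)"
      by (simp add: shuffle_map_single_mult zero_word_def)
    then show ?case by blast
  next
    case (shuffle_alg_lmul f j)
    then obtain g where "f = shuffle_map q g" by blast
    then have "lmul q j f = shuffle_map q (Poly_Mapping.single (Word [j]) 1 * g)"
      by (simp add: shuffle_map_single_mult)
    then show ?case by blast
  qed
  then show "x \<in> class_map ` carrier NA" by (auto simp: NA_simps image_image class_map_cls)
qed

lemma class_map_smult: "X \<in> carrier NA \<Longrightarrow> class_map (smult NA c X) = c *f class_map X"
  and smult_closed: "X \<in> carrier NA \<Longrightarrow> smult NA c X \<in> carrier NA"
  by (auto simp: NA_simps class_map_cls shuffle_map_single_mult zero_word_def)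

lemma class_map_finsum:
  assumes "finite A" "v \<in> A \<rightarrow> carrier NA"
  shows "class_map (finsum NA v A) = (\<Sum>i\<in>A. class_map (v i))"
  using assms
proof (induction A rule: finite_induct)
  case empty
  then show ?case
    by (simp add: abelian_monoid.finsum_empty[OF abelian_monoid_NA] NA_simps class_map_cls)
next
  case (insert a A)
  then have c: "v a \<in> carrier NA" "v \<in> A \<rightarrow> carrier NA" by auto
  have "finsum NA v A \<in> carrier NA"
    by (rule abelian_monoid.finsum_closed[OF abelian_monoid_NA c(2)])
  then have "class_map (add NA (v a) (finsum NA v A)) = class_map (v a) + class_map (finsum NA v A)"
    using c(1) by (auto simp: NA_simps class_map_cls shuffle_map_add)
  moreover have "finsum NA v (insert a A) = add NA (v a) (finsum NA v A)"
    by (rule abelian_monoid.finsum_insert[OF abelian_monoid_NA insert.hyps c(2,1)])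
  ultimately show ?case using insert c by simp
qed

lemma nat_pow_cls: "cls f [^]\<^bsub>NA\<^esub> (n::nat) = cls (f ^ n)"
proof (induction n)
  case (Suc n)
  have "cls f [^]\<^bsub>NA\<^esub> Suc n = mult NA (cls f [^]\<^bsub>NA\<^esub> n) (cls f)" by (simp add: nat_pow_def)
  then show ?case by (simp add: Suc NA_simps power_commutes)
qed (simp add: nat_pow_def NA_simps)

lemma basis_family_class_map:
  assumes "basis_family NA E mn" "x \<in> shuffle_alg q"
  shows "\<exists>!c. finite {i. c i \<noteq> 0} \<and> {i. c i \<noteq> 0} \<subseteq> E \<and>
    x = (\<Sum>i | c i \<noteq> 0. c i *f class_map (mn i))"
proof -
  obtain X where X: "X \<in> carrier NA" "x = class_map X" using assms(2) class_map_carrier by blast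
  have mn: "mn i \<in> carrier NA" if "i \<in> E" for i
    using assms(1) that by (auto simp: basis_family_def)
  have eq: "X = finsum NA (\<lambda>i. smult NA (c i) (mn i)) {i. c i \<noteq> 0} \<longleftrightarrow>
      x = (\<Sum>i | c i \<noteq> 0. c i *f class_map (mn i))"
    if c: "finite {i. c i \<noteq> 0}" "{i. c i \<noteq> 0} \<subseteq> E" for c
  proof -
    have cl: "(\<lambda>i. smult NA (c i) (mn i)) \<in> {i. c i \<noteq> 0} \<rightarrow> carrier NA"
      using c(2) mn smult_closed by blast
    have "finsum NA (\<lambda>i. smult NA (c i) (mn i)) {i. c i \<noteq> 0} \<in> carrier NA"
      by (rule abelian_monoid.finsum_closed[OF abelian_monoid_NA cl])
    then have "X = finsum NA (\<lambda>i. smult NA (c i) (mn i)) {i. c i \<noteq> 0} \<longleftrightarrow>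
        class_map X = class_map (finsum NA (\<lambda>i. smult NA (c i) (mn i)) {i. c i \<noteq> 0})"
      using class_map_inj X(1) by blast
    also have "class_map (finsum NA (\<lambda>i. smult NA (c i) (mn i)) {i. c i \<noteq> 0}) =
        (\<Sum>i | c i \<noteq> 0. class_map (smult NA (c i) (mn i)))"
      by (rule class_map_finsum[OF c(1) cl])
    also have "\<dots> = (\<Sum>i | c i \<noteq> 0. c i *f class_map (mn i))"
      using c(2) mn class_map_smult by (intro sum.cong) auto
    finally show ?thesis using X(2) by simp
  qed
  have "\<forall>X\<in>carrier NA. \<exists>!c. finite {i. c i \<noteq> 0} \<and> {i. c i \<noteq> 0} \<subseteq> E \<and>
      X = finsum NA (\<lambda>i. smult NA (c i) (mn i)) {i. c i \<noteq> 0}"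
    using assms(1) unfolding basis_family_def by (rule conjunct2)
  from bspec[OF this X(1)]
  have "\<exists>!c. finite {i. c i \<noteq> 0} \<and> {i. c i \<noteq> 0} \<subseteq> E \<and>
      X = finsum NA (\<lambda>i. smult NA (c i) (mn i)) {i. c i \<noteq> 0}" .
  moreover have "(finite {i. c i \<noteq> 0} \<and> {i. c i \<noteq> 0} \<subseteq> E \<and>
      X = finsum NA (\<lambda>i. smult NA (c i) (mn i)) {i. c i \<noteq> 0}) \<longleftrightarrow>
    (finite {i. c i \<noteq> 0} \<and> {i. c i \<noteq> 0} \<subseteq> E \<and>
      x = (\<Sum>i | c i \<noteq> 0. c i *f class_map (mn i)))" for c
    by (intro conj_cong refl eq)
  ultimately show ?thesis by (simp only:)
qed

end

text \<open>The members of degree \<open>d\<close> of a homogeneous basis form a basis of that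
  component: uniqueness of coefficients gives independence, and projecting an expansion to degree
  \<open>d\<close> gives generation.\<close>

lemma basis_family_dimB:
  fixes q :: "'n::finite \<Rightarrow> 'n \<Rightarrow> 'k::field"
  assumes B: "basis_family (nichols_algebra q) E mn"
    and dg: "\<And>i. i \<in> E \<Longrightarrow> class_map q (mn i) \<in> hcomp (dg i)"
  shows "finite {i \<in> E. dg i = d}" "dimB q d = card {i \<in> E. dg i = d}"
    and "\<And>i. i \<in> E \<Longrightarrow> class_map q (mn i) \<noteq> 0"
proof -
  let ?e = "\<lambda>i. class_map q (mn i)"
  have uniq: "c = c'"
    if "finite {i. c i \<noteq> 0}" "{i. c i \<noteq> 0} \<subseteq> E" "finite {i. c' i \<noteq> 0}" "{i. c' i \<noteq> 0} \<subseteq> E"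
      "(\<Sum>i | c i \<noteq> 0. c i *f ?e i) = (\<Sum>i | c' i \<noteq> 0. c' i *f ?e i)"
      "(\<Sum>i | c i \<noteq> 0. c i *f ?e i) \<in> shuffle_alg q" for c c'
  proof -
    define x where "x = (\<Sum>i | c i \<noteq> 0. c i *f ?e i)"
    define P where "P c \<longleftrightarrow> finite {i. c i \<noteq> 0} \<and> {i. c i \<noteq> 0} \<subseteq> E \<and>
      x = (\<Sum>i | c i \<noteq> 0. c i *f ?e i)" for c
    have "\<exists>!c. P c" unfolding P_def x_def by (rule basis_family_class_map[OF B that(6)])
    moreover have "P c" unfolding P_def x_def by (intro conjI that refl)
    moreover have "P c'" unfolding P_def x_def by (intro conjI that)
    ultimately show ?thesis by blast
  qed
  have e_shuffle_alg: "?e i \<in> shuffle_alg q" if "i \<in> E" for i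
    using B that class_map_carrier by (auto simp: basis_family_def)
  have indep: "c = (\<lambda>_. 0)"
    if c: "finite {i. c i \<noteq> 0}" "{i. c i \<noteq> 0} \<subseteq> E" "(\<Sum>i | c i \<noteq> 0. c i *f ?e i) = 0" for c
    by (rule uniq) (use c shuffle_alg_zero in auto)
  show nz: "?e i \<noteq> 0" if "i \<in> E" for i
  proof
    assume "?e i = 0"
    then have "(\<lambda>j. if j = i then 1 else 0 :: 'k) = (\<lambda>_. 0)"
      using that by (intro indep) auto
    from fun_cong[OF this, of i] show False by simp
  qed
  have inj: "inj_on ?e E"
  proof (rule inj_onI, rule ccontr)
    fix i j assume ij: "i \<in> E" "j \<in> E" "?e i = ?e j" "i \<noteq> j"
    let ?c = "\<lambda>l. if l = i then 1 else if l = j then -1 else 0 :: 'k"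
    have s: "{l. ?c l \<noteq> 0} = {i, j}" by auto
    have "?c = (\<lambda>_. 0)"
      by (rule indep) (unfold s, use ij in auto)
    from fun_cong[OF this, of i] show False by simp
  qed
  let ?Ed = "{i \<in> E. dg i = d}"
  have ind: "fs.independent (?e ` ?Ed)"
    unfolding fs.independent_explicit_finite_subsets
  proof (intro allI impI ballI)
    fix T u v assume T: "T \<subseteq> ?e ` ?Ed" "finite T" "(\<Sum>v\<in>T. u v *f v) = 0" "v \<in> T"
    let ?I = "{i \<in> ?Ed. ?e i \<in> T}"
    define c where "c i = (if i \<in> ?I then u (?e i) else 0)" for i
    have injI: "inj_on ?e ?I" using inj by (rule inj_on_subset) auto
    have img: "?e ` ?I = T" using T(1) by auto
    then have fI: "finite ?I" by (intro finite_imageD[OF _ injI]) (simp only: T(2))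
    have sub: "{i. c i \<noteq> 0} \<subseteq> ?I" by (auto simp: c_def)
    have "(\<Sum>i | c i \<noteq> 0. c i *f ?e i) = (\<Sum>i\<in>?I. c i *f ?e i)"
      by (rule sum.mono_neutral_left[OF fI sub]) auto
    also have "\<dots> = (\<Sum>i\<in>?I. u (?e i) *f ?e i)" by (rule sum.cong) (auto simp: c_def)
    also have "\<dots> = (\<Sum>v\<in>T. u v *f v)" using sum.reindex[OF injI, of "\<lambda>v. u v *f v"] img by simp
    finally have "c = (\<lambda>_. 0)"
      using T(3) sub fI by (intro indep) (auto intro: finite_subset)
    moreover obtain i where "i \<in> ?I" "v = ?e i" using T(4) img by blast
    then have "c i = u v" by (simp add: c_def)
    ultimately show "u v = 0" by simp
  qed
  have sub: "?e ` ?Ed \<subseteq> shuffle_alg q \<inter> hcomp d" using e_shuffle_alg dg by blast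
  have span: "shuffle_alg q \<inter> hcomp d \<subseteq> fs.span (?e ` ?Ed)"
  proof
    fix x assume x: "x \<in> shuffle_alg q \<inter> hcomp d"
    then obtain c where c: "finite {i. c i \<noteq> 0}" "{i. c i \<noteq> 0} \<subseteq> E"
      "x = (\<Sum>i | c i \<noteq> 0. c i *f ?e i)"
      using basis_family_class_map[OF B] by blast
    have "x = proj d x" using x by (simp add: hcomp_iff_proj)
    also have "\<dots> = (\<Sum>i | c i \<noteq> 0. c i *f proj d (?e i))"
      unfolding c(3) lin_sum[OF lin_proj] by simp
    also have "\<dots> \<in> fs.span (?e ` ?Ed)"
    proof (intro fs.span_sum fs.span_scale)
      fix i assume "i \<in> {i. c i \<noteq> 0}"
      then have i: "i \<in> E" using c(2) by blast
      show "proj d (?e i) \<in> fs.span (?e ` ?Ed)"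
      proof (cases "dg i = d")
        case True
        then have "proj d (?e i) = ?e i" using dg[OF i] by (simp add: hcomp_iff_proj)
        then show ?thesis using i True by (intro fs.span_base) auto
      next
        case False
        then have "proj d (?e i) = 0"
          using dg[OF i] by (auto simp: proj_def hcomp_def fun_eq_iff pointwise)
        then show ?thesis by (simp add: fs.span_zero)
      qed
    qed
    finally show "x \<in> fs.span (?e ` ?Ed)" .
  qed
  have injd: "inj_on ?e ?Ed" using inj by (rule inj_on_subset) auto
  obtain W where W: "finite W" "(hcomp d :: ('n list \<Rightarrow> 'k) set) \<subseteq> fs.span W"
    using hcomp_finite_span by blast
  then have "?e ` ?Ed \<subseteq> fs.span W" using sub by blast
  then have "finite (?e ` ?Ed)" by (rule fs.independent_span_bound[OF W(1) ind, THEN conjunct1])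
  then show "finite ?Ed" by (rule finite_imageD[OF _ injd])
  show "dimB q d = card ?Ed"
    using fs.basis_card_eq_dim[OF sub span ind] card_image[OF injd] by (simp add: dimB_def)
qed

section \<open>Counting PBW monomials\<close>

lemma shuffle_map_hcomp:
  fixes q :: "'n::finite \<Rightarrow> 'n \<Rightarrow> 'k::field"
  assumes "f \<in> tensor_component d"
  shows "shuffle_map q f \<in> hcomp d"
  unfolding shuffle_map_def
proof (intro fs.subspace_sum[OF subspace_hcomp] fs.subspace_scale[OF subspace_hcomp])
  fix w assume "w \<in> Poly_Mapping.keys f"
  then have "word_degree w = d" using assms by (simp add: tensor_component_def)
  then have "wdeg (letters w) = d" by (simp add: word_degree_def wdeg_def)
  then show "bword q (letters w) \<in> hcomp d" using bword_hcomp by metis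
qed

lemma tensor_component_mult:
  "f \<in> tensor_component d \<Longrightarrow> g \<in> tensor_component e \<Longrightarrow> f * g \<in> tensor_component (d + e)"
  using keys_mult[of f g]
  by (auto simp: tensor_component_def word_degree_def letters_add subset_iff)

lemma tensor_component_one: "1 \<in> tensor_component 0"
  unfolding single_one[symmetric] by (simp add: tensor_component_def word_degree_def zero_word_def)

lemma tensor_component_power:
  "f \<in> tensor_component d \<Longrightarrow> f ^ n \<in> tensor_component (int n *s d)"
proof (induction n)
  case 0
  have "0 *s d = 0" by (simp add: vec_eq_iff)
  then show ?case by (simp add: tensor_component_one)
next
  case (Suc n)
  have "int (Suc n) *s d = d + int n *s d" by (simp add: vec_eq_iff distrib_right)
  then show ?case using Suc by (simp add: tensor_component_mult)
qed

lemma pbw_monomial_component: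
  fixes q :: "'n::finite \<Rightarrow> 'n \<Rightarrow> 'k::field"
  assumes "\<forall>(u, a) \<in> set us. u \<in> nichols_component q (dg u)"
  shows "\<exists>g \<in> tensor_component (\<Sum>(u, a)\<leftarrow>us. int a *s dg u).
    pbw_monomial (nichols_algebra q) us = nichols_class q g"
  using assms
proof (induction us)
  case Nil
  show ?case
    by (rule bexI[of _ 1]) (simp_all add: pbw_monomial_def NA_simps tensor_component_one)
next
  case (Cons x us)
  obtain u a where x: "x = (u, a)" by (cases x)
  obtain g where g: "g \<in> tensor_component (\<Sum>(u, a)\<leftarrow>us. int a *s dg u)"
    "pbw_monomial (nichols_algebra q) us = nichols_class q g" using Cons by auto
  obtain f where f: "f \<in> tensor_component (dg u)" "u = nichols_class q f"
    using Cons.prems x by (auto simp: nichols_component_def)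
  have "pbw_monomial (nichols_algebra q) (x # us) = nichols_class q (f ^ a * g)"
    using g(2) f(2) by (simp add: pbw_monomial_def x nat_pow_cls NA_simps)
  moreover have "f ^ a * g \<in> tensor_component (\<Sum>(u, a)\<leftarrow>x # us. int a *s dg u)"
    using tensor_component_mult[OF tensor_component_power[OF f(1)] g(1)] by (simp add: x)
  ultimately show ?case by blast
qed

subsection \<open>Sorting with respect to a linear order\<close>

lemma sorted_wrt_unique:
  assumes "antisym r" "set xs = set ys"
    and "sorted_wrt (\<lambda>u v. (v, u) \<in> r \<and> u \<noteq> v) xs" "sorted_wrt (\<lambda>u v. (v, u) \<in> r \<and> u \<noteq> v) ys"
  shows "xs = ys"
  using assms(2-)
proof (induction xs arbitrary: ys)
  case (Cons x xs)
  then obtain y zs where ys: "ys = y # zs" by (cases ys) auto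
  have "x = y"
  proof (rule ccontr)
    assume ne: "x \<noteq> y"
    then have "x \<in> set zs" "y \<in> set xs" using Cons.prems(1) ys by auto
    then have "(x, y) \<in> r" "(y, x) \<in> r" using Cons.prems ys by auto
    then show False using ne assms(1) by (auto dest: antisymD)
  qed
  moreover have "x \<notin> set xs" "y \<notin> set zs" using Cons.prems ys by auto
  ultimately have "set xs = set zs" using Cons.prems(1) ys by auto
  then show ?case using Cons ys \<open>x = y\<close> by auto
qed simp

lemma sorted_wrt_exists:
  assumes "linear_order_on S r" "finite A" "A \<subseteq> S"
  shows "\<exists>xs. set xs = A \<and> sorted_wrt (\<lambda>u v. (v, u) \<in> r \<and> u \<noteq> v) xs"
  using assms(2,3)
proof (induction "card A" arbitrary: A rule: less_induct)
  case less
  have tr: "trans r" and tot: "total_on S r" and re: "\<forall>x\<in>S. (x, x) \<in> r"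
    using assms(1) by (auto simp: order_on_defs refl_on_def)
  show ?case
  proof (cases "A = {}")
    case False
    have "\<exists>m\<in>A. \<forall>y\<in>A. (y, m) \<in> r"
      using less.prems(1) False less.prems(2)
    proof (induction A rule: finite_ne_induct)
      case (singleton x)
      then show ?case using re by auto
    next
      case (insert x F)
      then obtain m where m: "m \<in> F" "\<forall>y\<in>F. (y, m) \<in> r" by auto
      have "x \<in> S" "m \<in> S" using insert m by auto
      show ?case
      proof (cases "(x, m) \<in> r")
        case True
        then show ?thesis using m by auto
      next
        case False
        then have "(m, x) \<in> r" using tot re \<open>x \<in> S\<close> \<open>m \<in> S\<close> by (metis total_on_def)
        then show ?thesis using m re \<open>x \<in> S\<close> tr by (metis insertE insertI1 transD)
      qed
    qed
    then obtain m where m: "m \<in> A" "\<forall>y\<in>A. (y, m) \<in> r" by blast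
    have "card (A - {m}) < card A" using m less.prems by (intro psubset_card_mono) auto
    then obtain xs where "set xs = A - {m}" "sorted_wrt (\<lambda>u v. (v, u) \<in> r \<and> u \<noteq> v) xs"
      using less.hyps[of "A - {m}"] less.prems by auto
    then show ?thesis using m by (intro exI[of _ "m # xs"]) auto
  qed simp
qed

text \<open>A decreasing list with positive exponents is its exponent function, extended by 0; the
  value 0 is admissible since \<open>0 < h u\<close>.\<close>

lemma pbw_exponents_count:
  fixes h :: "'b \<Rightarrow> enat" and dg :: "'b \<Rightarrow> int ^ 'n::finite"
  assumes lin: "linear_order_on S r" and fin: "finite S" and h: "\<forall>u\<in>S. 0 < h u"
  shows "card {us \<in> pbw_exponents S r h. (\<Sum>(u, a)\<leftarrow>us. int a *s dg u) = d} = card (exponents S h dg d)"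
proof -
  let ?R = "\<lambda>u v. (v, u) \<in> r \<and> u \<noteq> v"
  let ?A = "{us \<in> pbw_exponents S r h. (\<Sum>(u, a)\<leftarrow>us. int a *s dg u) = d}"
  define ev :: "('b \<times> nat) list \<Rightarrow> 'b \<Rightarrow> nat"
    where "ev us u = (case map_of us u of None \<Rightarrow> 0 | Some a \<Rightarrow> a)" for us u
  have asym: "antisym r" using lin by (auto simp: order_on_defs)
  have sorted: "sorted_wrt ?R (map fst us)" if "us \<in> pbw_exponents S r h" for us
    using that by (simp add: pbw_exponents_def sorted_wrt_map case_prod_unfold)
  have dist: "distinct (map fst us)" if "us \<in> pbw_exponents S r h" for us
  proof -
    have "distinct xs" if "sorted_wrt ?R xs" for xs using that by (induction xs) auto
    then show ?thesis using sorted[OF that] by blast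
  qed
  have ev_in: "ev us u = a" if "us \<in> pbw_exponents S r h" "(u, a) \<in> set us" for us u a
    using that dist by (simp add: ev_def map_of_is_SomeI)
  have ev_out: "ev us u = 0" if "u \<notin> fst ` set us" for us u
    using that by (simp add: ev_def map_of_eq_None_iff[THEN iffD2])
  have supp: "{u. ev us u \<noteq> 0} = fst ` set us" if us: "us \<in> pbw_exponents S r h" for us
  proof (intro equalityI subsetI)
    fix u assume "u \<in> fst ` set us"
    then obtain a where a: "(u, a) \<in> set us" by auto
    then have "0 < a" using us by (auto simp: pbw_exponents_def)
    then show "u \<in> {u. ev us u \<noteq> 0}" using ev_in[OF us a] by simp
  next
    fix u assume "u \<in> {u. ev us u \<noteq> 0}"
    then show "u \<in> fst ` set us" using ev_out[of u us] by auto
  qed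
  have us_eq: "us = map (\<lambda>u. (u, ev us u)) (map fst us)" if us: "us \<in> pbw_exponents S r h" for us
    unfolding map_map by (rule map_idI[symmetric]) (use ev_in[OF us] in \<open>auto simp: comp_def\<close>)
  have sum: "(\<Sum>(u, a)\<leftarrow>map (\<lambda>u. (u, b u)) xs. int a *s dg u) = (\<Sum>u\<in>S. int (b u) *s dg u)"
    if "distinct xs" "set xs \<subseteq> S" "\<forall>u\<in>S - set xs. b u = 0" for xs b
  proof -
    have z: "0 *s v = (0 :: int ^ 'n)" for v by (simp add: vec_eq_iff)
    have "(\<Sum>(u, a)\<leftarrow>map (\<lambda>u. (u, b u)) xs. int a *s dg u) = (\<Sum>u\<in>set xs. int (b u) *s dg u)"
      using that(1) by (simp add: comp_def sum_list_distinct_conv_sum_set)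
    also have "\<dots> = (\<Sum>u\<in>S. int (b u) *s dg u)"
      using that z by (intro sum.mono_neutral_left[OF fin]) auto
    finally show ?thesis .
  qed
  have "bij_betw ev ?A (exponents S h dg d)"
    unfolding bij_betw_def
  proof (intro conjI equalityI subsetI)
    show "inj_on ev ?A"
    proof (rule inj_onI)
      fix us vs assume us: "us \<in> ?A" and vs: "vs \<in> ?A" and e: "ev us = ev vs"
      then have "set (map fst us) = set (map fst vs)" using supp[of us] supp[of vs] by simp
      then have m: "map fst us = map fst vs"
        using sorted_wrt_unique[OF asym] sorted us vs by blast
      have "us = map (\<lambda>u. (u, ev us u)) (map fst us)" using us by (intro us_eq) simp
      also have "\<dots> = map (\<lambda>u. (u, ev vs u)) (map fst vs)" by (simp only: e m)
      also have "\<dots> = vs" using vs by (intro us_eq[symmetric]) simp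
      finally show "us = vs" .
    qed
    fix b assume "b \<in> ev ` ?A"
    then obtain us where us: "us \<in> pbw_exponents S r h" "(\<Sum>(u, a)\<leftarrow>us. int a *s dg u) = d"
      and b: "b = ev us" by auto
    have S: "fst ` set us \<subseteq> S" using us by (auto simp: pbw_exponents_def)
    have "enat (b u) < h u" if "u \<in> S" for u
    proof (cases "u \<in> fst ` set us")
      case True
      then obtain a where "(u, a) \<in> set us" by auto
      then show ?thesis using ev_in[OF us(1)] us(1) b by (auto simp: pbw_exponents_def)
    next
      case False
      then show ?thesis using ev_out b h that by (simp add: zero_enat_def[symmetric])
    qed
    moreover have "(\<Sum>u\<in>S. int (b u) *s dg u) = d"
    proof -
      have "(\<Sum>(u, a)\<leftarrow>map (\<lambda>u. (u, b u)) (map fst us). int a *s dg u) = (\<Sum>u\<in>S. int (b u) *s dg u)"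
        using S ev_out b by (intro sum dist[OF us(1)]) auto
      moreover have "map (\<lambda>u. (u, b u)) (map fst us) = us"
        unfolding b by (rule us_eq[OF us(1), symmetric])
      ultimately show ?thesis using us(2) by (simp only:)
    qed
    moreover have "b u = 0" if "u \<notin> S" for u
      using that S ev_out[of u us] b by auto
    ultimately show "b \<in> exponents S h dg d" by (simp add: exponents_def)
  next
    fix b assume b: "b \<in> exponents S h dg d"
    obtain xs where xs: "set xs = {u \<in> S. b u \<noteq> 0}" "sorted_wrt ?R xs"
      using sorted_wrt_exists[OF lin, of "{u \<in> S. b u \<noteq> 0}"] fin by auto
    have dxs: "distinct xs" using xs(2) by (induction xs) auto
    let ?us = "map (\<lambda>u. (u, b u)) xs"
    have 1: "?us \<in> pbw_exponents S r h"
      using b xs by (auto simp: pbw_exponents_def exponents_def sorted_wrt_map)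
    moreover have "(\<Sum>(u, a)\<leftarrow>?us. int a *s dg u) = d"
      using b xs(1) by (subst sum[OF dxs]) (auto simp: exponents_def)
    moreover have "ev ?us = b"
    proof
      fix u
      show "ev ?us u = b u"
      proof (cases "u \<in> set xs")
        case True
        then show ?thesis using ev_in[OF 1, of u "b u"] by auto
      next
        case False
        then have "b u = 0" using b xs(1) by (auto simp: exponents_def)
        then show ?thesis using ev_out[of u ?us] False by force
      qed
    qed
    ultimately show "b \<in> ev ` ?A" by (intro image_eqI[of _ _ ?us]) simp_all
  qed
  then show ?thesis by (rule bij_betw_same_card)
qed

lemma pbw_rootsys:
  fixes q :: "'n::finite \<Rightarrow> 'n \<Rightarrow> 'k::field_char_0"
  assumes q: "\<forall>i j. q i j \<noteq> 0" and pbw: "graded_pbw_basis q S r h"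
    and ht: "height_property q S h" and fin: "finite (roots q S)"
  shows "\<exists>dg. rootsys q S h dg \<and> (\<forall>u\<in>S. \<forall>d. u \<in> nichols_component q d \<longleftrightarrow> d = dg u)"
proof -
  have lin: "linear_order_on S r" and h2: "\<forall>u\<in>S. 2 \<le> h u"
    and comp: "\<forall>u\<in>S. \<exists>d. u \<in> nichols_component q d"
    and B: "basis_family (nichols_algebra q) (pbw_exponents S r h) (pbw_monomial (nichols_algebra q))"
    using pbw by (auto simp: graded_pbw_basis_def)
  define dg where "dg u = (SOME d. u \<in> nichols_component q d)" for u
  have dg: "u \<in> nichols_component q (dg u)" if "u \<in> S" for u
    unfolding dg_def using comp that by (meson someI_ex)
  let ?E = "pbw_exponents S r h"
  let ?dg = "\<lambda>us. \<Sum>(u, a)\<leftarrow>us. int a *s dg u"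
  have omE: "class_map q (pbw_monomial (nichols_algebra q) us) \<in> hcomp (?dg us)" if "us \<in> ?E" for us
  proof -
    have "\<forall>(u, a) \<in> set us. u \<in> nichols_component q (dg u)"
      using that dg by (auto simp: pbw_exponents_def)
    from pbw_monomial_component[OF this] show ?thesis
      using shuffle_map_hcomp by (auto simp: class_map_cls)
  qed
  have count: "finite {us \<in> ?E. ?dg us = d}" "dimB q d = card {us \<in> ?E. ?dg us = d}" for d
    by (rule basis_family_dimB[OF B omE]; assumption)+
  have mono_nz: "class_map q (pbw_monomial (nichols_algebra q) us) \<noteq> 0" if "us \<in> ?E" for us
    by (rule basis_family_dimB(3)[OF B omE that])
  have single: "[(u, 1)] \<in> ?E" if "u \<in> S" for u
  proof -
    have "enat 1 < 2" by (simp add: numeral_eq_enat)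
    then have "enat 1 < h u" using h2 that order_less_le_trans by blast
    then show ?thesis using that by (simp add: pbw_exponents_def)
  qed
  have deg_single: "?dg [(u, 1)] = dg u" for u by (simp add: vec_eq_iff)
  have class_map_u: "class_map q u \<noteq> 0" if u: "u \<in> S" for u
  proof -
    obtain f where "u = nichols_class q f" using dg[OF u] by (auto simp: nichols_component_def)
    then have "pbw_monomial (nichols_algebra q) [(u, 1)] = u"
      by (simp add: pbw_monomial_def nat_pow_cls[of q _ 1, simplified] NA_simps)
    then show ?thesis using mono_nz[OF single[OF u]] by simp
  qed
  have class_map_comp: "class_map q u \<in> hcomp d" if "u \<in> nichols_component q d" for u d
    using that shuffle_map_hcomp by (auto simp: nichols_component_def class_map_cls)
  have dg_eq: "d = dg u" if u: "u \<in> S" "u \<in> nichols_component q d" for u d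
  proof (rule ccontr)
    assume ne: "d \<noteq> dg u"
    have "class_map q u w = 0" for w
      using class_map_comp[OF u(2)] class_map_comp[OF dg[OF u(1)]] ne by (cases "wdeg w = d") (auto simp: hcomp_def)
    then show False using class_map_u[OF u(1)] by (auto simp: fun_eq_iff pointwise)
  qed
  \<comment> \<open>\<open>roots\<close> forgets multiplicities, so it must also be seen that each
    degree has finitely many generators: they inject into the PBW monomials of that degree, which
    form a basis of a finite-dimensional component.\<close>
  have finS: "finite S"
  proof -
    have fd: "finite (S \<inter> nichols_component q d)" for d
    proof -
      have "(\<lambda>u. [(u, 1)]) ` (S \<inter> nichols_component q d) \<subseteq> {us \<in> ?E. ?dg us = d}"
        using single dg_eq deg_single by auto
      then have "finite ((\<lambda>u. [(u, 1::nat)]) ` (S \<inter> nichols_component q d))"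
        using count(1) finite_subset by blast
      then show ?thesis by (rule finite_imageD) (auto simp: inj_on_def)
    qed
    have "finite (pos_roots q S)" using fin by (simp add: roots_def)
    moreover have "S \<subseteq> (\<Union>d\<in>pos_roots q S. S \<inter> nichols_component q d)"
    proof
      fix u assume u: "u \<in> S"
      then have "u \<in> S \<inter> nichols_component q (dg u)" using dg by blast
      moreover have "dg u \<in> pos_roots q S"
        using u dg[OF u] fd[of "dg u"] by (auto simp: pos_roots_def pos_mult_def zero_enat_def)
      ultimately show "u \<in> (\<Union>d\<in>pos_roots q S. S \<inter> nichols_component q d)" by blast
    qed
    ultimately show ?thesis using fd finite_subset by (metis (no_types, lifting) finite_UN_I)
  qed
  have "0 \<le> dg u $ k" if u: "u \<in> S" for u k
    using class_map_comp[OF dg[OF u]] class_map_u[OF u] hcomp_negative[of "dg u" k "class_map q u"] by force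
  moreover have "dg u \<noteq> 0" if u: "u \<in> S" for u
  proof
    assume z: "dg u = 0"
    \<comment> \<open>Besides the empty monomial, \<open>u\<close> would be a second monomial of
      degree 0, where the dimension is at most 1.\<close>
    then have sub: "{[], [(u, 1)]} \<subseteq> {us \<in> ?E. ?dg us = 0}"
      using single[OF u] deg_single[of u] by (auto simp: pbw_exponents_def)
    have "2 \<le> dimB q 0" using card_mono[OF count(1) sub] count(2)[of 0] by simp
    moreover have "dimB q 0 \<le> 1" using dimB_axis[of q undefined 0] by (simp split: if_splits)
    ultimately show False by simp
  qed
  moreover have "h u = pbw_height (bichar q (dg u) (dg u))" if u: "u \<in> S" for u
    using ht u dg[OF u] unfolding height_property_def pbw_height_def by (metis IntI enat_ord_simps(4))
  moreover have "dimB q d = card (exponents S h dg d)" for d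
    unfolding count(2) using h2 by (intro pbw_exponents_count lin finS) (metis gr_zeroI not_numeral_le_zero)
  ultimately have "rootsys q S h dg" using finS by (simp add: rootsys_def)
  then show ?thesis using dg dg_eq by blast
qed

theorem corollary2:
  fixes q :: "'n::finite \<Rightarrow> 'n \<Rightarrow> 'k::field_char_0"
    and S :: "('n, 'k) tensor set set"
    and r :: "('n, 'k) tensor set rel"
    and h :: "('n, 'k) tensor set \<Rightarrow> enat"
  assumes "\<forall>i j. q i j \<noteq> 0"
    and "graded_pbw_basis q S r h"
    and "height_property q S h"
    and "finite (roots q S)"
  shows "(\<forall>\<beta> \<in> roots q S. root_mult q S \<beta> = 1) \<and>
    (\<forall>\<alpha> \<in> pos_roots q S. \<forall>t::real. t \<noteq> 1 \<longrightarrow>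
      \<not> (\<exists>\<beta> \<in> pos_roots q S. real_vec \<beta> = t *\<^sub>R real_vec \<alpha>))"
proof -
  obtain dg where rs: "rootsys q S h dg"
    and dg: "\<And>u d. u \<in> S \<Longrightarrow> u \<in> nichols_component q d \<longleftrightarrow> d = dg u"
    using pbw_rootsys[OF assms] by blast
  have q: "braiding q" using assms(1) by (simp add: braiding_def)
  have pos: "0 \<le> dg u $ k" "dg u \<noteq> 0" if "u \<in> S" for u k
    using rs that by (auto simp: rootsys_def)
  have prp: "u = v" if "u \<in> S" "v \<in> S" "a \<noteq> 0" "a *s dg u = b *s dg v" for u v a b
    by (rule roots_not_proportional[OF q rs that(2,1,3,4)])
  have eq: "u = v" if "u \<in> S" "v \<in> S" "dg u = dg v" for u v
    using prp[of u v 1 1] that by simp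
  have pm: "pos_mult q S (dg u) = 1" if u: "u \<in> S" for u
  proof -
    have "S \<inter> nichols_component q (dg u) = {u}" using u dg eq by auto
    then show ?thesis by (simp add: pos_mult_def one_enat_def)
  qed
  have none: "pos_mult q S d = 0" if "\<forall>u\<in>S. d \<noteq> dg u" for d
  proof -
    have "S \<inter> nichols_component q d = {}" using that dg by blast
    then show ?thesis by (simp add: pos_mult_def zero_enat_def)
  qed
  have roots: "d \<in> pos_roots q S \<longleftrightarrow> (\<exists>u\<in>S. d = dg u)" for d
    using pm none by (auto simp: pos_roots_def)
  have neg: "pos_mult q S (- dg u) = 0" if u: "u \<in> S" for u
  proof (rule none, intro ballI notI)
    fix v assume v: "v \<in> S" "- dg u = dg v"
    obtain k where "dg u $ k \<noteq> 0" using nonzero_component pos(2)[OF u] by blast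
    then have "dg v $ k < 0"
      using pos(1)[OF u, of k] v(2)[symmetric] by simp
    then show False using pos(1)[OF v(1), of k] by simp
  qed
  have "root_mult q S d = 1" if "d \<in> roots q S" for d
  proof -
    have "\<exists>u\<in>S. d = dg u \<or> d = - dg u" using that by (auto simp: roots_def roots)
    then obtain u where "u \<in> S" "d = dg u \<or> d = - dg u" by blast
    then show ?thesis using pm neg by (auto simp: root_mult_def)
  qed
  moreover have False if \<alpha>: "\<alpha> \<in> pos_roots q S" and \<beta>: "\<beta> \<in> pos_roots q S"
    and t: "t \<noteq> 1" and e: "real_vec \<beta> = t *\<^sub>R real_vec \<alpha>" for \<alpha> \<beta> and t :: real
  proof -
    obtain u v where u: "u \<in> S" "\<alpha> = dg u" and v: "v \<in> S" "\<beta> = dg v" using \<alpha> \<beta> roots by auto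
    obtain k where k: "\<alpha> $ k \<noteq> 0" using nonzero_component pos(2) u by blast
    have c: "real_of_int (\<beta> $ j) = t * real_of_int (\<alpha> $ j)" for j
      using arg_cong[OF e, of "\<lambda>x. x $ j"] by (simp add: real_vec_def)
    \<comment> \<open>Cross-multiplying with the coordinate \<open>k\<close> eliminates the real
      factor \<open>t\<close> and leaves an integral relation, to which \<open>prp\<close>
      applies.\<close>
    have "real_of_int (\<alpha> $ k * \<beta> $ j) = real_of_int (\<beta> $ k * \<alpha> $ j)" for j
      by (simp add: c)
    then have "\<alpha> $ k * \<beta> $ j = \<beta> $ k * \<alpha> $ j" for j by (simp only: of_int_eq_iff)
    then have "(\<alpha> $ k) *s dg v = (\<beta> $ k) *s dg u" using u v by (simp add: vec_eq_iff)
    then have "v = u" by (rule prp[OF v(1) u(1) k])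
    then have "\<beta> = \<alpha>" using u v by simp
    then show False using c[of k] k t by simp
  qed
  ultimately show ?thesis by blast
qed

end
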